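(* Let $G$ be a graph of order $n$ with no isolated vertices, where $n\ge 6$. (i) If $n=6$ and $q(G)\ge q(K_1\vee (K_4\cup K_1))$, then $G$ contains a trebly chorded cycle with three chords incident to a vertex, unless $G\cong K_1\vee (K_4\cup K_1)$. (ii) If $n\ge 7$ and $q(G)\ge q(K_{1,1,n-2}^+)$, then $G$ contains a trebly chorded cycle with three chords incident to a vertex, unless $G\cong K_{1,1,n-2}^+$.
   Context: All graphs are finite and simple. For a graph $G$, $Q(G)=D(G)+A(G)$ is the signless Laplacian matrix, where $A(G)$ is the adjacency matrix and $D(G)$ the diagonal matrix of vertex degrees; $q(G)$ denotes the largest eigenvalue of $Q(G)$ (the signless Laplacian index). A chord of a cycle $C$ is an edge joining two non-consecutive vertices of $C$. "$G$ contains a trebly chorded cycle with three chords incident to a vertex" means that $G$ has a cycle $C$ and three distinct edges of $G$, each a chord of $C$, all sharing a common endpoint. $K_m$ is the complete graph on $m$ vertices; $G\cup H$ is the disjoint union and $G\vee H$ the join (disjoint union plus all edges between $V(G)$ and $V(H)$). $K_{1,1,n-2}$ is the complete tripartite graph with parts of sizes $1,1,n-2$, and $K_{1,1,n-2}^+$ is obtained from it by adding one edge inside the part of size $n-2$. *)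

theory Defs
  imports "Jordan_Normal_Form.Char_Poly"
begin

definition simple_graph :: "nat \<Rightarrow> nat set set \<Rightarrow> bool" where
  "simple_graph n E \<longleftrightarrow> (\<forall>e\<in>E. \<exists>u v. e = {u, v} \<and> u \<noteq> v \<and> u < n \<and> v < n)"

definition no_isolated :: "nat \<Rightarrow> nat set set \<Rightarrow> bool" where
  "no_isolated n E \<longleftrightarrow> (\<forall>v<n. \<exists>e\<in>E. v \<in> e)"

definition degree :: "nat set set \<Rightarrow> nat \<Rightarrow> nat" where
  "degree E v = card {e\<in>E. v \<in> e}"

definition signless_laplacian :: "nat \<Rightarrow> nat set set \<Rightarrow> real mat" where
  "signless_laplacian n E = mat n n (\<lambda>(i, j).
     (if i = j then real (degree E i) else 0) + (if {i, j} \<in> E then 1 else 0))"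

definition q_index :: "nat \<Rightarrow> nat set set \<Rightarrow> real" where
  "q_index n E = Max {k. eigenvalue (signless_laplacian n E) k}"

definition graph_iso :: "nat \<Rightarrow> nat set set \<Rightarrow> nat set set \<Rightarrow> bool" where
  "graph_iso n E E' \<longleftrightarrow> (\<exists>f. bij_betw f {0..<n} {0..<n} \<and>
      (\<forall>u<n. \<forall>v<n. {u, v} \<in> E \<longleftrightarrow> {f u, f v} \<in> E'))"

definition is_cycle :: "nat set set \<Rightarrow> nat list \<Rightarrow> bool" where
  "is_cycle E cs \<longleftrightarrow> distinct cs \<and> length cs \<ge> 3 \<and>
     (\<forall>i<length cs. {cs ! i, cs ! ((i + 1) mod length cs)} \<in> E)"

definition cycle_consecutive :: "nat list \<Rightarrow> nat \<Rightarrow> nat \<Rightarrow> bool" where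
  "cycle_consecutive cs x y \<longleftrightarrow>
     (\<exists>i<length cs. {cs ! i, cs ! ((i + 1) mod length cs)} = {x, y})"

definition is_chord :: "nat set set \<Rightarrow> nat list \<Rightarrow> nat set \<Rightarrow> bool" where
  "is_chord E cs e \<longleftrightarrow> e \<in> E \<and>
     (\<exists>x y. e = {x, y} \<and> x \<noteq> y \<and> x \<in> set cs \<and> y \<in> set cs \<and> \<not> cycle_consecutive cs x y)"

definition has_trebly_chorded_cycle_at_vertex :: "nat set set \<Rightarrow> bool" where
  "has_trebly_chorded_cycle_at_vertex E \<longleftrightarrow>
     (\<exists>cs w e1 e2 e3. is_cycle E cs \<and> is_chord E cs e1 \<and> is_chord E cs e2 \<and> is_chord E cs e3 \<and>
        e1 \<noteq> e2 \<and> e1 \<noteq> e3 \<and> e2 \<noteq> e3 \<and> w \<in> e1 \<and> w \<in> e2 \<and> w \<in> e3)"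

text \<open>K_1 join (K_4 union K_1) on {0..<6}: vertex 0 is the K_1 of the join, {1,2,3,4} the K_4,
  vertex 5 the isolated K_1.\<close>
definition K1_join_K4_K1 :: "nat set set" where
  "K1_join_K4_K1 = {{u, v} | u v. u \<noteq> v \<and> u < 6 \<and> v < 6 \<and>
      (u = 0 \<or> v = 0 \<or> (1 \<le> u \<and> u \<le> 4 \<and> 1 \<le> v \<and> v \<le> 4))}"

text \<open>K_{1,1,n-2}^+ on {0..<n}: parts {0}, {1}, {2..<n}, plus the edge {2,3}.\<close>
definition K112_plus :: "nat \<Rightarrow> nat set set" where
  "K112_plus n = {{u, v} | u v. u \<noteq> v \<and> u < n \<and> v < n \<and>
      (u \<le> 1 \<or> v \<le> 1 \<or> {u, v} = {2, 3})}"

end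

theory Submission
  imports Defs "HOL-Computational_Algebra.Fundamental_Theorem_Algebra"
begin

text \<open>Suppose \<open>G\<close> has no such cycle. The absolute values \<open>y\<^sub>u\<close> of the entries of an eigenvector of the index \<open>q\<close> satisfy
  \<open>q y\<^sub>u \<le> d\<^sub>u y\<^sub>u + \<Sum>\<^sub>w y\<^sub>w\<close> (sum over the neighbours \<open>w\<close> of \<open>u\<close>). Let \<open>v\<close> maximise \<open>y\<^sub>u / (d\<^sub>u - al)\<close> with a small shift
  \<open>al\<close>, let \<open>S\<close> be the neighbourhood of \<open>v\<close> and \<open>T\<close> the set of its non-neighbours. For \<open>n \<ge> 7\<close> the inequality at
  \<open>v\<close> gives \<open>2 e(S) \<ge> 2 |S| - 2 + (number of missing S-T edges)\<close>. On the other hand \<open>G[S]\<close>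
  contains no path with 5 vertices, so apart from copies of \<open>K\<^sub>4\<close> and \<open>K\<^sub>4 - e\<close> it has at most
  \<open>|S|\<close> edges, and almost every way to attach a vertex of \<open>T\<close> to \<open>S\<close> creates a cycle with three chords at
  one vertex; the copies of \<open>K\<^sub>4\<close> and \<open>K\<^sub>4 - e\<close> consist of low-degree vertices, on which \<open>y\<close> is much smaller than
  the degree. Hence \<open>T\<close> is empty and no such copy exists. Applying the inequality once more
  yields \<open>\<Sum> g(g + 1) \<ge> n(n - 1)\<close> for the degrees \<open>g\<close> in \<open>G[S]\<close>, which forces a second dominating
  vertex and exactly one further edge. For \<open>n = 6\<close> the count alone suffices.\<close>

definition nbrs :: "nat set set \<Rightarrow> nat \<Rightarrow> nat set" where
  "nbrs E u = {w. {u, w} \<in> E}"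

text \<open>\<open>q_index\<close> is a \<open>Max\<close>, which is meaningful only if a real
  eigenvalue exists. A complex eigenvalue \<open>k\<close> comes from the fundamental theorem of
  algebra; the Hermitian form \<open>L\<close> of its eigenvector is real and equals
  \<open>k\<close> times a positive number, so \<open>k\<close> is real and a root of the real
  characteristic polynomial.\<close>

lemma symmetric_mat_has_eigenvalue:
  fixes A :: "real mat"
  assumes A: "A \<in> carrier_mat n n" and n: "n > 0"
    and sym: "\<And>i j. i < n \<Longrightarrow> j < n \<Longrightarrow> A $$ (i, j) = A $$ (j, i)"
  shows "\<exists>k. eigenvalue A k"
proof -
  define B where "B = map_mat complex_of_real A"
  have B: "B \<in> carrier_mat n n" using A by (simp add: B_def)
  have "Polynomial.degree (char_poly B) > 0" using degree_monic_char_poly[OF B] n by simp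
  hence "\<not> constant (poly (char_poly B))" by (simp add: constant_degree)
  then obtain k where k: "poly (char_poly B) k = 0" using fundamental_theorem_of_algebra by blast
  hence "eigenvalue B k" by (simp add: eigenvalue_root_char_poly[OF B])
  then obtain y where y: "y \<in> carrier_vec n" "y \<noteq> 0\<^sub>v n" "B *\<^sub>v y = k \<cdot>\<^sub>v y"
    using B unfolding eigenvalue_def eigenvector_def by auto
  have ev: "(\<Sum>j<n. of_real (A $$ (i, j)) * y $ j) = k * y $ i" if "i < n" for i
  proof -
    have "(B *\<^sub>v y) $ i = (\<Sum>j<n. of_real (A $$ (i, j)) * y $ j)"
      using that A B y(1) by (auto simp: B_def scalar_prod_def lessThan_atLeast0 intro!: sum.cong)
    thus ?thesis using that y by simp
  qed
  define L where "L = (\<Sum>i<n. \<Sum>j<n. cnj (y $ i) * (of_real (A $$ (i, j)) * y $ j))"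
  define r where "r = (\<Sum>i<n. (cmod (y $ i))\<^sup>2)"
  have L: "L = k * of_real r"
  proof -
    have "L = (\<Sum>i<n. cnj (y $ i) * (k * y $ i))"
      unfolding L_def by (rule sum.cong) (auto simp: sum_distrib_left[symmetric] ev)
    also have "\<dots> = k * of_real r"
      unfolding r_def of_real_sum sum_distrib_left
      by (rule sum.cong) (auto simp: complex_norm_square[symmetric] mult.commute mult.left_commute)
    finally show ?thesis .
  qed
  have "cnj L = (\<Sum>i<n. \<Sum>j<n. y $ i * (of_real (A $$ (i, j)) * cnj (y $ j)))"
    by (simp add: L_def)
  also have "\<dots> = (\<Sum>j<n. \<Sum>i<n. y $ i * (of_real (A $$ (i, j)) * cnj (y $ j)))"
    by (rule sum.swap)
  also have "\<dots> = L"
    unfolding L_def by (intro sum.cong refl) (simp add: sym mult_ac)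
  finally have cL: "cnj L = L" .
  have "r \<noteq> 0"
  proof
    assume "r = 0"
    hence "\<forall>i<n. y $ i = 0" unfolding r_def by (subst (asm) sum_nonneg_eq_0_iff) auto
    hence "y = 0\<^sub>v n" using y(1) by (intro eq_vecI) auto
    thus False using y(2) by simp
  qed
  hence "cnj k = k" using cL by (simp add: L)
  then obtain k' where k': "k = of_real k'" by (metis Reals_cnj_iff Reals_cases)
  have "char_poly B = map_poly of_real (char_poly A)"
    unfolding B_def by (rule of_real_hom.char_poly_hom[OF A])
  hence "poly (char_poly A) k' = 0" using k unfolding k' by simp
  thus ?thesis by (auto simp: eigenvalue_root_char_poly[OF A])
qed

section \<open>Rows of the signless Laplacian and bounds for its index\<close>

lemma simple_graph_nbrs:
  assumes "simple_graph n E"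
  shows "u \<notin> nbrs E u" "nbrs E u \<subseteq> {..<n}" "finite (nbrs E u)"
proof -
  have *: "w < n \<and> u \<noteq> w" if "{u, w} \<in> E" for w
    using assms that unfolding simple_graph_def by (metis doubleton_eq_iff)
  show "u \<notin> nbrs E u" using *[of u] unfolding nbrs_def by blast
  show "nbrs E u \<subseteq> {..<n}" using * unfolding nbrs_def by auto
  thus "finite (nbrs E u)" using finite_subset by blast
qed

lemma degree_eq_card_nbrs:
  assumes "simple_graph n E"
  shows "degree E u = card (nbrs E u)"
proof -
  have "{e \<in> E. u \<in> e} = (\<lambda>w. {u, w}) ` nbrs E u"
  proof (intro equalityI subsetI)
    fix e assume "e \<in> {e \<in> E. u \<in> e}"
    moreover from this obtain a b where "e = {a, b}" using assms unfolding simple_graph_def by blast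
    ultimately show "e \<in> (\<lambda>w. {u, w}) ` nbrs E u"
      unfolding nbrs_def by (auto simp: insert_commute)
  qed (auto simp: nbrs_def)
  moreover have "inj_on (\<lambda>w. {u, w}) (nbrs E u)"
    by (auto simp: inj_on_def doubleton_eq_iff)
  ultimately show ?thesis unfolding degree_def by (simp add: card_image)
qed

text \<open>The diagonal entry supplies one \<open>z u\<close> for each neighbour. The later
  spectral arguments use this neighbourhood form instead of the matrix.\<close>

lemma signless_laplacian_row:
  assumes "simple_graph n E" "u < n"
  shows "(\<Sum>j<n. signless_laplacian n E $$ (u, j) * z j) = (\<Sum>w\<in>nbrs E u. z u + z w)"
proof -
  have "(\<Sum>j<n. signless_laplacian n E $$ (u, j) * z j)
      = (\<Sum>j<n. (if u = j then real (degree E u) * z j else 0)) + (\<Sum>j<n. if {u, j} \<in> E then z j else 0)"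
    unfolding sum.distrib[symmetric] using assms(2)
    by (intro sum.cong) (auto simp: signless_laplacian_def algebra_simps)
  also have "(\<Sum>j<n. (if u = j then real (degree E u) * z j else 0)) = real (degree E u) * z u"
    using assms(2) by simp
  also have "(\<Sum>j<n. if {u, j} \<in> E then z j else 0) = (\<Sum>j\<in>nbrs E u. z j)"
  proof -
    have "nbrs E u = {j \<in> {..<n}. {u, j} \<in> E}"
      using simple_graph_nbrs(2)[OF assms(1), of u] unfolding nbrs_def by auto
    thus ?thesis by (simp only: sum.inter_filter finite_lessThan)
  qed
  finally show ?thesis by (simp add: sum.distrib degree_eq_card_nbrs[OF assms(1)])
qed

lemma finite_eigenvalues_signless_laplacian:
  "finite {k. eigenvalue (signless_laplacian n E) k}"
proof -
  have A: "signless_laplacian n E \<in> carrier_mat n n" by (simp add: signless_laplacian_def)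
  have "char_poly (signless_laplacian n E) \<noteq> 0" using degree_monic_char_poly[OF A] by auto
  thus ?thesis by (simp add: eigenvalue_root_char_poly[OF A] poly_roots_finite)
qed

text \<open>Used for the two extremal graphs, whose eigenvectors are constant on the classes of an
  equitable partition.\<close>

lemma q_index_ge_eigenvalue:
  assumes "simple_graph n E" "u < n" "z u \<noteq> 0"
    and "\<And>u. u < n \<Longrightarrow> (\<Sum>w\<in>nbrs E u. z u + z w) = k * z u"
  shows "k \<le> q_index n E"
proof -
  let ?A = "signless_laplacian n E"
  have A: "?A \<in> carrier_mat n n" by (simp add: signless_laplacian_def)
  have "eigenvector ?A (vec n z) k"
    unfolding eigenvector_def
  proof (intro conjI)
    show "vec n z \<in> carrier_vec (dim_row ?A)" using A by auto
    show "vec n z \<noteq> 0\<^sub>v (dim_row ?A)" using assms(2,3) A by (metis carrier_matD(1) index_vec index_zero_vec(1))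
    show "?A *\<^sub>v vec n z = k \<cdot>\<^sub>v vec n z"
    proof (rule eq_vecI)
      fix i assume "i < dim_vec (k \<cdot>\<^sub>v vec n z)"
      hence i: "i < n" by simp
      have "(?A *\<^sub>v vec n z) $ i = (\<Sum>j<n. ?A $$ (i, j) * z j)"
        using i A by (auto simp: scalar_prod_def lessThan_atLeast0 intro!: sum.cong)
      thus "(?A *\<^sub>v vec n z) $ i = (k \<cdot>\<^sub>v vec n z) $ i"
        using i signless_laplacian_row[OF assms(1) i, of z] assms(4)[OF i] by simp
    qed (use A in auto)
  qed
  hence "eigenvalue ?A k" unfolding eigenvalue_def by blast
  thus ?thesis unfolding q_index_def by (simp add: finite_eigenvalues_signless_laplacian)
qed

text \<open>The entrywise absolute value of an eigenvector is only a subsolution, but that is all that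
  upper bounds on the index need, so no Perron--Frobenius theory is required.\<close>
lemma q_index_subsolution:
  assumes E: "simple_graph n E" and n: "n > 0"
  obtains z :: "nat \<Rightarrow> real" where "\<And>u. 0 \<le> z u" "\<exists>u<n. 0 < z u"
    "\<And>u. u < n \<Longrightarrow> q_index n E * z u \<le> (\<Sum>w\<in>nbrs E u. z u + z w)"
proof -
  let ?A = "signless_laplacian n E"
  have A: "?A \<in> carrier_mat n n" by (simp add: signless_laplacian_def)
  have "\<exists>k. eigenvalue ?A k"
    by (rule symmetric_mat_has_eigenvalue[OF A n]) (auto simp: signless_laplacian_def insert_commute)
  hence "q_index n E \<in> {k. eigenvalue ?A k}"
    unfolding q_index_def by (intro Max_in finite_eigenvalues_signless_laplacian) auto
  then obtain y where y: "y \<in> carrier_vec n" "y \<noteq> 0\<^sub>v n" "?A *\<^sub>v y = q_index n E \<cdot>\<^sub>v y"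
    using A unfolding eigenvalue_def eigenvector_def by auto
  show ?thesis
  proof
    show "0 \<le> \<bar>y $ u\<bar>" for u by simp
    show "\<exists>u<n. 0 < \<bar>y $ u\<bar>"
    proof (rule ccontr)
      assume "\<not> ?thesis"
      hence "y = 0\<^sub>v n" using y(1) by (intro eq_vecI) auto
      thus False using y(2) by simp
    qed
    fix u assume u: "u < n"
    have "(?A *\<^sub>v y) $ u = (\<Sum>j<n. ?A $$ (u, j) * y $ j)"
      using u A y(1) by (auto simp: scalar_prod_def lessThan_atLeast0 intro!: sum.cong)
    hence "q_index n E * y $ u = (\<Sum>w\<in>nbrs E u. y $ u + y $ w)"
      using u y signless_laplacian_row[OF E u, of "($) y"] by simp
    hence "\<bar>q_index n E * y $ u\<bar> \<le> (\<Sum>w\<in>nbrs E u. \<bar>y $ u + y $ w\<bar>)" by simp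
    also have "\<dots> \<le> (\<Sum>w\<in>nbrs E u. \<bar>y $ u\<bar> + \<bar>y $ w\<bar>)" by (intro sum_mono abs_triangle_ineq)
    finally have "\<bar>q_index n E * y $ u\<bar> \<le> (\<Sum>w\<in>nbrs E u. \<bar>y $ u\<bar> + \<bar>y $ w\<bar>)" .
    moreover have "q_index n E * \<bar>y $ u\<bar> \<le> \<bar>q_index n E * y $ u\<bar>"
      unfolding abs_mult by (intro mult_right_mono abs_ge_self abs_ge_zero)
    ultimately show "q_index n E * \<bar>y $ u\<bar> \<le> (\<Sum>w\<in>nbrs E u. \<bar>y $ u\<bar> + \<bar>y $ w\<bar>)"
      by (rule order_trans[rotated])
  qed
qed

section \<open>Graphs without the chorded cycle\<close>

text \<open>Closing the path \<open>p\<close> through \<open>w\<close> gives a cycle on which the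
  ends of \<open>p\<close> are the two cycle neighbours of \<open>w\<close>, so each inner vertex in
  \<open>X\<close> yields a chord at \<open>w\<close>.\<close>

lemma hub_cycle_has_three_chords:
  assumes p: "distinct (w # p)" "length p \<ge> 2" and "successively (\<lambda>x y. {x, y} \<in> E) p"
    and ends: "{w, hd p} \<in> E" "{w, last p} \<in> E"
    and X: "X \<subseteq> set p - {hd p, last p}" "card X = 3" "\<And>x. x \<in> X \<Longrightarrow> {w, x} \<in> E"
  shows "has_trebly_chorded_cycle_at_vertex E"
proof -
  let ?cs = "w # p"
  have cyc: "is_cycle E ?cs"
    unfolding is_cycle_def
  proof (intro conjI allI impI)
    fix i assume i: "i < length ?cs"
    show "{?cs ! i, ?cs ! ((i + 1) mod length ?cs)} \<in> E"
    proof (cases i)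
      case 0
      thus ?thesis using ends(1) p(2) by (cases p) auto
    next
      case (Suc j)
      show ?thesis
      proof (cases "Suc j < length p")
        case True
        thus ?thesis using assms(3) Suc by (simp add: successively_conv_nth)
      next
        case False
        \<comment> \<open>The closing edge of the cycle: the successor index wraps around to
          \<open>w\<close>.\<close>
        hence "Suc j = length p" using Suc i by simp
        moreover from this have "p ! j = last p" using p(2) by (metis last_conv_nth diff_Suc_1 length_0_conv nat.simps(3))
        moreover from this have "?cs ! i = last p" using Suc by simp
        ultimately show ?thesis using Suc ends(2) by (simp add: insert_commute)
      qed
    qed
  qed (use p in auto)
  have nc: "\<not> cycle_consecutive ?cs w x" if x: "x \<in> X" for x
  proof
    assume "cycle_consecutive ?cs w x"
    then obtain i where i: "i < length ?cs" "{?cs ! i, ?cs ! ((i + 1) mod length ?cs)} = {w, x}"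
      unfolding cycle_consecutive_def by blast
    have xp: "x \<in> set p" "x \<noteq> hd p" "x \<noteq> last p" using X(1) x by auto
    show False
    proof (cases i)
      case 0
      have "hd p \<in> {w, x}" using i(2) p(2) by (cases p) (auto simp: 0)
      thus False using xp p by (cases p) auto
    next
      case (Suc j)
      have jp: "p ! j \<in> set p" "j < length p" using i(1) Suc by auto
      show False
      proof (cases "Suc j < length p")
        case True
        hence "{p ! j, p ! Suc j} = {w, x}" using i(2) Suc by simp
        hence "w \<in> set p" using True by (metis doubleton_eq_iff jp(1) nth_mem)
        thus False using p(1) by simp
      next
        case False
        hence "Suc j = length p" using jp by simp
        moreover from this have "p ! j = last p" using p(2) by (metis last_conv_nth diff_Suc_1 length_0_conv nat.simps(3))
        moreover from this have "?cs ! i = last p" using Suc by simp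
        ultimately have "{last p, w} = {w, x}" using i(2) Suc by simp
        thus False using xp(1,3) p(1) by (auto simp: doubleton_eq_iff)
      qed
    qed
  qed
  have ch: "is_chord E ?cs {w, x}" if "x \<in> X" for x
  proof -
    have "{w, x} \<in> E" "x \<in> set ?cs" "w \<noteq> x" using X that p(1) by auto
    thus ?thesis unfolding is_chord_def using nc[OF that] by (metis list.set_intros(1))
  qed
  obtain x1 x2 x3 where x: "X = {x1, x2, x3}" "x1 \<noteq> x2" "x1 \<noteq> x3" "x2 \<noteq> x3"
    using X(2) by (auto simp: card_3_iff)
  show ?thesis
    unfolding has_trebly_chorded_cycle_at_vertex_def
    by (rule exI[of _ ?cs], rule exI[of _ w], rule exI[of _ "{w, x1}"], rule exI[of _ "{w, x2}"],
        rule exI[of _ "{w, x3}"]) (use cyc ch x in \<open>auto simp: doubleton_eq_iff\<close>)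
qed

lemma card_ge_2E:
  assumes "2 \<le> card A"
  obtains a b where "a \<in> A" "b \<in> A" "a \<noteq> b"
proof -
  obtain B where "B \<subseteq> A" "card B = 2" using assms by (metis obtain_subset_with_card_n)
  thus ?thesis using that by (auto simp: card_2_iff)
qed

lemma card_ge_3E:
  assumes "3 \<le> card A"
  obtains a b c where "a \<in> A" "b \<in> A" "c \<in> A" "a \<noteq> b" "a \<noteq> c" "b \<noteq> c"
proof -
  obtain B where "B \<subseteq> A" "card B = 3" using assms by (metis obtain_subset_with_card_n)
  thus ?thesis using that by (auto simp: card_3_iff)
qed

section \<open>Forbidden paths around a vertex\<close>

locale tcc_free =
  fixes n :: nat and E :: "nat set set"
  assumes simple: "simple_graph n E"
    and tcc_free: "\<not> has_trebly_chorded_cycle_at_vertex E"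
begin

definition adj :: "nat \<Rightarrow> nat \<Rightarrow> bool" where
  "adj u w \<longleftrightarrow> {u, w} \<in> E"

abbreviation N :: "nat \<Rightarrow> nat set" where "N \<equiv> nbrs E"

lemma in_N [simp]: "w \<in> N u \<longleftrightarrow> adj u w"
  by (simp add: nbrs_def adj_def)

lemma adj_commute: "adj u w \<longleftrightarrow> adj w u"
  by (simp add: adj_def insert_commute)

lemma adj_irrefl [simp]: "\<not> adj u u"
  using simple_graph_nbrs(1)[OF simple, of u] by simp

lemma adj_less: "adj u w \<Longrightarrow> w < n" "adj u w \<Longrightarrow> u < n"
  using simple_graph_nbrs(2)[OF simple, of u] simple_graph_nbrs(2)[OF simple, of w]
    in_N[of w u] in_N[of u w] adj_commute[of u w] by blast+

lemma finite_N [simp]: "finite (N u)"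
  by (rule simple_graph_nbrs(3)[OF simple])

lemma N_subset: "N u \<subseteq> {..<n} - {u}"
  using simple_graph_nbrs[OF simple, of u] by auto

lemma no_path5:
  assumes "distinct [a, b, c, d, e]" "adj a b" "adj b c" "adj c d" "adj d e"
    and "adj w a" "adj w b" "adj w c" "adj w d" "adj w e"
  shows False
proof -
  have "w \<notin> {a, b, c, d, e}" using assms by auto
  thus False
    using hub_cycle_has_three_chords[of w "[a, b, c, d, e]" E "{b, c, d}"] assms tcc_free
    by (auto simp: adj_def)
qed

text \<open>The vertex \<open>t\<close> may be a non-neighbour of \<open>w\<close>, since
  \<open>b\<close>, \<open>c\<close>, \<open>d\<close> still give three chords. Up to reversal of
  the path, the fourth and the fifth place are the only inner places for such a vertex.\<close>

lemma no_path6_skip4: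
  assumes "distinct [w, a, b, c, t, d, e]" "adj a b" "adj b c" "adj c t" "adj t d" "adj d e"
    and "adj w a" "adj w b" "adj w c" "adj w d" "adj w e"
  shows False
  using hub_cycle_has_three_chords[of w "[a, b, c, t, d, e]" E "{b, c, d}"] assms tcc_free
  by (auto simp: adj_def)

lemma no_path6_skip5:
  assumes "distinct [w, a, b, c, d, t, e]" "adj a b" "adj b c" "adj c d" "adj d t" "adj t e"
    and "adj w a" "adj w b" "adj w c" "adj w d" "adj w e"
  shows False
  using hub_cycle_has_three_chords[of w "[a, b, c, d, t, e]" E "{b, c, d}"] assms tcc_free
  by (auto simp: adj_def)

text \<open>Not a block in the sense of 2-connectivity: a copy of \<open>K\<^sub>4\<close> or of \<open>K\<^sub>4\<close> minus an edge inside a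
  neighbourhood. These are the only components with more edges than vertices that a neighbourhood
  can have.\<close>
definition block :: "nat \<Rightarrow> nat \<Rightarrow> nat \<Rightarrow> nat \<Rightarrow> nat \<Rightarrow> bool" where
  "block v a b x y \<longleftrightarrow> {a, b, x, y} \<subseteq> N v \<and> distinct [a, b, x, y] \<and>
     adj a b \<and> adj a x \<and> adj a y \<and> adj b x \<and> adj b y"

text \<open>\<open>K_4\<close> and \<open>K_4\<close> minus an edge have a Hamiltonian path from any
  prescribed vertex, and \<open>s\<close> would prolong it to a 5-vertex path in \<open>N v\<close>.
  So a block fills a component of the graph induced on \<open>N v\<close>.\<close>

lemma block_closed:
  assumes B: "block v a b x y" and s: "s \<in> N v" "p \<in> {a, b, x, y}" "adj p s"
  shows "s \<in> {a, b, x, y}"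
proof (rule ccontr)
  assume ns: "s \<notin> {a, b, x, y}"
  note F = B[unfolded block_def]
  consider "p = a" | "p = b" | "p = x" | "p = y" using s(2) by blast
  thus False
  proof cases
    case 1 thus False using no_path5[of s a x b y v] F s ns by (auto simp: adj_commute)
  next
    case 2 thus False using no_path5[of s b x a y v] F s ns by (auto simp: adj_commute)
  next
    case 3 thus False using no_path5[of s x a b y v] F s ns by (auto simp: adj_commute)
  next
    case 4 thus False using no_path5[of s y a b x v] F s ns by (auto simp: adj_commute)
  qed
qed

text \<open>The Hamiltonian path of the block that ends at \<open>p\<close> continues through
  \<open>t\<close> to \<open>s\<close>, with \<open>t\<close> in the fifth place.\<close>

lemma block_attached:
  assumes B: "block v a b x y" and t: "t \<noteq> v" "\<not> adj v t" "p \<in> {a, b, x, y}" "adj t p"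
    and s: "adj v s" "adj t s"
  shows "s \<in> {a, b, x, y}"
proof (rule ccontr)
  assume ns: "s \<notin> {a, b, x, y}"
  note F = B[unfolded block_def]
  have d: "distinct [v, a, b, x, y, t, s]" using F t s ns by auto
  consider "p = a" | "p = b" | "p = x" | "p = y" using t(3) by blast
  thus False
  proof cases
    case 1 thus False using no_path6_skip5[of v x b y a t s] F t s d by (auto simp: adj_commute)
  next
    case 2 thus False using no_path6_skip5[of v x a y b t s] F t s d by (auto simp: adj_commute)
  next
    case 3 thus False using no_path6_skip5[of v y b a x t s] F t s d by (auto simp: adj_commute)
  next
    case 4 thus False using no_path6_skip5[of v x b a y t s] F t s d by (auto simp: adj_commute)
  qed
qed

text \<open>The hub moves from \<open>v\<close> to \<open>a\<close>: its neighbourhood contains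
  \<open>v\<close>, \<open>b\<close>, \<open>x\<close>, \<open>y\<close> and \<open>t\<close>, and
  the edge from \<open>t\<close> to \<open>s\<close> starts a path through all five.\<close>

lemma block_attached_hub:
  assumes B: "block v a b x y" and t: "t \<noteq> v" "\<not> adj v t" "adj t a"
    and s: "s \<in> {b, x, y}" "adj t s"
  shows False
proof -
  note F = B[unfolded block_def]
  have d: "distinct [v, a, b, x, y, t]" using F t by auto
  consider "s = b" | "s = x" | "s = y" using s(1) by blast
  thus False
  proof cases
    case 1 thus False using no_path5[of t b x v y a] F t s d by (auto simp: adj_commute)
  next
    case 2 thus False using no_path5[of t x b y v a] F t s d by (auto simp: adj_commute)
  next
    case 3 thus False using no_path5[of t y b x v a] F t s d by (auto simp: adj_commute)
  qed
qed

lemma block_swap: "block v a b x y \<Longrightarrow> block v b a x y"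
  by (auto simp: block_def adj_commute)

lemma block_flip: "block v a b x y \<Longrightarrow> adj x y \<Longrightarrow> block v x y a b"
  by (auto simp: block_def adj_commute)

lemma block_attached_unique:
  assumes B: "block v a b x y" and t: "t \<noteq> v" "\<not> adj v t"
    and p: "p \<in> {a, b}" "adj t p" and s: "s \<in> {a, b, x, y}" "adj t s"
  shows "s = p"
proof (rule ccontr)
  assume "s \<noteq> p"
  show False
  proof (cases "p = a")
    case True
    thus False using block_attached_hub[OF B t _ _ s(2)] p s(1) \<open>s \<noteq> p\<close> by blast
  next
    case False
    thus False using block_attached_hub[OF block_swap[OF B] t _ _ s(2)] p s(1) \<open>s \<noteq> p\<close> by blast
  qed
qed

text \<open>A neighbour of \<open>t\<close> among \<open>a\<close>, \<open>b\<close> excludes all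
  others; without one, only \<open>x\<close> and \<open>y\<close> are left.\<close>

lemma block_attached_card_le_2:
  assumes B: "block v a b x y" and t: "t \<noteq> v" "\<not> adj v t"
    and p: "p \<in> {a, b, x, y}" "adj t p"
  shows "card (N t \<inter> N v) \<le> 2"
proof -
  have sub: "N t \<inter> N v \<subseteq> {a, b, x, y}" using block_attached[OF B t p] by (intro subsetI) auto
  have "N t \<inter> N v \<subseteq> {a} \<or> N t \<inter> N v \<subseteq> {b} \<or> N t \<inter> N v \<subseteq> {x, y}"
  proof (cases "adj t a \<or> adj t b")
    case True
    then obtain q where q: "q \<in> {a, b}" "adj t q" by blast
    have "N t \<inter> N v \<subseteq> {q}"
      using block_attached_unique[OF B t q] sub by (intro subsetI) (auto dest: subsetD)
    thus ?thesis using q by blast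
  next
    case False
    hence "a \<notin> N t" "b \<notin> N t" by simp_all
    hence "N t \<inter> N v \<subseteq> {x, y}" using sub by blast
    thus ?thesis by blast
  qed
  then obtain q r where "N t \<inter> N v \<subseteq> {q, r}" by blast
  from card_mono[OF _ this] show ?thesis by (auto simp: card_insert_if split: if_splits)
qed

text \<open>In a \<open>K_4\<close> the pairs \<open>a\<close>, \<open>b\<close> and
  \<open>x\<close>, \<open>y\<close> can be exchanged, so each of the four vertices can act as the
  hub.\<close>

lemma block_attached_card_le_1:
  assumes B: "block v a b x y" and xy: "adj x y" and t: "t \<noteq> v" "\<not> adj v t"
    and p: "p \<in> {a, b, x, y}" "adj t p"
  shows "card (N t \<inter> N v) \<le> 1"
proof -
  have sub: "N t \<inter> N v \<subseteq> {a, b, x, y}" using block_attached[OF B t p] by (intro subsetI) auto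
  have "N t \<inter> N v \<subseteq> {p}"
  proof
    fix s assume s: "s \<in> N t \<inter> N v"
    hence s': "s \<in> {a, b, x, y}" "adj t s" using sub by auto
    show "s \<in> {p}"
    proof (cases "p \<in> {a, b}")
      case True
      thus ?thesis using block_attached_unique[OF B t True p(2) s'] by simp
    next
      case False
      hence "p \<in> {x, y}" "s \<in> {x, y, a, b}" using p(1) s'(1) by auto
      thus ?thesis using block_attached_unique[OF block_flip[OF B xy] t _ p(2) _ s'(2)] by simp
    qed
  qed
  from card_mono[OF _ this] show ?thesis by simp
qed

section \<open>Edge counts inside a neighbourhood\<close>

definition blocks :: "nat \<Rightarrow> nat set" where
  "blocks v = {s. \<exists>a b x y. block v a b x y \<and> s \<in> {a, b, x, y}}"

text \<open>Twice the number of edges induced on \<open>W\<close>, kept as a degree sum because this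
  is the form in which it enters the spectral inequality.\<close>

definition degsum :: "nat set \<Rightarrow> nat" where
  "degsum W = (\<Sum>s\<in>W. card (N s \<inter> W))"

lemma degsum_remove:
  assumes "finite W" "p \<in> W"
  shows "degsum W = degsum (W - {p}) + 2 * card (N p \<inter> W)"
proof -
  have "(\<Sum>s\<in>W - {p}. card (N s \<inter> W)) = (\<Sum>s\<in>W - {p}. card (N s \<inter> (W - {p})) + (if s \<in> N p then 1 else 0))"
  proof (rule sum.cong)
    fix s assume s: "s \<in> W - {p}"
    show "card (N s \<inter> W) = card (N s \<inter> (W - {p})) + (if s \<in> N p then 1 else 0)"
    proof (cases "adj p s")
      case True
      hence "N s \<inter> W = insert p (N s \<inter> (W - {p}))" using assms by (auto simp: adj_commute)
      thus ?thesis using True assms by simp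
    next
      case False
      hence "N s \<inter> W = N s \<inter> (W - {p})" by (auto simp: adj_commute)
      thus ?thesis using False by simp
    qed
  qed simp
  also have "\<dots> = degsum (W - {p}) + card ((W - {p}) \<inter> N p)"
    unfolding sum.distrib degsum_def nbrs_def using assms by (simp add: sum.If_cases)
  also have "(W - {p}) \<inter> N p = N p \<inter> W" by auto
  finally show ?thesis
    unfolding degsum_def using assms by (subst sum.remove[of W p]) auto
qed

text \<open>Deleting a vertex of degree at most 1 does not decrease \<open>degsum W - 2 * card W\<close>.\<close>
lemma min_degree_2_core:
  assumes "finite W"
  shows "\<exists>W'\<subseteq>W. (\<forall>s\<in>W'. 2 \<le> card (N s \<inter> W')) \<and> degsum W + 2 * card W' \<le> degsum W' + 2 * card W
    \<and> (W \<noteq> {} \<longrightarrow> 2 * card W \<le> degsum W + 1 \<longrightarrow> W' \<noteq> {})"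
  using assms
proof (induction "card W" arbitrary: W)
  case 0
  thus ?case by auto
next
  case (Suc k)
  show ?case
  proof (cases "\<forall>s\<in>W. 2 \<le> card (N s \<inter> W)")
    case True
    thus ?thesis by auto
  next
    case False
    then obtain p where p: "p \<in> W" "card (N p \<inter> W) \<le> 1" by force
    have ck: "card (W - {p}) = k" using Suc.hyps(2) p Suc.prems by simp
    then obtain W' where W': "W' \<subseteq> W - {p}" "\<forall>s\<in>W'. 2 \<le> card (N s \<inter> W')"
      "degsum (W - {p}) + 2 * card W' \<le> degsum W' + 2 * card (W - {p})"
      "W - {p} \<noteq> {} \<longrightarrow> 2 * card (W - {p}) \<le> degsum (W - {p}) + 1 \<longrightarrow> W' \<noteq> {}"
      using Suc.hyps(1)[of "W - {p}"] Suc.prems by auto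
    have dr: "degsum W \<le> degsum (W - {p}) + 2" using degsum_remove[OF Suc.prems p(1)] p(2) by simp
    have "W' \<noteq> {}" if "2 * card W \<le> degsum W + 1"
    proof -
      \<comment> \<open>Deletion never goes down to one vertex: a singleton has
        \<open>degsum\<close> 0, while the density condition would require at least 1.\<close>
      have "W \<noteq> {p}"
      proof
        assume W: "W = {p}"
        have "N p \<inter> {p} = {}" by auto
        hence "degsum W = 0" unfolding W degsum_def by simp
        thus False using that W by simp
      qed
      hence "W - {p} \<noteq> {}" using p by auto
      thus ?thesis using W'(4) that dr ck Suc.hyps(2) by simp
    qed
    thus ?thesis using W' dr ck Suc.hyps(2) by (intro exI[of _ W']) auto
  qed
qed

text \<open>An excess survives in the core of minimum degree 2, so some \<open>w\<close> has three
  neighbours there, each with a further neighbour. If a further neighbour lies outside the three, a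
  5-vertex path arises; otherwise the three span at least two edges and form a block with
  \<open>w\<close>.\<close>

lemma degsum_le_twice_card:
  assumes W: "W \<subseteq> N v" and nb: "\<And>a b x y. {a, b, x, y} \<subseteq> W \<Longrightarrow> \<not> block v a b x y"
  shows "degsum W \<le> 2 * card W"
proof (rule ccontr)
  assume dense: "\<not> ?thesis"
  have fin: "finite W" using W finite_subset finite_N by blast
  then obtain W' where W': "W' \<subseteq> W" "\<And>s. s \<in> W' \<Longrightarrow> 2 \<le> card (N s \<inter> W')"
    "degsum W + 2 * card W' \<le> degsum W' + 2 * card W" using min_degree_2_core by meson
  have "2 * card W' < degsum W'" using W'(3) dense by linarith
  have "\<exists>w\<in>W'. 3 \<le> card (N w \<inter> W')"
  proof (rule ccontr)
    assume "\<not> ?thesis"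
    hence "degsum W' \<le> (\<Sum>s\<in>W'. 2)" unfolding degsum_def by (intro sum_mono) force
    thus False using \<open>2 * card W' < degsum W'\<close> by simp
  qed
  then obtain w a b c where w: "w \<in> W'" and abc: "adj w a" "adj w b" "adj w c" "a \<in> W'" "b \<in> W'" "c \<in> W'"
    "a \<noteq> b" "a \<noteq> c" "b \<noteq> c" by (auto elim!: card_ge_3E)
  have Nv: "adj v s" if "s \<in> W'" for s using that W' W by auto
  have other: "\<exists>s\<in>W'. adj p s \<and> s \<noteq> w" if "p \<in> W'" for p
  proof -
    note two = W'(2)[OF that]
    obtain s s' where "s \<in> N p \<inter> W'" "s' \<in> N p \<inter> W'" "s \<noteq> s'"
      using card_ge_2E[OF two] by metis
    thus ?thesis by (cases "s = w") auto
  qed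
  \<comment> \<open>The place of a second neighbour \<open>y\<close> of \<open>b\<close> decides how
    the edge between \<open>a\<close> and \<open>u\<close> extends to a 5-vertex path in
    \<open>N v\<close>.\<close>
  have out: "u \<in> {a, b, c}"
    if h: "adj w a" "adj w b" "adj w c" "a \<in> W'" "b \<in> W'" "c \<in> W'" "a \<noteq> b" "a \<noteq> c" "b \<noteq> c"
      "u \<in> W'" "adj a u" "u \<noteq> w" for a b c u
  proof (rule ccontr)
    assume u: "u \<notin> {a, b, c}"
    obtain y where y: "y \<in> W'" "adj b y" "y \<noteq> w" using other h by blast
    have "w \<notin> {a, b, c}" "y \<noteq> b" using h y by auto
    have nv: "adj v a" "adj v b" "adj v c" "adj v u" "adj v w" "adj v y" using Nv h(4-6,10) w y(1) by simp_all
    consider "y = a" | "y = c" | "y = u" | "y \<notin> {a, b, c, u}" using \<open>y \<noteq> b\<close> by blast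
    thus False
    proof cases
      case 1 thus False using no_path5[of u a b w c v] h y u nv \<open>w \<notin> _\<close> by (auto simp: adj_commute)
    next
      case 2 thus False using no_path5[of u a w b c v] h y u nv \<open>w \<notin> _\<close> by (auto simp: adj_commute)
    next
      case 3 thus False using no_path5[of c w b u a v] h y u nv \<open>w \<notin> _\<close> by (auto simp: adj_commute)
    next
      case 4 thus False using no_path5[of u a w b y v] h y u nv \<open>w \<notin> _\<close> by (auto simp: adj_commute)
    qed
  qed
  obtain a' where a': "a' \<in> W'" "adj a a'" "a' \<noteq> w" using other abc by blast
  obtain b' where b': "b' \<in> W'" "adj b b'" "b' \<noteq> w" using other abc by blast
  obtain c' where c': "c' \<in> W'" "adj c c'" "c' \<noteq> w" using other abc by blast
  have "a' \<in> {b, c}" using out[of a b c a'] abc a' by auto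
  moreover have "b' \<in> {a, c}" using out[of b a c b'] abc b' by auto
  moreover have "c' \<in> {a, b}" using out[of c a b c'] abc c' by auto
  ultimately have "(adj a b \<and> adj a c) \<or> (adj a b \<and> adj b c) \<or> (adj a c \<and> adj b c)"
    using a' b' c' by (auto simp: adj_commute)
  moreover have "\<not> block v w p q r" if "{p, q, r} \<subseteq> W'" for p q r
    using nb[of w p q r] that w W'(1) by blast
  hence "\<not> block v w a b c" "\<not> block v w b a c" "\<not> block v w c a b" using abc by auto
  moreover have "w \<noteq> a" "w \<noteq> b" "w \<noteq> c" using abc by auto
  ultimately show False
    using abc w Nv[of w] Nv[of a] Nv[of b] Nv[of c] unfolding block_def by (auto simp: adj_commute)
qed

text \<open>Density makes the core nonempty. Two steps in both directions from a core vertex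
  \<open>p\<close> would give a 5-vertex path unless the two walks meet, and then they close a
  triangle or a 4-cycle.\<close>

lemma dense_has_short_cycle [consumes 3, case_names triangle square]:
  assumes W: "W \<subseteq> N v" "W \<noteq> {}" and "2 * card W \<le> degsum W + 1"
  obtains (triangle) a b c where "{a, b, c} \<subseteq> W" "distinct [a, b, c]" "adj a b" "adj b c" "adj a c"
  | (square) a b c d where "{a, b, c, d} \<subseteq> W" "distinct [a, b, c, d]" "adj a b" "adj b c" "adj c d" "adj a d"
proof -
  have fin: "finite W" using W finite_subset finite_N by blast
  then obtain W' where W': "W' \<subseteq> W" "\<And>s. s \<in> W' \<Longrightarrow> 2 \<le> card (N s \<inter> W')" "W' \<noteq> {}"
    using min_degree_2_core assms by meson
  then obtain p where p: "p \<in> W'" by blast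
  then obtain q r where q: "q \<in> W'" "r \<in> W'" "adj p q" "adj p r" "q \<noteq> r"
    using card_ge_2E[OF W'(2)[OF p]] by (metis IntE in_N)
  have Nv: "adj v s" if "s \<in> W'" for s using that W' W by auto
  have other: "\<exists>s\<in>W'. adj u s \<and> s \<noteq> p" if "u \<in> W'" for u
  proof -
    note two = W'(2)[OF that]
    obtain s s' where "s \<in> N u \<inter> W'" "s' \<in> N u \<inter> W'" "s \<noteq> s'"
      using card_ge_2E[OF two] by metis
    thus ?thesis by (cases "s = p") auto
  qed
  obtain q' where q': "q' \<in> W'" "adj q q'" "q' \<noteq> p" using other q by blast
  obtain r' where r': "r' \<in> W'" "adj r r'" "r' \<noteq> p" using other q by blast
  have ne: "p \<noteq> q" "p \<noteq> r" "q \<noteq> q'" "r \<noteq> r'" using q q' r' by auto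
  consider "q' = r" | "r' = q" | "q' = r'" | "q' \<noteq> r" "r' \<noteq> q" "q' \<noteq> r'" by blast
  thus ?thesis
  proof cases
    case 1 thus ?thesis using triangle[of p q r] p q q' ne W' by auto
  next
    case 2 thus ?thesis using triangle[of p q r] p q r' ne W' by (auto simp: adj_commute)
  next
    case 3 thus ?thesis using square[of p q q' r] p q q' r' ne W' by (auto simp: adj_commute)
  next
    case 4
    hence False using no_path5[of q' q p r r' v] p q q' r' ne Nv by (auto simp: adj_commute)
    thus ?thesis ..
  qed
qed

section \<open>A non-neighbour attached to a neighbourhood without blocks\<close>

lemma no_P3_P2_attached:
  assumes "t \<noteq> v" "\<not> adj v t" and "{a, b, c, x, y} \<subseteq> N v" "distinct [a, b, c, x, y]"
    and "adj a b" "adj b c" "adj x y" "adj t a" "adj t x"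
  shows False
proof -
  have "distinct [v, c, b, a, t, x, y]" using assms by auto
  thus False using no_path6_skip4[of v c b a t x y] assms by (auto simp: adj_commute)
qed

lemma no_P4_attached:
  assumes "t \<noteq> v" "\<not> adj v t" and "{a, b, c, d, u} \<subseteq> N v" "distinct [a, b, c, d, u]"
    and "adj a b" "adj b c" "adj c d" "adj t d" "adj t u"
  shows False
proof -
  have "distinct [v, a, b, c, d, t, u]" using assms by auto
  thus False using no_path6_skip5[of v a b c d t u] assms by (auto simp: adj_commute)
qed

text \<open>The hub is the centre \<open>w\<close> of the claw: \<open>x\<close>, \<open>v\<close>,
  \<open>y\<close>, \<open>t\<close>, \<open>z\<close> is a path in its neighbourhood.\<close>

lemma no_claw_attached:
  assumes "t \<noteq> v" "\<not> adj v t" and "{w, x, y, z} \<subseteq> N v" "distinct [x, y, z]"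
    and "adj w x" "adj w y" "adj w z" "adj t w" "adj t y" "adj t z"
  shows False
proof -
  have "distinct [x, v, y, t, z]" using assms by auto
  thus False using no_path5[of x v y t z w] assms by (auto simp: adj_commute)
qed

context
  fixes v t :: nat and S Z :: "nat set"
  assumes t: "t \<noteq> v" "\<not> adj v t"
  defines "S \<equiv> N v" and "Z \<equiv> N v - N t"
  assumes d5: "5 \<le> card S"
    and nb: "\<And>a b x y. \<not> block v a b x y"
begin

lemma fin_S: "finite S"
  by (simp add: S_def)

lemma S_iff: "s \<in> S \<longleftrightarrow> adj v s"
  by (simp add: S_def)

lemma Z_iff: "s \<in> Z \<longleftrightarrow> adj v s \<and> \<not> adj t s"
  by (auto simp: Z_def)

lemma ex_outside4: "\<exists>u\<in>S. u \<notin> {a, b, c, d}"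
proof (rule ccontr)
  assume "\<not> ?thesis"
  hence "S \<subseteq> {a, b, c, d}" by blast
  from card_mono[OF _ this] have "card S \<le> 4" by (auto simp: card_insert_if split: if_splits)
  thus False using d5 by simp
qed

text \<open>As \<open>t\<close> sees all of \<open>S\<close>, the claw bound limits degrees in
  \<open>S\<close> to 2. A vertex of degree 2 isolates everything outside its closed neighbourhood,
  because another edge would be joined to the path through \<open>t\<close>; a fifth vertex of
  \<open>S\<close> serves as the end of that path where needed. Otherwise \<open>S\<close> induces a
  matching.\<close>

lemma complete_attachment_sparse:
  assumes Z: "Z = {}"
  shows "degsum S + 2 < 2 * card S"
proof -
  have ta: "adj t s" if "s \<in> S" for s using Z that by (auto simp: Z_def S_def)
  have deg2: "card (N s \<inter> S) \<le> 2" if s: "s \<in> S" for s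
  proof (rule ccontr)
    assume "\<not> ?thesis"
    hence "3 \<le> card (N s \<inter> S)" by simp
    then obtain x y z where "x \<in> N s \<inter> S" "y \<in> N s \<inter> S" "z \<in> N s \<inter> S" "x \<noteq> y" "x \<noteq> z" "y \<noteq> z"
      by (rule card_ge_3E)
    thus False using no_claw_attached[OF t, of s x y z] ta s by (auto simp: S_iff)
  qed
  show ?thesis
  proof (cases "\<exists>b\<in>S. 2 \<le> card (N b \<inter> S)")
    case True
    then obtain b where b: "b \<in> S" "2 \<le> card (N b \<inter> S)" by blast
    then obtain a c where ac: "a \<in> N b \<inter> S" "c \<in> N b \<inter> S" "a \<noteq> c" by (auto elim: card_ge_2E)
    have Nb: "N b \<inter> S = {a, c}"
      using ac deg2[OF b(1)] by (intro card_seteq[symmetric]) auto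
    have ne: "a \<noteq> b" "c \<noteq> b" using ac by auto
    have iso: "N x \<inter> S = {}" if x: "x \<in> S - {a, b, c}" for x
    proof (rule ccontr)
      assume "N x \<inter> S \<noteq> {}"
      then obtain y where y: "adj x y" "y \<in> S" by auto
      have xy: "x \<noteq> y" using y by auto
      consider "y \<notin> {a, b, c}" | "y = b" | "y = a" | "y = c" by blast
      thus False
      proof cases
        case 1
        thus False using no_P3_P2_attached[OF t, of a b c x y] x y xy ac b ne ta
          by (auto simp: S_iff adj_commute)
      next
        case 2
        hence "x \<in> N b \<inter> S" using y x by (auto simp: adj_commute)
        thus False using x unfolding Nb by auto
      next
        case 3
        obtain u where u: "u \<in> S" "u \<notin> {x, a, b, c}" using ex_outside4 by blast
        have "{x, a, b, c, u} \<subseteq> N v" using u x ac b by (auto simp: S_def)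
        moreover have "distinct [x, a, b, c, u]" using u x ac(3) ne by auto
        moreover have "adj x a \<or> adj x c" "adj a b" "adj b c" "adj c b" "adj b a" "adj t a" "adj t c" "adj t u"
          using y 3 ac ta[of a] ta[of c] ta[of u] u by (auto simp: adj_commute)
        ultimately show False using no_P4_attached[OF t, of x a b c u] y 3 by blast
      next
        case 4
        obtain u where u: "u \<in> S" "u \<notin> {x, a, b, c}" using ex_outside4 by blast
        have "{x, c, b, a, u} \<subseteq> N v" using u x ac b by (auto simp: S_def)
        moreover have "distinct [x, c, b, a, u]" using u x ac(3) ne by auto
        moreover have "adj x a \<or> adj x c" "adj a b" "adj b c" "adj c b" "adj b a" "adj t a" "adj t c" "adj t u"
          using y 4 ac ta[of a] ta[of c] ta[of u] u by (auto simp: adj_commute)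
        ultimately show False using no_P4_attached[OF t, of x c b a u] y 4 by blast
      qed
    qed
    have sub: "{a, b, c} \<subseteq> S" using ac b by auto
    have "degsum S = (\<Sum>s\<in>{a, b, c}. card (N s \<inter> S))"
      unfolding degsum_def by (rule sum.mono_neutral_right[OF fin_S sub]) (use iso in auto)
    also have "\<dots> \<le> (\<Sum>s\<in>{a, b, c}. 2)" by (intro sum_mono deg2) (use sub in auto)
    also have "\<dots> \<le> 6" by (auto simp: card_insert_if)
    finally show ?thesis using d5 by simp
  next
    case False
    hence "degsum S \<le> (\<Sum>s\<in>S. 1)" unfolding degsum_def by (intro sum_mono) force
    thus ?thesis using d5 by simp
  qed
qed

text \<open>The 4-cycle is induced and is a component of \<open>S\<close>. Missing at most two
  vertices, \<open>t\<close> meets it; a path around the cycle, continued through \<open>t\<close>,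
  then forbids any neighbour of \<open>t\<close> in \<open>S\<close> off the cycle. So all vertices
  off the cycle lie in \<open>Z\<close>, and there are at most two.\<close>

lemma square_attachment_sparse:
  assumes Z: "card Z \<le> 2" and q: "{a, b, c, d} \<subseteq> S" "distinct [a, b, c, d]"
    and e: "adj a b" "adj b c" "adj c d" "adj a d"
  shows "degsum S + 1 < 2 * card S"
proof -
  let ?Q = "{a, b, c, d}"
  have cQ: "card ?Q = 4" using q(2) by simp
  have nac: "\<not> adj a c" using nb[of a c b d] q e by (auto simp: block_def S_iff adj_commute)
  have nbd: "\<not> adj b d" using nb[of b d a c] q e by (auto simp: block_def S_iff adj_commute)
  have out: "\<not> adj p u" if pQ: "p \<in> ?Q" and uS: "u \<in> S - ?Q" for p u
  proof
    assume pu: "adj p u"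
    consider "p = a" | "p = b" | "p = c" | "p = d" using pQ by blast
    thus False
    proof cases
      case 1 thus False using no_path5[of u a b c d v] uS pu q e by (auto simp: S_iff adj_commute)
    next
      case 2 thus False using no_path5[of u b c d a v] uS pu q e by (auto simp: S_iff adj_commute)
    next
      case 3 thus False using no_path5[of u c d a b v] uS pu q e by (auto simp: S_iff adj_commute)
    next
      case 4 thus False using no_path5[of u d a b c v] uS pu q e by (auto simp: S_iff adj_commute)
    qed
  qed
  have "\<not> ?Q \<subseteq> Z"
  proof
    assume "?Q \<subseteq> Z"
    hence "card ?Q \<le> card Z" by (intro card_mono) (auto simp: Z_def)
    thus False using cQ Z by simp
  qed
  then obtain p where p: "p \<in> ?Q" "adj t p" using q(1) by (auto simp: Z_iff S_iff)
  have ZS: "S - ?Q \<subseteq> Z"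
  proof
    fix u assume u: "u \<in> S - ?Q"
    have "\<not> adj t u"
    proof
      assume tu: "adj t u"
      consider "p = a" | "p = b" | "p = c" | "p = d" using p by blast
      thus False
      proof cases
        case 1 thus False using no_P4_attached[OF t, of b c d a u] tu u p q e by (auto simp: S_iff adj_commute)
      next
        case 2 thus False using no_P4_attached[OF t, of c d a b u] tu u p q e by (auto simp: S_iff adj_commute)
      next
        case 3 thus False using no_P4_attached[OF t, of d a b c u] tu u p q e by (auto simp: S_iff adj_commute)
      next
        case 4 thus False using no_P4_attached[OF t, of a b c d u] tu u p q e by (auto simp: S_iff adj_commute)
      qed
    qed
    thus "u \<in> Z" using u by (simp add: Z_iff S_iff)
  qed
  have r: "card (S - ?Q) = card S - 4" using card_Diff_subset[of ?Q S] q(1) cQ by simp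
  have "card (S - ?Q) \<le> 2" using card_mono[OF _ ZS] Z by (simp add: Z_def)
  have "card (N s \<inter> S) \<le> 2" if s: "s \<in> ?Q" for s
  proof -
    have inQ: "x \<in> ?Q" if "x \<in> N s \<inter> S" for x using out[OF s, of x] that by auto
    have "N s \<inter> S \<subseteq> {b, d} \<or> N s \<inter> S \<subseteq> {a, c}"
    proof (cases "s \<in> {a, c}")
      case True
      have "x \<in> {b, d}" if x: "x \<in> N s \<inter> S" for x
        using inQ[OF x] x True nac by (auto simp: adj_commute)
      thus ?thesis by blast
    next
      case False
      have "x \<in> {a, c}" if x: "x \<in> N s \<inter> S" for x
        using inQ[OF x] x s False nbd by (auto simp: adj_commute)
      thus ?thesis by blast
    qed
    thus ?thesis
    proof
      assume "N s \<inter> S \<subseteq> {b, d}"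
      from card_mono[OF _ this] show ?thesis by (auto simp: card_insert_if split: if_splits)
    next
      assume "N s \<inter> S \<subseteq> {a, c}"
      from card_mono[OF _ this] show ?thesis by (auto simp: card_insert_if split: if_splits)
    qed
  qed
  hence "(\<Sum>s\<in>?Q. card (N s \<inter> S)) \<le> (\<Sum>s\<in>?Q. 2)" by (intro sum_mono)
  hence 1: "(\<Sum>s\<in>?Q. card (N s \<inter> S)) \<le> 8" using cQ by simp
  have "card (N s \<inter> S) \<le> card (S - ?Q) - 1" if s: "s \<in> S - ?Q" for s
  proof -
    have "N s \<inter> S \<subseteq> S - ?Q - {s}"
    proof
      fix u assume u: "u \<in> N s \<inter> S"
      hence "adj u s" "u \<noteq> s" by (auto simp: adj_commute)
      thus "u \<in> S - ?Q - {s}" using out[OF _ s, of u] u by blast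
    qed
    from card_mono[OF _ this] show ?thesis using s fin_S by simp
  qed
  hence 2: "(\<Sum>s\<in>S - ?Q. card (N s \<inter> S)) \<le> (\<Sum>s\<in>S - ?Q. card (S - ?Q) - 1)" by (intro sum_mono)
  have "degsum S = (\<Sum>s\<in>?Q. card (N s \<inter> S)) + (\<Sum>s\<in>S - ?Q. card (N s \<inter> S))"
    unfolding degsum_def using sum.subset_diff[OF q(1) fin_S, of "\<lambda>s. card (N s \<inter> S)"] by (simp only: add.commute)
  \<comment> \<open>One or two vertices off the cycle give the bounds 8 and 10, which lie below
    \<open>2 * card S - 1\<close>, that is 9 and 11.\<close>
  hence "degsum S \<le> 8 + card (S - ?Q) * (card (S - ?Q) - 1)" using 1 2 by simp
  moreover have "card (S - ?Q) = 1 \<or> card (S - ?Q) = 2" using \<open>card (S - ?Q) \<le> 2\<close> r d5 by linarith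
  ultimately show ?thesis using r d5 by auto
qed

text \<open>\<open>P\<close> consists of leaves at \<open>a\<close>, and \<open>R\<close> is
  separate from the triangle. An edge inside \<open>R\<close> has both ends in \<open>Z\<close>, so
  degrees in \<open>R\<close> are at most 1, and the edge count then leaves no room for
  \<open>R\<close>. There remain a triangle and at least two leaves, of which \<open>t\<close>
  misses at most two vertices; every choice of these yields a forbidden path or claw.\<close>

lemma triangle_attachment_sparse_aux:
  assumes Z: "card Z \<le> 2" and q: "{a, b, c} \<subseteq> S" "distinct [a, b, c]"
    and e: "adj a b" "adj b c" "adj a c"
    and Nb: "N b \<inter> S \<subseteq> {a, c}" and Nc: "N c \<inter> S \<subseteq> {a, b}"
  shows "degsum S + 1 < 2 * card S"
proof (rule ccontr)
  assume dense: "\<not> ?thesis"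
  have finZ: "finite Z" by (simp add: Z_def)
  define P where "P = N a \<inter> S - {b, c}"
  define R where "R = S - {a, b, c} - P"
  have fin: "finite P" "finite R" using fin_S by (auto simp: P_def R_def)
  have NP: "N x \<inter> S \<subseteq> {a}" if x: "x \<in> P" for x
  proof
    fix y assume y: "y \<in> N x \<inter> S"
    show "y \<in> {a}"
    proof (rule ccontr)
      assume "y \<notin> {a}"
      moreover have "y \<noteq> b" "y \<noteq> c" using y x Nb Nc by (auto simp: P_def adj_commute)
      moreover have "x \<noteq> a" "x \<noteq> y" using x y by (auto simp: P_def)
      ultimately show False using no_path5[of y x a b c v] x y q e by (auto simp: P_def S_iff adj_commute)
    qed
  qed
  have "\<not> {a, b, c} \<subseteq> Z"
  proof
    assume "{a, b, c} \<subseteq> Z"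
    hence "card {a, b, c} \<le> card Z" by (intro card_mono finZ)
    thus False using q(2) Z by simp
  qed
  then obtain p where p: "p \<in> {a, b, c}" "adj t p" using q(1) by (auto simp: Z_iff S_iff)
  have NR: "N x \<inter> S \<subseteq> R" if x: "x \<in> R" for x
  proof
    fix y assume y: "y \<in> N x \<inter> S"
    have xe: "x \<noteq> a" "x \<noteq> b" "x \<noteq> c" "x \<notin> P" "x \<in> S" using x by (auto simp: R_def)
    have "y \<noteq> a" using y xe by (auto simp: P_def adj_commute)
    moreover have "y \<noteq> b" "y \<noteq> c" using y xe Nb Nc by (auto simp: adj_commute)
    moreover have "y \<notin> P"
    proof
      assume "y \<in> P"
      moreover have "x \<in> N y \<inter> S" using y xe by (auto simp: adj_commute)
      ultimately have "x \<in> {a}" using NP by blast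
      thus False using xe by simp
    qed
    ultimately show "y \<in> R" using y by (auto simp: R_def)
  qed
  have RZ: "x \<in> Z" if x: "x \<in> R" "y \<in> N x \<inter> S" for x y
  proof -
    have "y \<in> R" using NR x by blast
    hence ne: "x \<notin> {a, b, c}" "y \<notin> {a, b, c}" "x \<noteq> y" "x \<in> S" "y \<in> S" using x by (auto simp: R_def)
    have "\<not> adj t x"
    proof
      assume tx: "adj t x"
      consider "p = a" | "p = b" | "p = c" using p by blast
      thus False
      proof cases
        case 1 thus False using no_P3_P2_attached[OF t, of a b c x y] tx p ne x q e by (auto simp: S_iff adj_commute)
      next
        case 2 thus False using no_P3_P2_attached[OF t, of b a c x y] tx p ne x q e by (auto simp: S_iff adj_commute)
      next
        case 3 thus False using no_P3_P2_attached[OF t, of c a b x y] tx p ne x q e by (auto simp: S_iff adj_commute)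
      qed
    qed
    thus ?thesis using ne by (simp add: Z_iff S_iff)
  qed
  have dR: "card (N x \<inter> S) \<le> 1" if x: "x \<in> R" for x
  proof (cases "N x \<inter> S = {}")
    case False
    hence xZ: "x \<in> Z" using RZ x by blast
    have "N x \<inter> S \<subseteq> Z - {x}"
    proof
      fix y assume y: "y \<in> N x \<inter> S"
      have "y \<in> R" using NR x y by blast
      moreover have "x \<in> N y \<inter> S" using y x by (auto simp: R_def adj_commute)
      ultimately show "y \<in> Z - {x}" using RZ y by auto
    qed
    from card_mono[OF _ this] show ?thesis using xZ Z finZ by simp
  qed simp
  have "S = insert a (insert b (insert c (P \<union> R)))" using q(1) by (auto simp: P_def R_def)
  moreover have disj: "a \<notin> P \<union> R" "b \<notin> P \<union> R" "c \<notin> P \<union> R" "P \<inter> R = {}" by (auto simp: P_def R_def)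
  ultimately have cS: "card S = 3 + card P + card R"
    and dS: "degsum S = card (N a \<inter> S) + card (N b \<inter> S) + card (N c \<inter> S)
       + (\<Sum>s\<in>P. card (N s \<inter> S)) + (\<Sum>s\<in>R. card (N s \<inter> S))"
    unfolding degsum_def using fin q(2) by (simp_all add: card_Un_disjoint sum.union_disjoint)
  have "N a \<inter> S \<subseteq> insert b (insert c P)" by (auto simp: P_def)
  from card_mono[OF _ this] have ca: "card (N a \<inter> S) \<le> card P + 2"
    using fin(1) disj q(2) by (auto simp: card_insert_if split: if_splits)
  have cb: "card (N b \<inter> S) \<le> 2" "card (N c \<inter> S) \<le> 2"
    using card_mono[OF _ Nb] card_mono[OF _ Nc] q(2) by simp_all
  have "(\<Sum>s\<in>P. card (N s \<inter> S)) \<le> (\<Sum>s\<in>P. 1)"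
    using NP by (intro sum_mono) (metis card_mono finite.emptyI finite_insert card.empty card_insert_disjoint empty_iff One_nat_def)
  hence cP: "(\<Sum>s\<in>P. card (N s \<inter> S)) \<le> card P" by simp
  have "(\<Sum>s\<in>R. card (N s \<inter> S)) \<le> (\<Sum>s\<in>R. 1)" by (intro sum_mono dR)
  hence cR: "(\<Sum>s\<in>R. card (N s \<inter> S)) \<le> card R" by simp
  \<comment> \<open>The bounds add up to \<open>6 + 2 * card P + card R\<close>, while density
    requires \<open>5 + 2 * card P + 2 * card R\<close>.\<close>
  have "card R \<le> 1" using dense cS dS ca cb cP cR by linarith
  have "(\<Sum>s\<in>R. card (N s \<inter> S)) = 0"
  proof (rule sum.neutral, intro ballI)
    fix x assume x: "x \<in> R"
    hence "R = {x}" using \<open>card R \<le> 1\<close> fin(2) card_le_Suc0_iff_eq[of R] by auto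
    hence "N x \<inter> S = {}" using NR[OF x] by auto
    thus "card (N x \<inter> S) = 0" by simp
  qed
  hence R0: "card R = 0" using dense cS dS ca cb cP by linarith
  hence "2 \<le> card P" using cS d5 by simp
  then obtain x1 x2 where x: "x1 \<in> P" "x2 \<in> P" "x1 \<noteq> x2" by (rule card_ge_2E)
  have xS: "s \<in> S \<and> adj a s \<and> s \<notin> {a, b, c}" if "s \<in> P" for s using that by (auto simp: P_def)
  show False
  proof (cases "adj t b \<or> adj t c")
    case True
    have PZ: "P \<subseteq> Z"
    proof
      fix x assume xP: "x \<in> P"
      obtain x' where x': "x' \<in> P" "x' \<noteq> x" using x by metis
      have "\<not> adj t x"
        using True no_P4_attached[OF t, of x' a c b x] no_P4_attached[OF t, of x' a b c x]
          xS[OF xP] xS[OF x'(1)] x'(2) q e by (auto simp: S_iff adj_commute)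
      thus "x \<in> Z" using xS[OF xP] by (simp add: Z_iff S_iff)
    qed
    \<comment> \<open>The leaves use up both missing edges, so \<open>t\<close> sees the whole
      triangle.\<close>
    hence "P = Z" using \<open>2 \<le> card P\<close> Z finZ by (intro card_seteq) auto
    hence "adj t a" "adj t b" "adj t c" using q disj by (auto simp: Z_iff S_iff)
    thus False using no_claw_attached[OF t, of a x1 b c] xS[OF x(1)] q e by (auto simp: S_iff)
  next
    case False
    hence "{b, c} \<subseteq> Z" using q by (auto simp: Z_iff S_iff)
    hence "{b, c} = Z" using q(2) Z finZ by (intro card_seteq) auto
    hence "adj t a" "adj t x1" "adj t x2" using q xS[OF x(1)] xS[OF x(2)] by (auto simp: Z_iff S_iff)
    thus False using no_claw_attached[OF t, of a b x1 x2] xS[OF x(1)] xS[OF x(2)] x(3) q e by (auto simp: S_iff)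
  qed
qed

text \<open>At most one vertex of the triangle has neighbours in \<open>S\<close> outside it: two
  such vertices give a block if they share an outer neighbour and a 5-vertex path if not.\<close>

lemma triangle_attachment_sparse:
  assumes Z: "card Z \<le> 2" and q: "{a, b, c} \<subseteq> S" "distinct [a, b, c]"
    and e: "adj a b" "adj b c" "adj a c"
  shows "degsum S + 1 < 2 * card S"
proof -
  have one: False if h: "{p, q, r} \<subseteq> S" "distinct [p, q, r]" "adj p q" "adj q r" "adj p r"
    "x \<in> N p \<inter> S - {p, q, r}" "y \<in> N q \<inter> S - {p, q, r}" for p q r x y
  proof (cases "x = y")
    case True
    thus False using nb[of p q r x] h by (auto simp: block_def S_iff adj_commute)
  next
    case False
    moreover have "x \<noteq> p" using h by auto
    ultimately show False using no_path5[of x p r q y v] h by (auto simp: S_iff adj_commute)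
  qed
  consider "N b \<inter> S - {a, b, c} = {}" "N c \<inter> S - {a, b, c} = {}"
    | "N a \<inter> S - {a, b, c} = {}" "N c \<inter> S - {a, b, c} = {}"
    | "N a \<inter> S - {a, b, c} = {}" "N b \<inter> S - {a, b, c} = {}"
  proof -
    have "{a, c, b} = {a, b, c}" "{b, c, a} = {a, b, c}" by auto
    note perm = this
    have 1: "N a \<inter> S - {a, b, c} = {} \<or> N b \<inter> S - {a, b, c} = {}"
      using one[OF q e] by blast
    have 2: "N a \<inter> S - {a, b, c} = {} \<or> N c \<inter> S - {a, b, c} = {}"
      using one[of a c b, unfolded perm, OF q(1) _ e(3) _ e(1)] q(2) e(2) adj_commute by fastforce
    have 3: "N b \<inter> S - {a, b, c} = {} \<or> N c \<inter> S - {a, b, c} = {}"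
      using one[of b c a, unfolded perm, OF q(1) _ e(2)] q(2) e(1,3) adj_commute by fastforce
    from 1 2 3 that show thesis by blast
  qed
  thus ?thesis
  proof cases
    case 1
    thus ?thesis using q e by (intro triangle_attachment_sparse_aux[OF Z, of a b c]) auto
  next
    case 2
    thus ?thesis using q e by (intro triangle_attachment_sparse_aux[OF Z, of b a c]) (auto simp: adj_commute)
  next
    case 3
    thus ?thesis using q e by (intro triangle_attachment_sparse_aux[OF Z, of c a b]) (auto simp: adj_commute)
  qed
qed

text \<open>If this fails, \<open>card Z\<close> and the deficit of \<open>degsum S\<close> below
  \<open>2 * card S\<close> add up to at most 2. An empty \<open>Z\<close> contradicts the complete
  case; otherwise the deficit is at most 1, which forces a triangle or a 4-cycle in
  \<open>S\<close>.\<close>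

lemma nonneighbour_sparse_no_block: "degsum (N v) + card (N t \<inter> N v) + 2 < 3 * card (N v)"
proof (rule ccontr)
  assume "\<not> ?thesis"
  hence dense: "3 * card S \<le> degsum S + card (N t \<inter> S) + 2" unfolding S_def by simp
  have "card (N t \<inter> S) + card Z = card S"
  proof -
    have "S = (N t \<inter> S) \<union> Z" by (auto simp: Z_def S_def)
    moreover have "(N t \<inter> S) \<inter> Z = {}" by (auto simp: Z_def)
    ultimately show ?thesis by (metis card_Un_disjoint fin_S finite_Un)
  qed
  moreover have "degsum S \<le> 2 * card S" using degsum_le_twice_card[of S v] nb by (simp add: S_def)
  ultimately have Z: "card Z \<le> 2" and D: "2 * card S + card Z \<le> degsum S + 2" using dense by linarith+
  show False
  proof (cases "Z = {}")
    case True
    thus False using complete_attachment_sparse D by simp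
  next
    case False
    hence "card Z \<noteq> 0" by (simp add: Z_def)
    hence D': "2 * card S \<le> degsum S + 1" using D by simp
    have "S \<noteq> {}" using d5 by auto
    have SN: "S \<subseteq> N v" by (simp add: S_def)
    from SN \<open>S \<noteq> {}\<close> D' show False
    proof (cases rule: dense_has_short_cycle)
      case (triangle a b c)
      thus False using triangle_attachment_sparse[OF Z, of a b c] D' by simp
    next
      case (square a b c d)
      thus False using square_attachment_sparse[OF Z, of a b c d] D' by simp
    qed
  qed
qed

end

section \<open>The union of all blocks in a neighbourhood\<close>

lemma blocks_subset: "blocks v \<subseteq> N v"
  by (auto simp: blocks_def block_def)

lemma block_subset_blocks: "block v a b x y \<Longrightarrow> {a, b, x, y} \<subseteq> blocks v"
  unfolding blocks_def by blast

lemma blocks_closed: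
  assumes "s \<in> blocks v" "adj v u" "adj s u"
  shows "u \<in> blocks v"
proof -
  obtain a b x y where B: "block v a b x y" "s \<in> {a, b, x, y}" using assms(1) unfolding blocks_def by blast
  show ?thesis using block_closed[OF B(1) _ B(2)] assms block_subset_blocks[OF B(1)] by auto
qed

lemma blocks_degree:
  assumes "s \<in> blocks v"
  shows "card (N s \<inter> N v) \<le> 3"
proof -
  obtain a b x y where B: "block v a b x y" "s \<in> {a, b, x, y}" using assms(1) unfolding blocks_def by blast
  have "N s \<inter> N v \<subseteq> {a, b, x, y} - {s}" using block_closed[OF B(1) _ B(2)] by (intro subsetI) auto
  hence "card (N s \<inter> N v) \<le> card ({a, b, x, y} - {s})" by (intro card_mono) auto
  also have "\<dots> = 3" using B by (simp add: block_def)
  finally show ?thesis .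
qed

lemma blocks_attached:
  assumes "t \<noteq> v" "\<not> adj v t" "p \<in> blocks v" "adj t p"
  shows "card (N t \<inter> N v) \<le> 2"
proof -
  obtain a b x y where B: "block v a b x y" "p \<in> {a, b, x, y}" using assms(3) unfolding blocks_def by blast
  show ?thesis using block_attached_card_le_2[OF B(1) assms(1,2) B(2) assms(4)] .
qed

lemma degsum_blocks:
  "degsum (N v) = (\<Sum>s\<in>blocks v. card (N s \<inter> N v)) + degsum (N v - blocks v)"
proof -
  have "degsum (N v - blocks v) = (\<Sum>s\<in>N v - blocks v. card (N s \<inter> N v))"
    unfolding degsum_def
  proof (rule sum.cong)
    fix s assume s: "s \<in> N v - blocks v"
    have "N s \<inter> (N v - blocks v) = N s \<inter> N v" using s blocks_closed[of _ v s] by (auto simp: adj_commute)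
    thus "card (N s \<inter> (N v - blocks v)) = card (N s \<inter> N v)" by simp
  qed simp
  thus ?thesis unfolding degsum_def[of "N v"]
    using sum.subset_diff[OF blocks_subset finite_N, of "\<lambda>s. card (N s \<inter> N v)" v] by simp
qed

lemma degsum_off_blocks: "degsum (N v - blocks v) \<le> 2 * card (N v - blocks v)"
proof (rule degsum_le_twice_card)
  fix a b x y assume "{a, b, x, y} \<subseteq> N v - blocks v"
  thus "\<not> block v a b x y" using block_subset_blocks[of v a b x y] by blast
qed auto

text \<open>Being components, two blocks have equal or disjoint vertex sets.\<close>

lemma block_eq_blocks_or_card_ge_8:
  assumes B: "block v a b x y"
  shows "blocks v = {a, b, x, y} \<or> 8 \<le> card (blocks v)"
proof (cases "blocks v \<subseteq> {a, b, x, y}")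
  case True
  thus ?thesis using block_subset_blocks[OF B] by blast
next
  case False
  then obtain s where s: "s \<in> blocks v" "s \<notin> {a, b, x, y}" by blast
  then obtain a' b' x' y' where B': "block v a' b' x' y'" "s \<in> {a', b', x', y'}"
    unfolding blocks_def by blast
  have cl: "q \<in> {a, b, x, y}" if "p \<in> {a, b, x, y}" "q \<in> {a', b', x', y'}" "adj p q" for p q
    using block_closed[OF B, of q p] that B'(1) by (auto simp: block_def)
  have "{a, b, x, y} \<inter> {a', b', x', y'} = {}"
  proof (rule ccontr)
    assume "\<not> ?thesis"
    then obtain p where p: "p \<in> {a, b, x, y}" "p \<in> {a', b', x', y'}" by blast
    have e: "adj a' b'" "adj a' x'" "adj a' y'" "adj b' x'" "adj b' y'" "adj b' a'" "adj x' a'" "adj y' a'"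
       "adj x' b'" "adj y' b'" using B'(1) by (auto simp: block_def adj_commute)
    have "a' \<in> {a, b, x, y}" 
      using p cl[of p a'] e by blast
    moreover from this have "b' \<in> {a, b, x, y}" "x' \<in> {a, b, x, y}" "y' \<in> {a, b, x, y}"
      using cl[of a' b'] cl[of a' x'] cl[of a' y'] e by blast+
    ultimately show False using s(2) B'(2) by blast
  qed
  hence "card ({a, b, x, y} \<union> {a', b', x', y'}) = 8"
    using B B'(1) by (subst card_Un_disjoint) (auto simp: block_def)
  moreover have "card ({a, b, x, y} \<union> {a', b', x', y'}) \<le> card (blocks v)"
    using block_subset_blocks[OF B] block_subset_blocks[OF B'(1)] finite_subset[OF blocks_subset finite_N]
    by (intro card_mono) auto
  ultimately show ?thesis by simp
qed

text \<open>A block vertex has degree at most 3, one more than the average possible off the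
  blocks.\<close>

lemma degsum_le_blocks: "degsum (N v) \<le> 2 * card (N v) + card (blocks v)"
proof -
  have "(\<Sum>s\<in>blocks v. card (N s \<inter> N v)) \<le> (\<Sum>s\<in>blocks v. 3)"
    by (intro sum_mono blocks_degree)
  moreover have "card (N v) = card (blocks v) + card (N v - blocks v)"
    using card_Diff_subset[OF finite_subset[OF blocks_subset finite_N] blocks_subset] card_mono[OF finite_N blocks_subset, of v]
    by simp
  ultimately show ?thesis using degsum_blocks[of v] degsum_off_blocks[of v] by simp
qed

section \<open>Edges between a neighbourhood and the non-neighbours\<close>

definition far :: "nat \<Rightarrow> nat set" where
  "far v = {..<n} - insert v (N v)"

lemma finite_far [simp]: "finite (far v)"
  by (simp add: far_def)

lemma far_iff: "t \<in> far v \<longleftrightarrow> t < n \<and> t \<noteq> v \<and> \<not> adj v t"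
  by (auto simp: far_def)

lemma card_far: "v < n \<Longrightarrow> card (far v) + card (N v) + 1 = n"
proof -
  assume v: "v < n"
  have sub: "insert v (N v) \<subseteq> {..<n}" using N_subset[of v] v by auto
  have "card (far v) + card (insert v (N v)) = card {..<n}"
    unfolding far_def using card_Diff_subset[OF _ sub] card_mono[OF _ sub] by simp
  moreover have "v \<notin> N v" by simp
  ultimately show ?thesis by (simp del: in_N)
qed

text \<open>Blocks raise \<open>degsum\<close>, but every non-neighbour pays for this: if attached
  to a block it has at most two neighbours in \<open>N v\<close>, and if not it misses all of
  \<open>blocks v\<close>. Two non-neighbours pay at least 3 more than is gained.\<close>

lemma block_far_sparse:
  assumes B: "block v a b x y" and d5: "5 \<le> card (N v)" and c2: "2 \<le> card (far v)"
  shows "degsum (N v) + (\<Sum>t\<in>far v. card (N t \<inter> N v)) + 3 \<le> (card (far v) + 2) * card (N v)"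
proof -
  let ?d = "card (N v)" and ?L = "card (blocks v)" and ?c = "card (far v)"
  have finH: "finite (blocks v)" using finite_subset[OF blocks_subset finite_N] .
  have Ld: "?L \<le> ?d" by (rule card_mono[OF finite_N blocks_subset])
  have unatt: "card (N t \<inter> N v) + ?L \<le> ?d" if "\<And>p. p \<in> blocks v \<Longrightarrow> \<not> adj t p" for t
  proof -
    have "N t \<inter> N v \<subseteq> N v - blocks v" using that by auto
    hence "card (N t \<inter> N v) \<le> ?d - ?L"
      using card_mono[of "N v - blocks v"] card_Diff_subset[OF finH blocks_subset] by simp
    thus ?thesis using Ld by simp
  qed
  \<comment> \<open>\<open>k\<close> is the surplus of \<open>degsum\<close> over
    \<open>2 * ?d\<close> and \<open>m\<close> the number of edges missing at each non-neighbour.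
    The pairs used are \<open>?L\<close>, \<open>?L - 2\<close> for several blocks, 4, 4 for one
    \<open>K_4\<close>, and 2, 3 for one \<open>K_4\<close> minus an edge.\<close>
  have fin: "degsum (N v) + (\<Sum>t\<in>far v. card (N t \<inter> N v)) + 3 \<le> (?c + 2) * ?d"
    if D: "degsum (N v) \<le> 2 * ?d + k" and m: "\<And>t. t \<in> far v \<Longrightarrow> card (N t \<inter> N v) + m \<le> ?d"
      and km: "k + 3 \<le> 2 * m" for k m
  proof -
    have "(\<Sum>t\<in>far v. card (N t \<inter> N v)) + ?c * m = (\<Sum>t\<in>far v. card (N t \<inter> N v) + m)"
      by (simp add: sum.distrib)
    also have "\<dots> \<le> (\<Sum>t\<in>far v. ?d)" by (intro sum_mono m)
    finally have "(\<Sum>t\<in>far v. card (N t \<inter> N v)) + ?c * m \<le> ?c * ?d" by simp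
    moreover have "2 * m \<le> ?c * m" using c2 by (rule mult_le_mono1)
    ultimately show ?thesis using D km unfolding add_mult_distrib by linarith
  qed
  consider "8 \<le> ?L" | "blocks v = {a, b, x, y}" "adj x y" | "blocks v = {a, b, x, y}" "\<not> adj x y"
    using block_eq_blocks_or_card_ge_8[OF B] by blast
  thus ?thesis
  proof cases
    case 1
    show ?thesis
    proof (rule fin[of ?L "?L - 2"])
      fix t assume t: "t \<in> far v"
      show "card (N t \<inter> N v) + (?L - 2) \<le> ?d"
      proof (cases "\<exists>p\<in>blocks v. adj t p")
        case True
        hence "card (N t \<inter> N v) \<le> 2" using blocks_attached t by (auto simp: far_iff)
        thus ?thesis using 1 Ld by simp
      next
        case False
        thus ?thesis using unatt[of t] by auto
      qed
    qed (use degsum_le_blocks 1 in auto)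
  next
    case 2
    have L4: "?L = 4" using 2 B by (simp add: block_def)
    show ?thesis
    proof (rule fin[of 4 4])
      fix t assume t: "t \<in> far v"
      show "card (N t \<inter> N v) + 4 \<le> ?d"
      proof (cases "\<exists>p\<in>blocks v. adj t p")
        case True
        hence "card (N t \<inter> N v) \<le> 1"
          using block_attached_card_le_1[OF B 2(2), of t] t unfolding 2(1) by (auto simp: far_iff)
        thus ?thesis using d5 by simp
      next
        case False
        thus ?thesis using unatt[of t] L4 by auto
      qed
    qed (use degsum_le_blocks[of v] L4 in auto)
  next
    case 3
    have L4: "?L = 4" using 3 B by (simp add: block_def)
    have two: "card (N s \<inter> N v) \<le> 2" if s: "s \<in> {x, y}" for s
    proof -
      have "N s \<inter> N v \<subseteq> {a, b, x, y}" using block_closed[OF B, of _ s] s by (intro subsetI) auto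
      moreover have "x \<notin> N s" "y \<notin> N s" using s 3(2) by (auto simp: adj_commute)
      ultimately have "N s \<inter> N v \<subseteq> {a, b}" by blast
      from card_mono[OF _ this] show ?thesis by (auto simp: card_insert_if split: if_splits)
    qed
    have "(\<Sum>s\<in>blocks v. card (N s \<inter> N v)) = card (N a \<inter> N v) + card (N b \<inter> N v) + card (N x \<inter> N v) + card (N y \<inter> N v)"
      using B unfolding 3(1) by (simp add: block_def)
    also have "\<dots> \<le> 10"
      using two[of x] two[of y] blocks_degree[of a v] blocks_degree[of b v] unfolding 3(1) by simp
    finally have "degsum (N v) \<le> 10 + 2 * (?d - 4)"
      using degsum_blocks[of v] degsum_off_blocks[of v] card_Diff_subset[OF finH blocks_subset] L4 by simp
    hence D: "degsum (N v) \<le> 2 * ?d + 2" using d5 by simp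
    show ?thesis
    proof (rule fin[of 2 3, OF D])
      fix t assume t: "t \<in> far v"
      show "card (N t \<inter> N v) + 3 \<le> ?d"
      proof (cases "\<exists>p\<in>blocks v. adj t p")
        case True
        hence "card (N t \<inter> N v) \<le> 2" using blocks_attached t by (auto simp: far_iff)
        thus ?thesis using d5 by simp
      next
        case False
        thus ?thesis using unatt[of t] L4 by auto
      qed
    qed simp
  qed
qed

text \<open>With at most four neighbours there are no 5-vertex paths in \<open>N v\<close>, so the
  hub becomes a vertex \<open>p\<close> of \<open>N v\<close>: two nearly complete non-neighbours
  \<open>t\<close>, \<open>u\<close> and two neighbours \<open>q\<close>, \<open>r\<close> of
  \<open>p\<close> form the path \<open>t\<close>, \<open>q\<close>, \<open>v\<close>,
  \<open>r\<close>, \<open>u\<close> around it. If a block occurs, it is all of \<open>N v\<close>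
  and is counted directly.\<close>

lemma low_degree_far_sparse:
  assumes d: "1 \<le> card (N v)" "card (N v) \<le> 4" and c2: "2 \<le> card (far v)"
  shows "degsum (N v) + (\<Sum>t\<in>far v. card (N t \<inter> N v)) + 1 < (card (far v) + 2) * card (N v)"
proof -
  let ?d = "card (N v)" and ?c = "card (far v)"
  have bnd: "(\<Sum>t\<in>far v. card (N t \<inter> N v)) \<le> ?c * m" if "\<And>t. t \<in> far v \<Longrightarrow> card (N t \<inter> N v) \<le> m" for m
    using sum_bounded_above[of "far v" "\<lambda>t. card (N t \<inter> N v)" m] that by simp
  have deg: "card (N s \<inter> N v) \<le> ?d - 1" if "s \<in> N v" for s
  proof -
    have "N s \<inter> N v \<subseteq> N v - {s}" by auto
    from card_mono[OF _ this] show ?thesis using that by simp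
  qed
  have D: "degsum (N v) \<le> ?d * (?d - 1)"
    unfolding degsum_def using sum_bounded_above[of "N v" "\<lambda>s. card (N s \<inter> N v)" "?d - 1"] deg by simp
  have le: "card (N t \<inter> N v) \<le> ?d" for t by (rule card_mono) auto
  show ?thesis
  proof (cases "\<exists>a b x y. block v a b x y")
    case True
    then obtain a b x y where B: "block v a b x y" by blast
    have 4: "?d = 4" "N v = {a, b, x, y}"
    proof -
      have sub: "{a, b, x, y} \<subseteq> N v" and c4: "card {a, b, x, y} = 4" using B by (auto simp: block_def)
      from card_mono[OF _ sub] c4 d show "?d = 4" by simp
      thus "N v = {a, b, x, y}" using card_seteq[OF _ sub] c4 by simp
    qed
    show ?thesis
    proof (cases "adj x y")
      case True
      have "card (N t \<inter> N v) \<le> 1" if t: "t \<in> far v" for t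
      proof (cases "N t \<inter> N v = {}")
        case False
        then obtain p where "p \<in> {a, b, x, y}" "adj t p" using 4(2) by auto
        thus ?thesis using block_attached_card_le_1[OF B True, of t p] t by (auto simp: far_iff)
      qed simp
      from bnd[OF this] show ?thesis using D 4(1) c2 by simp
    next
      case False
      have "card (N t \<inter> N v) \<le> 2" if t: "t \<in> far v" for t
      proof (cases "N t \<inter> N v = {}")
        case False
        then obtain p where "p \<in> {a, b, x, y}" "adj t p" using 4(2) by auto
        thus ?thesis using block_attached_card_le_2[OF B, of t p] t by (auto simp: far_iff)
      qed simp
      note 1 = bnd[OF this]
      have "N x \<inter> N v \<subseteq> {a, b}" "N y \<inter> N v \<subseteq> {a, b}" using False 4(2) by (auto simp: adj_commute)
      hence "card (N x \<inter> N v) \<le> 2" "card (N y \<inter> N v) \<le> 2"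
        using card_mono[of "{a, b}" "N x \<inter> N v"] card_mono[of "{a, b}" "N y \<inter> N v"] B by (simp_all add: block_def)
      hence "degsum (N v) \<le> 10"
        unfolding degsum_def using deg[of a] deg[of b] B 4 by (simp add: block_def)
      thus ?thesis using 1 4(1) c2 by simp
    qed
  next
    case False
    hence D2: "degsum (N v) \<le> 2 * ?d" by (intro degsum_le_twice_card) auto
    show ?thesis
    proof (rule ccontr)
      assume dense: "\<not> ?thesis"
      have miss: "(\<Sum>t\<in>far v. card (N t \<inter> N v)) + (\<Sum>t\<in>far v. card (N v - N t)) = ?c * ?d"
      proof -
        have "card (N t \<inter> N v) + card (N v - N t) = ?d" for t
        proof -
          have "N v = (N t \<inter> N v) \<union> (N v - N t)" "(N t \<inter> N v) \<inter> (N v - N t) = {}" by auto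
          thus ?thesis by (metis card_Un_disjoint finite_N finite_Un)
        qed
        thus ?thesis unfolding sum.distrib[symmetric] by simp
      qed
      \<comment> \<open>Missing edges and the deficit of \<open>degsum\<close> below
        \<open>2 * ?d\<close> amount to at most 1 together.\<close>
      have m1: "(\<Sum>t\<in>far v. card (N v - N t)) \<le> 1" and D1: "2 * ?d \<le> degsum (N v) + 1"
        using miss D2 dense by (auto simp: algebra_simps)
      obtain t1 t2 where t12: "t1 \<in> far v" "t2 \<in> far v" "t1 \<noteq> t2" using card_ge_2E[OF c2] by blast
      have "(\<Sum>t\<in>{t1, t2}. card (N v - N t)) \<le> 1"
        using m1 sum_mono2[of "far v" "{t1, t2}" "\<lambda>t. card (N v - N t)"] t12 by simp
      hence "card (N v - N t1) + card (N v - N t2) \<le> 1" using t12 by simp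
      then obtain t u where tu: "t \<in> far v" "u \<in> far v" "t \<noteq> u" "card (N v - N t) \<le> 1" "card (N v - N u) = 0"
      proof (cases "card (N v - N t2) = 0")
        case True
        thus ?thesis using that[of t1 t2] t12 \<open>card (N v - N t1) + _ \<le> 1\<close> by simp
      next
        case False
        hence "card (N v - N t1) = 0" "card (N v - N t2) \<le> 1"
          using \<open>card (N v - N t1) + _ \<le> 1\<close> by linarith+
        thus ?thesis using that[of t2 t1] t12 by simp
      qed
      obtain s0 where s0: "N v - N t \<subseteq> {s0}"
        using tu(4) by (metis card_le_Suc0_iff_eq One_nat_def finite_N finite_Diff insertCI subsetI)
      have tt: "adj t s" if "adj v s" "s \<noteq> s0" for s using s0 that by auto
      have uu: "adj u s" if "adj v s" for s using tu(5) that by auto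
      have key: False if h: "adj p q" "adj p r" "q \<noteq> r" "adj v p" "adj v q" "adj v r" "p \<noteq> s0" for p q r
      proof (cases "adj t q")
        case True
        have "distinct [t, q, v, r, u]" using h tu by (auto simp: far_iff)
        thus False using no_path5[of t q v r u p] h True uu tt by (auto simp: adj_commute)
      next
        case False
        hence "adj t r" using tt h by metis
        moreover have "distinct [t, r, v, q, u]" using h tu by (auto simp: far_iff)
        ultimately show False using no_path5[of t r v q u p] h uu tt by (auto simp: adj_commute)
      qed
      have Nv: "N v \<noteq> {}" using d by auto
      show False
        using subset_refl Nv D1
      proof (cases rule: dense_has_short_cycle)
        case (triangle a b c)
        thus False using key[of a b c] key[of b a c] by (cases "a = s0") (auto simp: adj_commute)
      next
        case (square a b c d)
        thus False using key[of a b d] key[of b a c] by (cases "a = s0") (auto simp: adj_commute)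
      qed
    qed
  qed
qed

section \<open>Neighbourhoods attaining the second-order bound\<close>

lemma closed_part_sum:
  assumes R: "R \<subseteq> N v" and cl: "\<And>x. x \<in> R \<Longrightarrow> N x \<inter> N v \<subseteq> R"
    and nb: "\<And>a b x y. \<not> block v a b x y"
  shows "(\<Sum>x\<in>R. card (N x \<inter> N v) * (card (N x \<inter> N v) + 1)) \<le> 2 * card R * card R"
proof -
  have fin: "finite R" using R finite_subset finite_N by blast
  have eq: "N x \<inter> N v = N x \<inter> R" if "x \<in> R" for x using cl[OF that] R by auto
  have le: "card (N x \<inter> R) + 1 \<le> card R" if x: "x \<in> R" for x
  proof -
    have "N x \<inter> R \<subseteq> R - {x}" by auto
    from card_mono[OF _ this] have "card (N x \<inter> R) \<le> card R - 1" using fin x by simp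
    moreover have "0 < card R" using x fin card_gt_0_iff by blast
    ultimately show ?thesis by simp
  qed
  have "(\<Sum>x\<in>R. card (N x \<inter> N v) * (card (N x \<inter> N v) + 1)) \<le> (\<Sum>x\<in>R. card (N x \<inter> R) * card R)"
    using le eq by (intro sum_mono) (simp del: add_Suc_right)
  also have "\<dots> = degsum R * card R" unfolding degsum_def by (simp add: sum_distrib_right)
  also have "\<dots> \<le> (2 * card R) * card R"
    using degsum_le_twice_card[OF R] nb by (intro mult_right_mono) auto
  finally show ?thesis .
qed

text \<open>A star on \<open>d\<close> vertices has \<open>\<Sum> h = d * (d + 1) - 2\<close>, two
  short of the hypothesis, and one edge between leaves closes this gap. If the vertex
  \<open>w\<close> of maximum degree \<open>D\<close> misses \<open>r > 0\<close> vertices, the term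
  \<open>2 * D * r\<close> in \<open>d * (d + 1)\<close> is not matched by what these vertices can
  contribute.\<close>

lemma dominated_structure:
  fixes v :: nat
  defines "S \<equiv> N v"
  defines "h \<equiv> \<lambda>s. card (N s \<inter> S) * (card (N s \<inter> S) + 1)"
  assumes d6: "6 \<le> card S" and nb: "\<And>a b x y. \<not> block v a b x y"
    and big: "card S * (card S + 1) \<le> (\<Sum>s\<in>S. h s)"
  obtains w p q where "w \<in> S" "S - {w} \<subseteq> N w" "p \<in> S - {w}" "q \<in> S - {w}" "adj p q"
    "\<And>x y. x \<in> S - {w} \<Longrightarrow> y \<in> S - {w} \<Longrightarrow> adj x y \<Longrightarrow> {x, y} = {p, q}"
proof -
  have finS: "finite S" by (simp add: S_def)
  have Siff: "s \<in> S \<longleftrightarrow> adj v s" for s by (simp add: S_def)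
  define d where "d = card S"
  define g where "g = (\<lambda>s. card (N s \<inter> S))"
  have hg: "h s = g s * (g s + 1)" for s by (simp add: h_def g_def)
  have "S \<noteq> {}" using d6 by auto
  hence "Max (g ` S) \<in> g ` S" using finS by (intro Max_in) auto
  then obtain w where w: "w \<in> S" "g w = Max (g ` S)" by auto
  have w_max: "g s \<le> g w" if "s \<in> S" for s unfolding w(2) using that finS by (intro Max_ge) auto
  define D where "D = g w"
  define A where "A = N w \<inter> S"
  define R where "R = S - insert w A"
  define r where "r = card R"
  have fin: "finite A" "finite R" using finS by (auto simp: A_def R_def)
  have cA: "card A = D" by (simp add: A_def D_def g_def)
  have wA: "w \<notin> A" by (simp add: A_def)
  have S_eq: "S = insert w (A \<union> R)" using w(1) by (auto simp: A_def R_def)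
  have disj: "w \<notin> A \<union> R" "A \<inter> R = {}" by (auto simp: A_def R_def)
  have d_eq: "d = 1 + D + r"
    unfolding d_def S_eq using disj fin cA by (simp add: card_Un_disjoint r_def)
  have sum_eq: "(\<Sum>s\<in>S. h s) = h w + (\<Sum>s\<in>A. h s) + (\<Sum>s\<in>R. h s)"
    unfolding S_eq using disj fin by (simp add: sum.union_disjoint)
  \<comment> \<open>One factor of \<open>h\<close> is at most \<open>D + 1\<close> and the other
    sums to at most \<open>2 * d\<close>. Hence \<open>w\<close> is adjacent to at least half of the
    other vertices.\<close>
  have "d + 1 \<le> 2 * (D + 1)"
  proof -
    have "(\<Sum>s\<in>S. h s) \<le> (\<Sum>s\<in>S. g s * (D + 1))"
      unfolding hg D_def using w_max by (intro sum_mono mult_left_mono) auto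
    also have "\<dots> = degsum S * (D + 1)" unfolding degsum_def g_def by (rule sum_distrib_right[symmetric])
    also have "\<dots> \<le> (2 * d) * (D + 1)"
      unfolding d_def using degsum_le_twice_card[of S v] nb by (intro mult_right_mono) (auto simp: S_def)
    finally have "d * (d + 1) \<le> d * (2 * (D + 1))" using big by (simp add: d_def mult.assoc mult.left_commute)
    thus ?thesis using d6 unfolding d_def by (subst (asm) mult_le_cancel1) auto
  qed
  hence rD: "r \<le> D" and D3: "3 \<le> D" using d_eq d6 unfolding d_def by presburger+
  have Aiff: "s \<in> A \<longleftrightarrow> adj w s \<and> adj v s" for s by (auto simp: A_def Siff)
  have Riff: "s \<in> R \<longleftrightarrow> adj v s \<and> s \<noteq> w \<and> \<not> adj w s" for s by (auto simp: R_def A_def Siff)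
  have wS: "adj v w" using w(1) by (simp add: Siff)
  \<comment> \<open>Disjoint edges in \<open>A\<close> give the path \<open>x\<close>,
    \<open>y\<close>, \<open>w\<close>, \<open>x'\<close>, \<open>y'\<close>; edges with a common
    vertex form a block with \<open>w\<close>.\<close>
  have one_edge: "{x, y} = {x', y'}" if e: "x \<in> A" "y \<in> A" "adj x y" "x' \<in> A" "y' \<in> A" "adj x' y'" for x y x' y'
  proof (rule ccontr)
    assume ne: "{x, y} \<noteq> {x', y'}"
    have n: "x \<noteq> y" "x' \<noteq> y'" "w \<noteq> x" "w \<noteq> y" "w \<noteq> x'" "w \<noteq> y'" using e wA by auto
    have share: False if "p \<in> A" "q \<in> A" "s \<in> A" "adj p q" "adj q s" "p \<noteq> s" for p q s
    proof -
      have "w \<noteq> p" "w \<noteq> q" "w \<noteq> s" "p \<noteq> q" "q \<noteq> s" using that wA by auto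
      thus False using nb[of w q p s] that wS by (auto simp: block_def Aiff adj_commute)
    qed
    show False
    proof (cases "{x, y} \<inter> {x', y'} = {}")
      case True
      thus False using no_path5[of x y w x' y' v] e n wS by (auto simp: Aiff adj_commute)
    next
      case False
      then consider "x = x'" "y \<noteq> y'" | "x = y'" "y \<noteq> x'" | "y = x'" "x \<noteq> y'" | "y = y'" "x \<noteq> x'"
        using ne by blast
      thus False
      proof cases
        case 1 thus False using share[of y x y'] e by (auto simp: adj_commute)
      next
        case 2 thus False using share[of y x x'] e by (auto simp: adj_commute)
      next
        case 3 thus False using share[of x y y'] e by (auto simp: adj_commute)
      next
        case 4 thus False using share[of x y x'] e by (auto simp: adj_commute)
      qed
    qed
  qed
  have h_le: "h s \<le> k * (k + 1)" if "card (N s \<inter> S) \<le> k" for s k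
    unfolding h_def using that by (intro mult_le_mono) auto
  have hw: "h w = D * (D + 1)" by (simp add: hg D_def)
  have card_sub: "card (N s \<inter> S) \<le> card B" if "N s \<inter> S \<subseteq> B" "finite B" for s B
    using card_mono that by blast
  consider (full) "R = {}" | (apart) "R \<noteq> {}" "\<And>a u. a \<in> A \<Longrightarrow> u \<in> R \<Longrightarrow> \<not> adj a u"
    | (linked) a u where "a \<in> A" "u \<in> R" "adj a u" by blast
  thus thesis
  proof cases
    case full
    show thesis
    proof (cases "\<exists>p\<in>A. \<exists>q\<in>A. adj p q")
      case True
      then obtain p q where pq: "p \<in> A" "q \<in> A" "adj p q" by blast
      have SA: "S - {w} = A" using S_eq full wA by auto
      show thesis
      proof (rule that[of w p q])
        show "w \<in> S" by (rule w(1))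
        show "S - {w} \<subseteq> N w" unfolding SA by (auto simp: A_def)
        show "p \<in> S - {w}" "q \<in> S - {w}" "adj p q" unfolding SA using pq by auto
        show "{x, y} = {p, q}" if "x \<in> S - {w}" "y \<in> S - {w}" "adj x y" for x y
          using one_edge[of x y p q] that pq unfolding SA by simp
      qed
    next
      case False
      have "h s \<le> 2" if s: "s \<in> A" for s
      proof -
        have "N s \<inter> S \<subseteq> {w}" using False s S_eq full by auto
        from h_le[OF card_sub[OF this]] show ?thesis by simp
      qed
      hence "(\<Sum>s\<in>A. h s) \<le> (\<Sum>s\<in>A. 2)" by (intro sum_mono)
      hence "(\<Sum>s\<in>S. h s) \<le> D * (D + 1) + 2 * D" using sum_eq full hw cA by simp
      moreover have "card S = D + 1" using d_eq full by (simp add: d_def r_def)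
      ultimately show thesis using big by (simp add: algebra_simps)
    qed
  next
    case apart
    have r1: "1 \<le> r" unfolding r_def using apart fin by (simp add: Suc_le_eq card_gt_0_iff)
    \<comment> \<open>The ends of the only possible edge in \<open>A\<close> contribute 6 each and
      the other vertices 2 each.\<close>
    have "(\<Sum>s\<in>A. h s) \<le> 2 * D + 8"
    proof (cases "\<exists>p\<in>A. \<exists>q\<in>A. adj p q")
      case True
      then obtain p q where pq: "p \<in> A" "q \<in> A" "adj p q" by blast
      have pqne: "p \<noteq> q" using pq by auto
      have hpq: "h s \<le> 6" if s: "s \<in> {p, q}" for s
      proof -
        have "y \<in> {w, p, q} - {s}" if y: "y \<in> N s \<inter> S" for y
        proof (cases "y = w")
          case False
          hence "y \<in> A" using y S_eq apart(2)[of s y] s pq by auto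
          hence "{s, y} = {p, q}" using one_edge[of s y p q] pq s y by auto
          thus ?thesis using y by auto
        qed (use s pq wA in auto)
        hence sub: "N s \<inter> S \<subseteq> {w, p, q} - {s}" by blast
        have "card ({w, p, q} - {s}) \<le> 2" using s by (auto simp: card_insert_if card_Diff_singleton_if)
        hence "card (N s \<inter> S) \<le> 2" using card_sub[OF sub] by simp
        from h_le[OF this] show ?thesis by simp
      qed
      have "h s \<le> 2" if s: "s \<in> A - {p, q}" for s
      proof -
        have "y \<in> {w}" if y: "y \<in> N s \<inter> S" for y
        proof (rule ccontr)
          assume "y \<notin> {w}"
          hence "y \<in> A" using y S_eq apart(2)[of s y] s by auto
          hence "{s, y} = {p, q}" using one_edge[of s y p q] pq s y by auto
          thus False using s by auto
        qed
        hence "N s \<inter> S \<subseteq> {w}" by blast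
        from h_le[OF card_sub[OF this]] show ?thesis by simp
      qed
      hence "(\<Sum>s\<in>A - {p, q}. h s) \<le> (\<Sum>s\<in>A - {p, q}. 2)" by (intro sum_mono)
      moreover have "card (A - {p, q}) = D - 2" using pq pqne cA fin by (subst card_Diff_subset) auto
      moreover have "(\<Sum>s\<in>A. h s) = (\<Sum>s\<in>A - {p, q}. h s) + (h p + h q)"
        using sum.subset_diff[of "{p, q}" A h] pq pqne fin by auto
      moreover have "h p \<le> 6" "h q \<le> 6" using hpq by auto
      ultimately show ?thesis using D3 by simp
    next
      case False
      have "h s \<le> 2" if s: "s \<in> A" for s
      proof -
        have "N s \<inter> S \<subseteq> {w}" using False s S_eq apart(2) by auto
        from h_le[OF card_sub[OF this]] show ?thesis by simp
      qed
      hence "(\<Sum>s\<in>A. h s) \<le> (\<Sum>s\<in>A. 2)" by (intro sum_mono)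
      thus ?thesis using cA by simp
    qed
    moreover have "(\<Sum>s\<in>R. h s) \<le> 2 * r * r"
      unfolding h_def r_def S_def
    proof (rule closed_part_sum[OF _ _ nb])
      fix x assume x: "x \<in> R"
      have "y \<in> R" if "y \<in> N x \<inter> S" for y
        using that apart(2)[of y x] x S_eq by (auto simp: adj_commute Riff)
      thus "N x \<inter> N v \<subseteq> R" by (auto simp: S_def)
    qed (auto simp: R_def S_def)
    ultimately have "(1 + D + r) * (1 + D + r + 1) \<le> D * (D + 1) + (2 * D + 8) + 2 * r * r"
      using big sum_eq hw d_eq unfolding d_def by simp
    \<comment> \<open>With \<open>r \<le> D\<close> and \<open>3 \<le> D\<close> this gives
      \<open>6 * r \<le> 6\<close>, and \<open>r = 1\<close> would require
      \<open>D \<le> 2\<close>.\<close>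
    hence "2 * (D * r) + 3 * r \<le> 6 + r * r" by (simp add: algebra_simps)
    moreover have "r * r \<le> D * r" "3 * r \<le> D * r" using rD D3 by (intro mult_le_mono1; simp)+
    ultimately have "r = 1" using r1 by linarith
    thus thesis using \<open>2 * (D * r) + 3 * r \<le> 6 + r * r\<close> D3 by simp
  next
    \<comment> \<open>An edge within \<open>A\<close>, or an edge from another vertex of
      \<open>A\<close> to \<open>R\<close>, would create a 5-vertex path. So \<open>a\<close> is the
      only vertex of \<open>A\<close> with neighbours in \<open>R\<close>; these form
      \<open>R1\<close> and are leaves, and \<open>R2\<close> is separate from all the rest.\<close>
    case linked
    have third: "\<exists>c\<in>A. c \<noteq> x \<and> c \<noteq> y" for x y
    proof (rule ccontr)
      assume "\<not> ?thesis"
      hence "A \<subseteq> {x, y}" by blast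
      from card_mono[OF _ this] show False using cA D3 by (auto simp: card_insert_if split: if_splits)
    qed
    have ne: "w \<noteq> a" "u \<noteq> w" "u \<notin> A" using linked by (auto simp: A_def R_def)
    have indep: "\<not> adj x y" if xy: "x \<in> A" "y \<in> A" for x y
    proof
      assume e: "adj x y"
      have star: False if z: "z \<in> A" "adj a z" for z
      proof -
        obtain c where c: "c \<in> A" "c \<noteq> a" "c \<noteq> z" using third by blast
        have "z \<noteq> a" using z(2) by auto
        moreover have "z \<noteq> w" "c \<noteq> w" "z \<noteq> u" "c \<noteq> u" "a \<noteq> u" using z(1) c(1) linked(1) wA ne(3) by blast+
        ultimately have dist: "distinct [u, a, z, w, c]" using ne(1,2) c(2,3) by auto
        show False using no_path5[OF dist, of v] linked z c(1) wS by (simp add: Aiff Riff adj_commute)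
      qed
      have "x \<noteq> a" "y \<noteq> a" using star[of x] star[of y] e xy by (auto simp: adj_commute)
      moreover have "x \<noteq> y" "x \<noteq> w" "y \<noteq> w" "x \<noteq> u" "y \<noteq> u" "a \<noteq> u" using e xy wA ne linked by auto
      ultimately show False using no_path5[of u a w x y v] linked xy e ne wS by (auto simp: Aiff Riff adj_commute)
    qed
    have only_a: "b = a" if b: "b \<in> A" "y \<in> R" "adj b y" for b y
    proof (rule ccontr)
      assume ba: "b \<noteq> a"
      have yn: "y \<noteq> w" "y \<notin> A" "b \<noteq> w" "a \<noteq> y" "b \<noteq> y" "a \<noteq> u" "b \<noteq> u" using b wA ne linked by (auto simp: A_def R_def)
      show False
      proof (cases "y = u")
        case True
        obtain c where c: "c \<in> A" "c \<noteq> a" "c \<noteq> b" using third by blast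
        moreover have "c \<noteq> w" "c \<noteq> u" using c wA ne by auto
        ultimately show False using no_path5[of c w a u b v] linked b True yn ba ne wS by (auto simp: Aiff Riff adj_commute)
      next
        case False
        thus False using no_path5[of u a w b y v] linked b yn ba ne wS by (auto simp: Aiff Riff adj_commute)
      qed
    qed
    define R1 where "R1 = N a \<inter> R"
    define R2 where "R2 = R - R1"
    have fin12: "finite R1" "finite R2" using fin by (auto simp: R1_def R2_def)
    have r_eq: "r = card R1 + card R2"
    proof -
      have "R = R1 \<union> R2" "R1 \<inter> R2 = {}" by (auto simp: R1_def R2_def)
      thus ?thesis unfolding r_def using fin12 by (metis card_Un_disjoint)
    qed
    have r1: "1 \<le> card R1"
    proof -
      have "u \<in> R1" using linked by (simp add: R1_def)
      hence "0 < card R1" using fin12 card_gt_0_iff by blast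
      thus ?thesis by simp
    qed
    have NR1: "N x \<inter> S \<subseteq> {a}" if x: "x \<in> R1" for x
    proof
      fix y assume y: "y \<in> N x \<inter> S"
      have xR: "x \<in> R" "adj a x" using x by (auto simp: R1_def)
      have "y \<noteq> w" using y xR by (auto simp: Riff adj_commute)
      moreover have "y \<notin> R"
      proof
        assume yR: "y \<in> R"
        obtain c where c: "c \<in> A" "c \<noteq> a" using third by blast
        have "c \<noteq> w" "c \<notin> R" "a \<notin> R" "w \<notin> R" "x \<noteq> y" using c wA linked y disj by auto
        hence "distinct [y, x, a, w, c]" using yR xR c ne by auto
        thus False using no_path5[of y x a w c v] yR xR y c linked wS by (auto simp: Aiff Riff adj_commute)
      qed
      ultimately have "y \<in> A" using y S_eq by auto
      thus "y \<in> {a}" using only_a[of y x] xR y by (auto simp: adj_commute)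
    qed
    have hA: "h b \<le> 2" if b: "b \<in> A - {a}" for b
    proof -
      have "y \<notin> R" if "adj b y" for y using that b only_a[of b y] by blast
      hence "N b \<inter> S \<subseteq> {w}" using b S_eq indep[of b] by auto
      from h_le[OF card_sub[OF this]] show ?thesis by simp
    qed
    have "N a \<inter> S \<subseteq> insert w R1" using S_eq indep[OF linked(1)] by (auto simp: R1_def)
    moreover have "card (insert w R1) \<le> 1 + card R1" using fin12 by (simp add: card_insert_if)
    ultimately have "card (N a \<inter> S) \<le> 1 + card R1" using card_sub fin12 by (meson finite_insert order_trans)
    from h_le[OF this] have ha: "h a \<le> (1 + card R1) * (1 + card R1 + 1)" .
    have "(\<Sum>s\<in>A - {a}. h s) \<le> (\<Sum>s\<in>A - {a}. 2)" by (intro sum_mono hA)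
    hence sA: "(\<Sum>s\<in>A. h s) \<le> (1 + card R1) * (1 + card R1 + 1) + 2 * (D - 1)"
      using ha linked(1) fin cA by (simp add: sum.remove[of A a])
    have "h x \<le> 2" if x: "x \<in> R1" for x using h_le[OF card_sub[OF NR1[OF x]]] by simp
    hence "(\<Sum>s\<in>R1. h s) \<le> (\<Sum>s\<in>R1. 2)" by (intro sum_mono)
    moreover have "(\<Sum>s\<in>R2. h s) \<le> 2 * card R2 * card R2"
      unfolding h_def S_def
    proof (rule closed_part_sum[OF _ _ nb])
      fix x assume x: "x \<in> R2"
      have xR: "x \<in> R" "x \<notin> R1" "\<not> adj a x" using x by (auto simp: R1_def R2_def)
      have "y \<in> R2" if y: "y \<in> N x \<inter> S" for y
      proof -
        have "y \<noteq> w" using y xR by (auto simp: Riff adj_commute)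
        moreover have "y \<notin> A" using only_a[of y x] xR y by (auto simp: adj_commute)
        ultimately have "y \<in> R" using y S_eq by auto
        moreover have "y \<notin> R1"
        proof
          assume "y \<in> R1"
          moreover have "x \<in> N y \<inter> S" using y xR by (auto simp: Riff Siff adj_commute)
          ultimately have "x = a" using NR1 by blast
          thus False using linked xR disj by auto
        qed
        ultimately show ?thesis by (simp add: R2_def)
      qed
      thus "N x \<inter> N v \<subseteq> R2" by (auto simp: S_def)
    qed (auto simp: R2_def R_def S_def)
    moreover have "(\<Sum>s\<in>R. h s) = (\<Sum>s\<in>R1. h s) + (\<Sum>s\<in>R2. h s)"
    proof -
      have "R = R1 \<union> R2" "R1 \<inter> R2 = {}" by (auto simp: R1_def R2_def)
      thus ?thesis using fin12 by (metis sum.union_disjoint)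
    qed
    ultimately have sR: "(\<Sum>s\<in>R. h s) \<le> 2 * card R1 + 2 * card R2 * card R2" by simp
    \<comment> \<open>Integers allow \<open>D - 1\<close> to be expanded.\<close>
    define x where "x = int (card R1)"
    define y where "y = int (card R2)"
    define z where "z = int D"
    have "(1 + D + r) * (1 + D + r + 1) \<le> D * (D + 1) + ((1 + card R1) * (1 + card R1 + 1) + 2 * (D - 1))
        + (2 * card R1 + 2 * card R2 * card R2)"
      using big sum_eq hw d_eq sA sR unfolding d_def by simp
    hence "int ((1 + D + r) * (1 + D + r + 1)) \<le> int (D * (D + 1) + ((1 + card R1) * (1 + card R1 + 1) + 2 * (D - 1))
        + (2 * card R1 + 2 * card R2 * card R2))" by (simp only: of_nat_le_iff)
    hence "(1 + z + (x + y)) * (2 + z + (x + y)) \<le> z * (z + 1) + ((1 + x) * (2 + x) + 2 * (z - 1)) + (2 * x + 2 * y * y)"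
      using D3 r_eq by (simp add: x_def y_def z_def of_nat_diff algebra_simps)
    hence "2 * z * x + 2 * z * y + 2 * x * y + 3 * y + 2 \<le> y * y + 2 * x" by (simp add: algebra_simps)
    moreover have "y * y \<le> z * y" using rD r_eq by (intro mult_right_mono) (auto simp: y_def z_def)
    moreover have "3 * x \<le> z * x" using D3 by (intro mult_right_mono) (auto simp: x_def z_def)
    moreover have "0 \<le> z * y" "0 \<le> x * y" "0 \<le> x" "0 \<le> y" by (auto simp: x_def y_def z_def)
    ultimately have False by linarith
    thus thesis ..
  qed
qed

section \<open>Degree sums over a neighbourhood\<close>

lemma card_nbrs_split:
  assumes "s \<in> N v"
  shows "card (N s) = 1 + card (N s \<inter> N v) + card (N s \<inter> far v)"
proof -
  have "N s = insert v ((N s \<inter> N v) \<union> (N s \<inter> far v))"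
    using assms adj_less(1)[of s] by (auto simp: far_iff adj_commute)
  moreover have "v \<notin> (N s \<inter> N v) \<union> (N s \<inter> far v)" by (auto simp: far_iff)
  moreover have "(N s \<inter> N v) \<inter> (N s \<inter> far v) = {}" by (auto simp: far_iff)
  ultimately have "card (N s) = Suc (card (N s \<inter> N v) + card (N s \<inter> far v))"
    by (metis card_Un_disjoint card_insert_disjoint finite_Int finite_N finite_UnI)
  thus ?thesis by simp
qed

lemma N_subset_insert:
  assumes "far v = {}"
  shows "N s \<subseteq> insert v (N v)"
proof
  fix u assume "u \<in> N s"
  hence "u < n" using adj_less by auto
  thus "u \<in> insert v (N v)" using assms far_iff[of u v] by auto
qed

lemma double_count:
  assumes "finite X" "finite Y"
  shows "(\<Sum>s\<in>X. card (N s \<inter> Y)) = (\<Sum>t\<in>Y. card (N t \<inter> X))"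
proof -
  have "card (N s \<inter> Y) = (\<Sum>t\<in>Y. if adj s t then 1 else 0)" if "finite Y" for s Y
    using that by (simp add: sum.If_cases Int_commute nbrs_def adj_def)
  thus ?thesis using assms sum.swap[of "\<lambda>s t. if adj s t then 1 else 0 :: nat" Y X] by (simp add: adj_commute)
qed

lemma sum_card_nbrs:
  "(\<Sum>s\<in>N v. card (N s)) = card (N v) + degsum (N v) + (\<Sum>t\<in>far v. card (N t \<inter> N v))"
proof -
  have "(\<Sum>s\<in>N v. card (N s)) = (\<Sum>s\<in>N v. 1 + card (N s \<inter> N v) + card (N s \<inter> far v))"
    by (intro sum.cong refl card_nbrs_split)
  also have "\<dots> = card (N v) + degsum (N v) + (\<Sum>s\<in>N v. card (N s \<inter> far v))"
    by (simp add: sum.distrib sum_Suc degsum_def)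
  also have "(\<Sum>s\<in>N v. card (N s \<inter> far v)) = (\<Sum>t\<in>far v. card (N t \<inter> N v))"
    by (rule double_count) auto
  finally show ?thesis .
qed

lemma card_blocks_ge_4: "block v a b x y \<Longrightarrow> 4 \<le> card (blocks v)"
  using card_mono[OF finite_subset[OF blocks_subset finite_N] block_subset_blocks, of v a b x y] by (auto simp: block_def)

text \<open>A \<open>K_4\<close> gives 12 and allows one edge to \<open>t\<close>; dropping one of
  its edges costs 2 and allows only one further edge to \<open>t\<close>.\<close>

lemma block_degree_sum:
  assumes B: "block v a b x y" and t: "t \<in> far v"
  shows "(\<Sum>s\<in>{a, b, x, y}. card (N s \<inter> N v)) + card (N t \<inter> {a, b, x, y}) \<le> 13"
proof -
  have sum4: "(\<Sum>s\<in>{a, b, x, y}. f s) = f a + f b + f x + f y" for f :: "nat \<Rightarrow> nat"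
    using B by (simp add: block_def)
  have deg3: "card (N s \<inter> N v) \<le> 3" if "s \<in> {a, b, x, y}" for s
    using blocks_degree block_subset_blocks[OF B] that by blast
  have sub: "N t \<inter> {a, b, x, y} \<subseteq> N t \<inter> N v" using B by (auto simp: block_def)
  have att: "card (N t \<inter> {a, b, x, y}) \<le> k"
    if "\<And>p. p \<in> {a, b, x, y} \<Longrightarrow> adj t p \<Longrightarrow> card (N t \<inter> N v) \<le> k" for k
  proof (cases "N t \<inter> {a, b, x, y} = {}")
    case False
    then obtain p where "p \<in> {a, b, x, y}" "adj t p" by auto
    from that[OF this] show ?thesis using card_mono[OF _ sub] by simp
  qed simp
  show ?thesis
  proof (cases "adj x y")
    case True
    have "card (N t \<inter> {a, b, x, y}) \<le> 1"
      using block_attached_card_le_1[OF B True, of t] t by (intro att) (auto simp: far_iff)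
    thus ?thesis unfolding sum4 using deg3[of a] deg3[of b] deg3[of x] deg3[of y] by simp
  next
    case False
    have "card (N t \<inter> {a, b, x, y}) \<le> 2"
      using block_attached_card_le_2[OF B, of t] t by (intro att) (auto simp: far_iff)
    moreover have two: "card (N s \<inter> N v) \<le> 2" if s: "s \<in> {x, y}" for s
    proof -
      have "N s \<inter> N v \<subseteq> {a, b, x, y}" using block_closed[OF B, of _ s] s by (intro subsetI) auto
      moreover have "x \<notin> N s" "y \<notin> N s" using s False by (auto simp: adj_commute)
      ultimately have "N s \<inter> N v \<subseteq> {a, b}" by blast
      from card_mono[OF _ this] show ?thesis by (auto simp: card_insert_if split: if_splits)
    qed
    ultimately show ?thesis unfolding sum4 using deg3[of a, simplified] deg3[of b, simplified] two[of x, simplified] two[of y, simplified] by linarith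
  qed
qed

end

section \<open>Subsolutions\<close>

text \<open>The vertex \<open>v\<close> maximises \<open>y u / (deg u - al)\<close>. The choice \<open>al = 0\<close> yields the classical
  bound by \<open>deg v\<close> plus the average degree of its neighbours; the small shift \<open>al\<close> used below
  sharpens it just enough to leave only configurations with few missing edges.\<close>
locale subsolution = tcc_free +
  fixes mu al :: real and v :: nat and y :: "nat \<Rightarrow> real"
  assumes v_less: "v < n" and deg_pos: "1 \<le> card (N v)" and al: "0 \<le> al" "al < 1"
    and y_v: "y v = card (N v) - al"
    and y_le: "\<And>u. u < n \<Longrightarrow> y u \<le> card (N u) - al"
    and y_nonneg: "\<And>u. 0 \<le> y u"
    and y_sub: "\<And>u. u < n \<Longrightarrow> (mu - card (N u)) * y u \<le> (\<Sum>w\<in>N u. y w)"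
begin

lemma N_less: "s \<in> N v \<Longrightarrow> s < n"
  using adj_less by auto

lemma y_v_pos: "0 < y v"
  using y_v deg_pos al by linarith

lemma sum_y_le: "B \<subseteq> N v \<Longrightarrow> (\<Sum>s\<in>B. y s) \<le> real (\<Sum>s\<in>B. card (N s)) - al * card B"
proof -
  assume B: "B \<subseteq> N v"
  have "(\<Sum>s\<in>B. y s) \<le> (\<Sum>s\<in>B. real (card (N s)) - al)"
    using B by (intro sum_mono y_le N_less) auto
  thus ?thesis by (simp add: sum_subtractf mult.commute)
qed

text \<open>The subsolution inequality at \<open>v\<close>, with each \<open>y s\<close> replaced by
  its bound \<open>card (N s) - al\<close>.\<close>

lemma first_order:
  "(mu - card (N v)) * (card (N v) - al)
     \<le> real (card (N v) + degsum (N v) + (\<Sum>t\<in>far v. card (N t \<inter> N v))) - al * card (N v)"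
  using y_sub[OF v_less] sum_y_le[of "N v"] unfolding y_v sum_card_nbrs by simp

text \<open>The largest entry \<open>y m\<close> on \<open>H\<close> satisfies
  \<open>(mu - card (N m)) * y m \<le> y v + (card (N m) - 1) * y m\<close>, since \<open>v\<close>
  is the only neighbour of \<open>m\<close> outside \<open>H\<close>.\<close>

lemma closed_bound:
  assumes H: "H \<subseteq> N v" "\<And>s. s \<in> H \<Longrightarrow> N s \<subseteq> insert v H" "\<And>s. s \<in> H \<Longrightarrow> card (N s) \<le> k"
    and mu: "2 * real k - 1 < mu" and s: "s \<in> H"
  shows "y s \<le> y v / (mu - 2 * real k + 1)"
proof -
  have fin: "finite H" using H(1) finite_subset finite_N by blast
  have "Max (y ` H) \<in> y ` H" using fin s by (intro Max_in) auto
  then obtain m where m: "m \<in> H" "y m = Max (y ` H)" by auto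
  have le: "y x \<le> y m" if "x \<in> H" for x unfolding m(2) using that fin by (intro Max_ge) auto
  have vm: "v \<in> N m" using m(1) H(1) by (auto simp: adj_commute)
  have c1: "1 \<le> card (N m)" using vm card_gt_0_iff[of "N m"] finite_N[of m] by (simp add: Suc_le_eq del: in_N) blast
  have "(\<Sum>w\<in>N m. y w) = y v + (\<Sum>w\<in>N m - {v}. y w)" using vm by (intro sum.remove) auto
  also have "(\<Sum>w\<in>N m - {v}. y w) \<le> (\<Sum>w\<in>N m - {v}. y m)"
    using H(2)[OF m(1)] le by (intro sum_mono) auto
  also have "\<dots> = (real (card (N m)) - 1) * y m" using vm c1 by (simp add: of_nat_diff del: in_N)
  finally have "(mu - 2 * card (N m) + 1) * y m \<le> y v"
    using y_sub[of m] N_less[of m] m(1) H(1) by (simp add: algebra_simps subset_iff)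
  moreover have "(mu - 2 * real k + 1) * y m \<le> (mu - 2 * card (N m) + 1) * y m"
    using H(3)[OF m(1)] y_nonneg[of m] by (intro mult_right_mono) auto
  ultimately have "y m \<le> y v / (mu - 2 * real k + 1)" using mu by (simp add: field_simps)
  thus ?thesis using le[OF s] by simp
qed

text \<open>Up to three neighbours in the block and \<open>v\<close> itself give
  \<open>k = 4\<close>. \<open>H\<close> is a parameter because one attached block may have to be
  left out.\<close>

lemma blocks_bound:
  assumes H: "H \<subseteq> blocks v" "\<And>s u. s \<in> H \<Longrightarrow> adj s u \<Longrightarrow> adj v u \<Longrightarrow> u \<in> H"
    and un: "\<And>s t. s \<in> H \<Longrightarrow> t \<in> far v \<Longrightarrow> \<not> adj s t" and mu: "7 < mu" and s: "s \<in> H"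
  shows "y s \<le> y v / (mu - 7)"
proof -
  have HN: "H \<subseteq> N v" using H(1) blocks_subset by blast
  have "y s \<le> y v / (mu - 2 * real 4 + 1)"
  proof (rule closed_bound[OF HN _ _ _ s])
    fix x assume x: "x \<in> H"
    show "N x \<subseteq> insert v H"
    proof
      fix u assume "u \<in> N x"
      hence "adj x u" "u < n" using adj_less by auto
      thus "u \<in> insert v H" using un[OF x, of u] H(2)[OF x, of u] far_iff[of u v] by blast
    qed
    have "N x \<inter> far v = {}" using un[OF x] by auto
    moreover have "x \<in> N v" "x \<in> blocks v" using x H(1) HN by auto
    ultimately show "card (N x) \<le> 4" using card_nbrs_split[of x v] blocks_degree[of x v] by simp
  qed (use mu in auto)
  thus ?thesis by (simp add: algebra_simps)
qed

end

section \<open>At least seven vertices\<close>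

text \<open>The condition \<open>e * (n + 4) \<le> 4\<close> is what \<open>second_order\<close>
  consumes, and \<open>al\<close> is a quarter of the largest such \<open>e\<close>. The cap
  \<open>27 / 100\<close> matters for small \<open>n\<close>: for \<open>n = 7\<close> the value
  \<open>4 / 11\<close> would be too large for the estimate in \<open>no_block\<close>.\<close>

locale large_subsolution = subsolution +
  fixes e :: real
  assumes n7: "7 \<le> n" and mu_eq: "mu = real n + 2 - e" and al_eq: "al = 1 / (real n + 4)"
    and e: "0 \<le> e" "e \<le> 27 / 100" "e * (real n + 4) \<le> 4"
begin

lemma al_mult: "al * (real n + 4) = 1"
  by (simp add: al_eq)

lemma e_le: "e \<le> 4 * al"
  using e(3) by (simp add: al_eq field_simps)

text \<open>Up to the nonpositive term \<open>- al * e\<close>, the error is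
  \<open>e * d + al * (c + 3) - al * d\<close> with \<open>d = card (N v)\<close> and
  \<open>c = card (far v)\<close>; then \<open>e \<le> 4 * al\<close> is used.\<close>

lemma count_real:
  "real ((card (far v) + 2) * card (N v))
     \<le> real (degsum (N v) + (\<Sum>t\<in>far v. card (N t \<inter> N v))) + al * (2 * card (N v) + real n + 2)"
proof -
  let ?d = "real (card (N v))" and ?c = "real (card (far v))"
  have n: "real n = ?c + ?d + 1" using card_far[OF v_less] by simp
  have "e * ?d \<le> 4 * al * ?d" using e_le by (intro mult_right_mono) auto
  moreover have "0 \<le> al * e" using al e by simp
  moreover have "(mu - ?d) * (?d - al) = (?c + 3) * ?d - e * ?d - al * (?c + 3) + al * e"
    unfolding mu_eq n by (simp add: algebra_simps)
  ultimately show ?thesis using first_order n by (simp add: algebra_simps)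
qed

text \<open>From \<open>d < n\<close> follows \<open>2 * d + n + 2 < 3 * (n + 4)\<close>, so the
  error is below 3 and, by integrality, at most 2.\<close>

lemma count:
  "(card (far v) + 2) * card (N v) \<le> degsum (N v) + (\<Sum>t\<in>far v. card (N t \<inter> N v)) + 2"
proof -
  have "al * (2 * card (N v) + real n + 2) < al * (3 * (real n + 4))"
    using card_far[OF v_less] al_mult n7 by (intro mult_strict_left_mono) (auto simp: al_eq)
  hence "al * (2 * card (N v) + real n + 2) < 3" using al_mult by (simp add: algebra_simps)
  hence "real ((card (far v) + 2) * card (N v)) < real (degsum (N v) + (\<Sum>t\<in>far v. card (N t \<inter> N v)) + 3)"
    using count_real by simp
  thus ?thesis unfolding of_nat_less_iff by linarith
qed

text \<open>A small degree brings the error below 2, the precision that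
  \<open>low_degree_far_sparse\<close> requires.\<close>

lemma count_low:
  assumes "card (N v) \<le> 4"
  shows "(card (far v) + 2) * card (N v) \<le> degsum (N v) + (\<Sum>t\<in>far v. card (N t \<inter> N v)) + 1"
proof -
  have "al * (2 * card (N v) + real n + 2) < al * (2 * (real n + 4))"
    using assms n7 by (intro mult_strict_left_mono) (auto simp: al_eq)
  hence "al * (2 * card (N v) + real n + 2) < 2" using al_mult by (simp add: algebra_simps)
  hence "real ((card (far v) + 2) * card (N v)) < real (degsum (N v) + (\<Sum>t\<in>far v. card (N t \<inter> N v)) + 2)"
    using count_real by simp
  thus ?thesis unfolding of_nat_less_iff by linarith
qed

lemma degree_ge_5: "5 \<le> card (N v)"
proof (rule ccontr)
  assume "\<not> ?thesis"
  moreover from this have "2 \<le> card (far v)" using card_far[OF v_less] n7 by simp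
  ultimately show False using low_degree_far_sparse[of v] deg_pos count_low by simp
qed

text \<open>A single non-neighbour already costs more than the 2 permitted by \<open>count\<close>,
  even if all others are adjacent to the whole of \<open>N v\<close>.\<close>

lemma far_empty_if_no_block:
  assumes nb: "\<And>a b x y. \<not> block v a b x y"
  shows "far v = {}"
proof (rule ccontr)
  assume "far v \<noteq> {}"
  then obtain t where t: "t \<in> far v" by blast
  let ?d = "card (N v)" and ?c = "card (far v)"
  have "(\<Sum>u\<in>far v - {t}. card (N u \<inter> N v)) \<le> (\<Sum>u\<in>far v - {t}. ?d)" by (intro sum_mono card_mono) auto
  hence "(\<Sum>u\<in>far v. card (N u \<inter> N v)) \<le> card (N t \<inter> N v) + (?c - 1) * ?d"
    using t by (simp add: sum.remove[of "far v" t])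
  moreover have "degsum (N v) + card (N t \<inter> N v) + 2 < 3 * ?d"
    using nonneighbour_sparse_no_block[of t v] degree_ge_5 nb t by (auto simp: far_iff)
  moreover have "(?c - 1) * ?d + 3 * ?d = (?c + 2) * ?d"
  proof -
    have "?c \<ge> 1" using t card_gt_0_iff[of "far v"] by (auto simp: Suc_le_eq)
    hence "?c - 1 + 3 = ?c + 2" by simp
    thus ?thesis by (metis add_mult_distrib)
  qed
  ultimately show False using count by linarith
qed

text \<open>On unattached blocks \<open>blocks_bound\<close> improves the degree bound
  \<open>4 - al\<close> to 3. At least four vertices gain in this way, which outweighs the
  error.\<close>

lemma block_unattached:
  assumes B: "block v a b x y'" and far: "far v = {t}" and un: "\<And>p. p \<in> blocks v \<Longrightarrow> \<not> adj t p"
  shows False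
proof -
  let ?d = "card (N v)" and ?L = "card (blocks v)"
  have d: "n = ?d + 2" using card_far[OF v_less] far by simp
  have mu7: "mu - 7 = real ?d - 3 - e" using d by (simp add: mu_eq)
  have "(\<Sum>s\<in>blocks v. y s) \<le> (\<Sum>s\<in>blocks v. 3)"
  proof (rule sum_mono)
    fix s assume s: "s \<in> blocks v"
    have "y s \<le> y v / (mu - 7)"
      using mu7 e degree_ge_5 blocks_closed un far
      by (intro blocks_bound[of "blocks v", OF _ _ _ _ s]) (auto simp: adj_commute)
    \<comment> \<open>This is \<open>9 + 3 * e - al \<le> 2 * ?d\<close>, which holds from
      \<open>?d = 5\<close> on.\<close>
    also have "\<dots> \<le> 3" using mu7 e al degree_ge_5 by (simp add: y_v field_simps)
    finally show "y s \<le> 3" .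
  qed
  moreover have "(\<Sum>s\<in>N v - blocks v. y s) \<le> (4 - al) * card (N v - blocks v)"
  proof -
    have "(\<Sum>s\<in>N v - blocks v. card (N s)) \<le> (\<Sum>s\<in>N v - blocks v. 2 + card (N s \<inter> (N v - blocks v)))"
    proof (rule sum_mono)
      fix s assume s: "s \<in> N v - blocks v"
      have "N s \<inter> (N v - blocks v) = N s \<inter> N v" using s blocks_closed[of _ v s] by (auto simp: adj_commute)
      moreover have "card (N s \<inter> far v) \<le> 1" using far card_mono[of "{t}" "N s \<inter> far v"] by simp
      ultimately show "card (N s) \<le> 2 + card (N s \<inter> (N v - blocks v))" using card_nbrs_split[of s v] s by simp
    qed
    also have "\<dots> = 2 * card (N v - blocks v) + degsum (N v - blocks v)" by (simp add: sum.distrib sum_Suc degsum_def)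
    also have "\<dots> \<le> 4 * card (N v - blocks v)" using degsum_off_blocks[of v] by simp
    finally have "real (\<Sum>s\<in>N v - blocks v. card (N s)) \<le> 4 * card (N v - blocks v)" by (metis of_nat_le_iff of_nat_mult of_nat_numeral)
    thus ?thesis using sum_y_le[of "N v - blocks v"] by (simp add: algebra_simps)
  qed
  moreover have "(\<Sum>s\<in>N v. y s) = (\<Sum>s\<in>blocks v. y s) + (\<Sum>s\<in>N v - blocks v. y s)"
    using sum.subset_diff[OF blocks_subset finite_N, of y v] by simp
  moreover have "(mu - ?d) * y v \<le> (\<Sum>s\<in>N v. y s)" by (rule y_sub[OF v_less])
  ultimately have "(4 - e) * (?d - al) \<le> 3 * ?L + (4 - al) * card (N v - blocks v)"
    using d by (simp add: y_v mu_eq)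
  moreover have "real (card (N v - blocks v)) = real ?d - real ?L"
    using card_Diff_subset[OF finite_subset[OF blocks_subset finite_N] blocks_subset] card_mono[OF finite_N blocks_subset, of v] by simp
  ultimately have "(4 - e) * (?d - al) \<le> 3 * ?L + (4 - al) * (real ?d - real ?L)" by simp
  also have "\<dots> = (4 - al) * ?d - (1 - al) * ?L" by (simp add: algebra_simps)
  also have "\<dots> \<le> (4 - al) * ?d - (1 - al) * 4"
    using card_blocks_ge_4[OF B] al by (intro diff_left_mono mult_left_mono) auto
  \<comment> \<open>With \<open>e * ?d \<le> 4 * al * ?d\<close> and
    \<open>al * ?d = 1 - 6 * al\<close> this becomes
    \<open>1 + 10 * al + e * al \<le> 0\<close>.\<close>
  finally have "4 + al * ?d + e * al \<le> e * ?d + 8 * al" by (simp add: algebra_simps)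
  moreover have "e * ?d \<le> 4 * al * ?d" using e_le by (intro mult_right_mono) auto
  moreover have "al * ?d = 1 - 6 * al" using al_mult d by (simp add: algebra_simps)
  moreover have "0 \<le> e * al" using e al by simp
  ultimately show False using al by linarith
qed

text \<open>The block monopolises \<open>t\<close>, so the other vertices of \<open>N v\<close> lose
  their edge to \<open>t\<close>, while the block has degree sum at most
  \<open>4 + 13 = 17\<close>.\<close>

lemma block_attached_impossible:
  assumes B: "block v a b x y'" and far: "far v = {t}" and p: "p \<in> {a, b, x, y'}" "adj t p"
  shows False
proof -
  let ?d = "card (N v)" and ?A = "{a, b, x, y'}"
  have d: "n = ?d + 2" using card_far[OF v_less] far by simp
  have tf: "t \<in> far v" using far by simp
  have mu7: "mu - 7 = real ?d - 3 - e" using d by (simp add: mu_eq)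
  have AH: "?A \<subseteq> blocks v" and AN: "?A \<subseteq> N v" and cA: "card ?A = 4"
    using block_subset_blocks[OF B] B by (auto simp: block_def)
  have out: "\<not> adj t s" if "s \<in> N v - ?A" for s
    using block_attached[OF B _ _ p, of s] that tf by (auto simp: far_iff)
  have clA: "\<not> adj s q" if "s \<in> N v - ?A" "q \<in> ?A" for s q
    using block_closed[OF B _ that(2), of s] that(1) by (auto simp: adj_commute)
  have "(\<Sum>s\<in>?A. card (N s)) = (\<Sum>s\<in>?A. 1 + card (N s \<inter> N v) + card (N s \<inter> far v))"
    using AN by (intro sum.cong refl card_nbrs_split) auto
  also have "\<dots> = 4 + (\<Sum>s\<in>?A. card (N s \<inter> N v)) + card (N t \<inter> ?A)"
    using double_count[of ?A "far v"] far cA by (simp only: sum.distrib) simp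
  finally have "(\<Sum>s\<in>?A. card (N s)) \<le> 17" using block_degree_sum[OF B tf] by linarith
  hence "real (\<Sum>s\<in>?A. card (N s)) \<le> 17" by (metis of_nat_le_iff of_nat_numeral)
  hence sA: "(\<Sum>s\<in>?A. y s) \<le> 17 - 4 * al" using sum_y_le[OF AN] cA by (simp add: mult.commute)
  have rest: "real (card (N v - ?A)) = real ?d - 4" using card_Diff_subset[OF _ AN] cA card_mono[OF _ AN] by simp
  have nosplit: "card (N s) = 1 + card (N s \<inter> N v)" if s: "s \<in> N v - ?A" for s
  proof -
    have "N s \<inter> far v = {}" using out[OF s] far by (auto simp: adj_commute)
    thus ?thesis using card_nbrs_split[of s v] s by simp
  qed
  have tot: "(\<Sum>s\<in>N v. y s) = (\<Sum>s\<in>?A. y s) + (\<Sum>s\<in>N v - ?A. y s)"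
    using sum.subset_diff[OF AN finite_N, of y] by simp
  have main: "(4 - e) * (?d - al) \<le> (\<Sum>s\<in>N v. y s)" using y_sub[OF v_less] d by (simp add: y_v mu_eq)
  have eal: "0 \<le> e * al" using e al by simp
  show False
  \<comment> \<open>Comparing \<open>17 + 3 * (d - 4)\<close> with \<open>(4 - e) * d\<close> yields
    \<open>(1 - e) * d \<le> 5\<close>, which fails from \<open>d = 7\<close> on. For
    \<open>d\<close> equal to 5 or 6 only \<open>d - 4\<close> vertices lie outside the block, with
    degrees at most \<open>d - 4\<close>.\<close>
  proof (cases "7 \<le> ?d")
    case True
    have "(\<Sum>s\<in>blocks v - ?A. y s) \<le> (\<Sum>s\<in>blocks v - ?A. 3)"
    proof (rule sum_mono)
      fix s assume s: "s \<in> blocks v - ?A"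
      have "y s \<le> y v / (mu - 7)"
      proof (rule blocks_bound[of "blocks v - ?A", OF _ _ _ _ s])
        fix q u assume q: "q \<in> blocks v - ?A"
        hence qN: "q \<in> N v - ?A" using blocks_subset by blast
        show "u \<in> blocks v - ?A" if "adj q u" "adj v u"
          using blocks_closed[of q v u] clA[OF qN, of u] that q by auto
        show "\<not> adj q u" if "u \<in> far v" using out[OF qN] that far by (auto simp: adj_commute)
      qed (use mu7 e True in auto)
      also have "\<dots> \<le> 3" using mu7 e al True by (simp add: y_v field_simps)
      finally show "y s \<le> 3" .
    qed
    moreover have "(\<Sum>s\<in>N v - blocks v. y s) \<le> 3 * card (N v - blocks v)"
    proof -
      have "(\<Sum>s\<in>N v - blocks v. card (N s)) = (\<Sum>s\<in>N v - blocks v. 1 + card (N s \<inter> (N v - blocks v)))"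
      proof (rule sum.cong)
        fix s assume s: "s \<in> N v - blocks v"
        have "N s \<inter> (N v - blocks v) = N s \<inter> N v" using s blocks_closed[of _ v s] by (auto simp: adj_commute)
        thus "card (N s) = 1 + card (N s \<inter> (N v - blocks v))" using nosplit[of s] s AH by auto
      qed simp
      also have "\<dots> = card (N v - blocks v) + degsum (N v - blocks v)" by (simp add: sum.distrib sum_Suc degsum_def)
      also have "\<dots> \<le> 3 * card (N v - blocks v)" using degsum_off_blocks[of v] by simp
      finally have "real (\<Sum>s\<in>N v - blocks v. card (N s)) \<le> 3 * card (N v - blocks v)" by (metis of_nat_le_iff of_nat_mult of_nat_numeral)
      moreover have "0 \<le> al * card (N v - blocks v)" using al by simp
      ultimately show ?thesis using sum_y_le[of "N v - blocks v"] by simp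
    qed
    moreover have "N v - ?A = (blocks v - ?A) \<union> (N v - blocks v)" "(blocks v - ?A) \<inter> (N v - blocks v) = {}"
      using AH blocks_subset by auto
    moreover have "finite (blocks v - ?A)" using finite_subset[OF blocks_subset finite_N] by blast
    ultimately have "(\<Sum>s\<in>N v - ?A. y s) \<le> 3 * card (N v - ?A)"
      by (simp add: sum.union_disjoint card_Un_disjoint)
    hence "(4 - e) * (?d - al) \<le> 17 - 4 * al + 3 * (real ?d - 4)" using main tot sA rest by simp
    hence "real ?d \<le> 5 + e * ?d" using eal by (simp add: algebra_simps)
    moreover have "e * ?d \<le> 27 / 100 * ?d" using e by (intro mult_right_mono) auto
    ultimately show False using True by simp
  next
    case False
    have "card (N s) \<le> ?d - 4" if s: "s \<in> N v - ?A" for s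
    proof -
      have "N s \<inter> N v \<subseteq> N v - ?A - {s}"
      proof
        fix u assume u: "u \<in> N s \<inter> N v"
        hence "adj s u" "u \<noteq> s" by auto
        thus "u \<in> N v - ?A - {s}" using clA[OF s, of u] u by blast
      qed
      hence "card (N s \<inter> N v) \<le> card (N v - ?A - {s})" by (intro card_mono) auto
      also have "\<dots> = ?d - 4 - 1" using s card_Diff_subset[OF _ AN] cA by simp
      finally show ?thesis using nosplit[OF s] degree_ge_5 by simp
    qed
    hence "(\<Sum>s\<in>N v - ?A. card (N s)) \<le> card (N v - ?A) * (?d - 4)"
      using sum_bounded_above[of "N v - ?A" "\<lambda>s. card (N s)" "?d - 4"] by simp
    hence "real (\<Sum>s\<in>N v - ?A. card (N s)) \<le> real (card (N v - ?A) * (?d - 4))" by (simp only: of_nat_le_iff)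
    hence "(\<Sum>s\<in>N v - ?A. y s) \<le> (real ?d - 4) * (real ?d - 4) - al * (real ?d - 4)"
      using sum_y_le[of "N v - ?A"] rest degree_ge_5 by (simp add: of_nat_diff)
    hence fin: "(4 - e) * (?d - al) \<le> 17 - 4 * al + (real ?d - 4) * (real ?d - 4) - al * (real ?d - 4)"
      using main tot sA by simp
    have "?d = 5 \<or> ?d = 6" using False degree_ge_5 by linarith
    hence "2 + al + e * al \<le> 5 * e \<or> 3 + 2 * al + e * al \<le> 6 * e"
      using fin by (auto simp: algebra_simps)
    thus False using eal e al by linarith
  qed
qed

lemma far_empty: "far v = {}"
proof (cases "\<exists>a b x y. block v a b x y")
  case True
  then obtain a b x y' where B: "block v a b x y'" by blast
  show ?thesis
  proof (rule ccontr)
    assume "far v \<noteq> {}"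
    have "\<not> 2 \<le> card (far v)" using block_far_sparse[OF B degree_ge_5] count by linarith
    moreover have "card (far v) \<noteq> 0" using \<open>far v \<noteq> {}\<close> by simp
    ultimately have "card (far v) = 1" by linarith
    then obtain t where t: "far v = {t}" by (rule card_1_singletonE)
    show False
    proof (cases "\<exists>p\<in>blocks v. adj t p")
      case True
      then obtain p a b x y' where "block v a b x y'" "p \<in> {a, b, x, y'}" "adj t p" unfolding blocks_def by blast
      thus False using block_attached_impossible[OF _ t] by blast
    next
      case False
      thus False using block_unattached[OF B t] by blast
    qed
  qed
qed (use far_empty_if_no_block in blast)

lemma card_N_v: "card (N v) + 1 = n"
  using card_far[OF v_less] far_empty by simp

lemma card_nbrs_S: "s \<in> N v \<Longrightarrow> card (N s) = 1 + card (N s \<inter> N v)"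
  using card_nbrs_split[of s v] far_empty by simp

text \<open>Measured in units of \<open>y v\<close>, a vertex off the blocks contributes
  \<open>3 / d\<close> on average and a block vertex at most \<open>1 / (d - 4 - e)\<close>, while a
  total of \<open>3 - e\<close> is required.\<close>

lemma no_block: "\<not> block v a b x y'"
proof
  assume B: "block v a b x y'"
  let ?d = "card (N v)" and ?L = "card (blocks v)"
  have d: "real n = ?d + 1" using card_N_v by simp
  have mu7: "mu - 7 = real ?d - 4 - e" using d by (simp add: mu_eq)
  have d6: "6 \<le> ?d" using card_N_v n7 by simp
  have L: "real (card (N v - blocks v)) = real ?d - real ?L" and Ld: "?L \<le> ?d"
    using card_Diff_subset[OF finite_subset[OF blocks_subset finite_N] blocks_subset] card_mono[OF finite_N blocks_subset, of v] by simp_all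
  have main: "(3 - e) * y v \<le> (\<Sum>s\<in>N v. y s)" using y_sub[OF v_less] d by (simp add: mu_eq)
  have tot: "(\<Sum>s\<in>N v. y s) = (\<Sum>s\<in>blocks v. y s) + (\<Sum>s\<in>N v - blocks v. y s)"
    using sum.subset_diff[OF blocks_subset finite_N, of y v] by simp
  have "y s \<le> y v / (mu - 7)" if s: "s \<in> blocks v" for s
    using mu7 e d6 blocks_closed far_empty
    by (intro blocks_bound[of "blocks v", OF _ _ _ _ s]) auto
  hence "(\<Sum>s\<in>blocks v. y s) \<le> (\<Sum>s\<in>blocks v. y v / (mu - 7))" by (rule sum_mono)
  hence hub: "(\<Sum>s\<in>blocks v. y s) \<le> ?L * (y v / (real ?d - 4 - e))" using mu7 by simp
  have same: "N s \<inter> (N v - blocks v) = N s \<inter> N v" if s: "s \<in> N v - blocks v" for s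
    using s blocks_closed[of _ v s] by (auto simp: adj_commute)
  have factor: "a * (u / b) + u / c * k = (a / b + k / c) * u" for a b c k u :: real
    by (simp add: distrib_right)
  show False
  \<comment> \<open>For \<open>d\<close> below 8 the difference between \<open>3 / d\<close> and
    \<open>1 / (d - 4 - e)\<close> is too small, but then there is one block and at most three other
    vertices, to which \<open>closed_bound\<close> applies as well.\<close>
  proof (cases "8 \<le> ?d")
    case True
    have "(\<Sum>s\<in>N v - blocks v. y s) \<le> (\<Sum>s\<in>N v - blocks v. y v / ?d * card (N s))"
    proof (rule sum_mono)
      fix s assume s: "s \<in> N v - blocks v"
      have "card (N s) \<le> ?d" using card_mono[of "{..<n} - {s}" "N s"] N_subset[of s] N_less[of s] s card_N_v by simp
      hence "al * card (N s) \<le> al * ?d" using al by (intro mult_left_mono) auto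
      moreover have "y s * ?d \<le> (card (N s) - al) * ?d" using y_le[of s] N_less[of s] s by (intro mult_right_mono) auto
      ultimately have "y s * ?d \<le> y v * card (N s)" by (simp add: y_v algebra_simps)
      thus "y s \<le> y v / ?d * card (N s)" using d6 by (simp add: field_simps)
    qed
    also have "\<dots> = y v / ?d * real (\<Sum>s\<in>N v - blocks v. card (N s))" by (simp add: sum_distrib_left)
    also have "(\<Sum>s\<in>N v - blocks v. card (N s)) = (\<Sum>s\<in>N v - blocks v. 1 + card (N s \<inter> (N v - blocks v)))"
      using card_nbrs_S same by (intro sum.cong) auto
    also have "\<dots> = card (N v - blocks v) + degsum (N v - blocks v)" by (simp add: sum.distrib sum_Suc degsum_def)
    also have "y v / ?d * real (card (N v - blocks v) + degsum (N v - blocks v)) \<le> y v / ?d * (3 * (?d - real ?L))"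
      using degsum_off_blocks[of v] L y_v_pos by (intro mult_left_mono) auto
    finally have "(3 - e) * y v \<le> ?L * (y v / (real ?d - 4 - e)) + y v / ?d * (3 * (?d - real ?L))"
      using main tot hub by linarith
    hence "(3 - e) * y v \<le> (?L / (real ?d - 4 - e) + 3 * (?d - real ?L) / ?d) * y v" by (simp only: factor)
    hence "3 - e \<le> ?L / (real ?d - 4 - e) + 3 * (?d - real ?L) / ?d" using y_v_pos by (metis mult_le_cancel_right_pos)
    also have "3 * (real ?d - real ?L) / ?d = 3 - ?L * (3 / ?d)"
    proof -
      have "N v \<noteq> {}" using True by auto
      thus ?thesis by (simp add: right_diff_distrib diff_divide_distrib)
    qed
    also have "?L / (real ?d - 4 - e) + (3 - ?L * (3 / ?d)) = 3 - ?L * (3 / ?d - 1 / (real ?d - 4 - e))"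
      by (simp add: right_diff_distrib)
    also have "\<dots> \<le> 3 - 4 * (3 / ?d - 1 / (real ?d - 4 - e))"
    proof (intro diff_left_mono mult_right_mono)
      show "0 \<le> 3 / real ?d - 1 / (real ?d - 4 - e)" using True e by (simp add: field_simps)
    qed (use card_blocks_ge_4[OF B] in simp)
    finally have "12 / ?d \<le> e + 4 / (real ?d - 4 - e)" by simp
    also have "\<dots> \<le> 4 / (real ?d + 5) + 4 / (real ?d - 427 / 100)"
    proof (rule add_mono)
      show "e \<le> 4 / (real ?d + 5)" using e d True by (simp add: field_simps)
      show "4 / (real ?d - 4 - e) \<le> 4 / (real ?d - 427 / 100)" using e True by (intro frac_le) auto
    qed
    finally have "3 * (real ?d + 5) * (real ?d - 427 / 100) \<le> ?d * (real ?d - 427 / 100) + ?d * (real ?d + 5)"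
      using True by (simp add: divide_simps) (simp add: algebra_simps)
    hence "0 \<le> ?d * (real ?d - 427 / 100) + ?d * (real ?d + 5) - 3 * (real ?d + 5) * (real ?d - 427 / 100)" by simp
    also have "\<dots> = 6405 / 100 - (real ?d * ?d + 146 / 100 * ?d)" by (simp add: field_simps)
    finally have "real ?d * ?d + 146 / 100 * ?d \<le> 6405 / 100" by simp
    moreover have "8 * 8 \<le> real ?d * ?d" using True by (intro mult_mono) auto
    ultimately show False using True by linarith
  next
    case False
    hence L4: "?L = 4" using block_eq_blocks_or_card_ge_8[OF B] Ld B by (auto simp: block_def)
    define f where "f = ?d - 4"
    have cf: "card (N v - blocks v) = f" using L L4 d6 by (simp add: f_def)
    have mu2: "2 * real f - 1 < mu" using False d6 d e by (simp add: f_def mu_eq)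
    have "y s \<le> y v / (mu - 2 * real f + 1)" if s: "s \<in> N v - blocks v" for s
    proof (rule closed_bound[OF _ _ _ mu2 s])
      fix q assume q: "q \<in> N v - blocks v"
      have "N q \<subseteq> insert v (N v)" by (rule N_subset_insert[OF far_empty])
      thus "N q \<subseteq> insert v (N v - blocks v)" using same[OF q] by blast
      have "N q \<inter> N v \<subseteq> N v - blocks v - {q}" using same[OF q] by auto
      hence "card (N q \<inter> N v) \<le> card (N v - blocks v - {q})" by (intro card_mono) auto
      thus "card (N q) \<le> f" using card_nbrs_S[of q] q cf d6 by (simp add: f_def)
    qed auto
    hence "(\<Sum>s\<in>N v - blocks v. y s) \<le> (\<Sum>s\<in>N v - blocks v. y v / (mu - 2 * real f + 1))" by (rule sum_mono)
    hence "(3 - e) * y v \<le> 4 * (y v / (real ?d - 4 - e)) + f * (y v / (mu - 2 * real f + 1))"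
      using main tot hub L4 cf by simp
    hence "(3 - e) * y v \<le> (4 / (real ?d - 4 - e) + f / (mu - 2 * real f + 1)) * y v" by (simp add: distrib_right)
    hence fin: "3 - e \<le> 4 / (real ?d - 4 - e) + f / (mu - 2 * real f + 1)" using y_v_pos by (metis mult_le_cancel_right_pos)
    have e': "1 / (k - e) \<le> 1 / (k - 27 / 100)" if "1 \<le> k" for k using e that by (intro divide_left_mono) auto
    \<comment> \<open>The tight case is \<open>d = 6\<close>: for \<open>e = 27 / 100\<close> it
      compares 2.73 with about 2.66.\<close>
    have "?d = 6 \<or> ?d = 7" using False d6 by linarith
    thus False
    proof
      assume "?d = 6"
      thus False using fin e'[of 2] e'[of 6] e d by (simp add: f_def mu_eq)
    next
      assume "?d = 7"
      thus False using fin e'[of 3] e'[of 5] e d by (simp add: f_def mu_eq)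
    qed
  qed
qed

text \<open>Summing the inequalities at all neighbours of \<open>v\<close> and exchanging the double
  sum gives \<open>(mu - 1) * \<Sum> y s \<le> d * y v + 2 * \<Sum> g s * y s\<close>, with
  \<open>g\<close> the degree inside \<open>N v\<close>. The inequality at \<open>v\<close> bounds
  the left side from below, and \<open>d * y s \<le> y v * (g s + 1)\<close> eliminates
  \<open>y\<close> on the right.\<close>

lemma second_order:
  "card (N v) * (card (N v) + 1) \<le> (\<Sum>s\<in>N v. card (N s \<inter> N v) * (card (N s \<inter> N v) + 1))"
proof -
  let ?d = "real (card (N v))" and ?g = "\<lambda>s. real (card (N s \<inter> N v))"
  have d: "real n = ?d + 1" using card_N_v by simp
  have main: "(3 - e) * y v \<le> (\<Sum>s\<in>N v. y s)" using y_sub[OF v_less] d by (simp add: mu_eq)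
  have "(\<Sum>s\<in>N v. (mu - 1 - ?g s) * y s) \<le> (\<Sum>s\<in>N v. y v + (\<Sum>w\<in>N s \<inter> N v. y w))"
  proof (rule sum_mono)
    fix s assume s: "s \<in> N v"
    have "N s = insert v (N s \<inter> N v)"
      using s N_subset_insert[OF far_empty, of s] by (auto simp: adj_commute)
    hence "(\<Sum>w\<in>N s. y w) = (\<Sum>w\<in>insert v (N s \<inter> N v). y w)" by (rule arg_cong)
    also have "\<dots> = y v + (\<Sum>w\<in>N s \<inter> N v. y w)" by (subst sum.insert) auto
    finally show "(mu - 1 - ?g s) * y s \<le> y v + (\<Sum>w\<in>N s \<inter> N v. y w)"
      using y_sub[OF N_less[OF s]] card_nbrs_S[OF s] by (simp add: algebra_simps)
  qed
  also have "\<dots> = ?d * y v + (\<Sum>s\<in>N v. \<Sum>w\<in>N s \<inter> N v. y w)" by (simp add: sum.distrib)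
  also have "(\<Sum>s\<in>N v. \<Sum>w\<in>N s \<inter> N v. y w) = (\<Sum>s\<in>N v. ?g s * y s)"
  proof -
    have "(\<Sum>s\<in>N v. \<Sum>w\<in>N s \<inter> N v. y w) = (\<Sum>s\<in>N v. \<Sum>w\<in>N v. if adj s w then y w else 0)"
    proof (rule sum.cong)
      fix s
      show "(\<Sum>w\<in>N s \<inter> N v. y w) = (\<Sum>w\<in>N v. if adj s w then y w else 0)"
        using sum.inter_restrict[OF finite_N, of y v "N s"] by (simp add: Int_commute)
    qed simp
    also have "\<dots> = (\<Sum>w\<in>N v. \<Sum>s\<in>N v. if adj s w then y w else 0)" by (rule sum.swap)
    also have "\<dots> = (\<Sum>w\<in>N v. ?g w * y w)"
    proof (rule sum.cong)
      fix w
      have "(\<Sum>s\<in>N v. if adj s w then y w else 0) = (\<Sum>s\<in>N v \<inter> N w. y w)"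
        using sum.inter_restrict[OF finite_N, of "\<lambda>_. y w" v "N w"] by (simp add: adj_commute)
      thus "(\<Sum>s\<in>N v. if adj s w then y w else 0) = ?g w * y w" by (simp add: Int_commute)
    qed simp
    finally show ?thesis .
  qed
  finally have "(mu - 1) * (\<Sum>s\<in>N v. y s) \<le> ?d * y v + 2 * (\<Sum>s\<in>N v. ?g s * y s)"
    by (simp add: algebra_simps sum.distrib sum_subtractf sum_distrib_left)
  moreover have "(mu - 1) * ((3 - e) * y v) \<le> (mu - 1) * (\<Sum>s\<in>N v. y s)"
    using main e n7 by (intro mult_left_mono) (auto simp: mu_eq)
  ultimately have 1: "((mu - 1) * (3 - e) - ?d) * y v \<le> 2 * (\<Sum>s\<in>N v. ?g s * y s)" by (simp add: algebra_simps)
  have 2: "?d * (\<Sum>s\<in>N v. ?g s * y s) \<le> y v * (\<Sum>s\<in>N v. ?g s * (?g s + 1))"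
    unfolding sum_distrib_left
  proof (rule sum_mono)
    fix s assume s: "s \<in> N v"
    have "card (N s) \<le> card (N v)" using card_mono[of "{..<n} - {s}" "N s"] N_subset[of s] N_less[of s] s card_N_v by simp
    hence "al * card (N s) \<le> al * ?d" using al by (intro mult_left_mono) auto
    moreover have "y s * ?d \<le> (card (N s) - al) * ?d" using y_le[of s] N_less[of s] s by (intro mult_right_mono) auto
    ultimately have "y s * ?d \<le> y v * card (N s)" by (simp add: y_v algebra_simps)
    hence "?g s * (y s * ?d) \<le> ?g s * (y v * card (N s))" by (intro mult_left_mono) auto
    thus "?d * (?g s * y s) \<le> y v * (?g s * (?g s + 1))" using card_nbrs_S[OF s] by (simp add: algebra_simps)
  qed
  have "2 * (?d + 1) \<le> (mu - 1) * (3 - e) - ?d"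
  proof -
    \<comment> \<open>The origin of the condition \<open>e * (real n + 4) \<le> 4\<close>.\<close>
    have "(mu - 1) * (3 - e) - ?d = 2 * (?d + 1) + (4 - e * (real n + 4)) + e * e"
      unfolding mu_eq d by (simp add: algebra_simps)
    thus ?thesis using e(3) zero_le_square[of e] by linarith
  qed
  hence "2 * (?d + 1) * y v \<le> 2 * (\<Sum>s\<in>N v. ?g s * y s)"
    using 1 y_v_pos mult_right_mono[of "2 * (?d + 1)" "(mu - 1) * (3 - e) - ?d" "y v"] by linarith
  hence "2 * ((?d + 1) * y v) \<le> 2 * (\<Sum>s\<in>N v. ?g s * y s)" by (simp only: mult.assoc)
  hence "(?d + 1) * y v \<le> (\<Sum>s\<in>N v. ?g s * y s)" by linarith
  hence "?d * ((?d + 1) * y v) \<le> ?d * (\<Sum>s\<in>N v. ?g s * y s)" by (rule mult_left_mono) simp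
  hence "y v * (?d * (?d + 1)) \<le> y v * (\<Sum>s\<in>N v. ?g s * (?g s + 1))" using 2 by (simp add: algebra_simps)
  hence "?d * (?d + 1) \<le> (\<Sum>s\<in>N v. ?g s * (?g s + 1))" using y_v_pos by simp
  hence "real (card (N v) * (card (N v) + 1)) \<le> real (\<Sum>s\<in>N v. card (N s \<inter> N v) * (card (N s \<inter> N v) + 1))"
    by (simp add: algebra_simps)
  thus ?thesis by (simp only: of_nat_le_iff)
qed

end

section \<open>From an eigenvector to a normalised subsolution\<close>

context tcc_free
begin

text \<open>Without isolated vertices every \<open>card (N u) - al\<close> is positive, so the
  quotient \<open>r\<close> is defined; dividing by its maximum makes the degree bound an equality
  at \<open>v\<close>.\<close>

lemma normalised_subsolution:
  assumes iso: "no_isolated n E" and n: "0 < n" and al: "0 \<le> al" "al < 1" and mu: "mu \<le> q_index n E"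
  obtains v y where "subsolution n E mu al v y"
proof -
  obtain z where z: "\<And>u. 0 \<le> z u" "\<exists>u<n. 0 < z u"
    "\<And>u. u < n \<Longrightarrow> q_index n E * z u \<le> (\<Sum>w\<in>N u. z u + z w)"
    using q_index_subsolution[OF simple n] by metis
  have deg: "1 \<le> card (N u)" if u: "u < n" for u
  proof -
    obtain e where e: "e \<in> E" "u \<in> e" using iso u unfolding no_isolated_def by blast
    then obtain a b where "e = {a, b}" using simple unfolding simple_graph_def by blast
    hence "N u \<noteq> {}" using e by (auto simp: nbrs_def insert_commute)
    thus ?thesis using finite_N[of u] by (simp add: Suc_le_eq card_gt_0_iff)
  qed
  define k where "k = (\<lambda>u. real (card (N u)) - al)"
  have k: "0 < k u" if "u < n" for u using deg[OF that] al unfolding k_def by linarith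
  define r where "r = (\<lambda>u. z u / k u)"
  have "Max (r ` {..<n}) \<in> r ` {..<n}" using n by (intro Max_in) auto
  then obtain v where v: "v < n" "r v = Max (r ` {..<n})" by auto
  have r_le: "r u \<le> r v" if "u < n" for u unfolding v(2) using that by (intro Max_ge) auto
  have rv: "0 < r v"
  proof -
    obtain u where "u < n" "0 < z u" using z(2) by blast
    hence "0 < r u" using k by (simp add: r_def)
    thus ?thesis using r_le[OF \<open>u < n\<close>] by simp
  qed
  show thesis
  proof (rule that[of v "\<lambda>u. z u / r v"], unfold_locales)
    show "v < n" by (rule v(1))
    show "1 \<le> card (N v)" by (rule deg[OF v(1)])
    have "z v \<noteq> 0" using rv by (auto simp: r_def)
    thus "z v / r v = card (N v) - al" by (simp add: r_def k_def)
    show "0 \<le> z u / r v" for u using z(1) rv by simp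
    show "z u / r v \<le> card (N u) - al" if u: "u < n" for u
    proof -
      have "r u = z u / k u" by (simp add: r_def)
      hence "z u \<le> r v * k u" using r_le[OF u] k[OF u] by (simp add: pos_divide_le_eq)
      hence "z u / r v \<le> k u" using rv by (simp add: pos_divide_le_eq mult.commute)
      thus ?thesis by (simp add: k_def)
    qed
    show "(mu - card (N u)) * (z u / r v) \<le> (\<Sum>w\<in>N u. z w / r v)" if u: "u < n" for u
    proof -
      have "mu * z u \<le> q_index n E * z u" using mu z(1) by (intro mult_right_mono) auto
      hence "(mu - card (N u)) * z u \<le> (\<Sum>w\<in>N u. z w)" using z(3)[OF u] by (simp add: sum.distrib algebra_simps)
      hence "(mu - card (N u)) * z u / r v \<le> (\<Sum>w\<in>N u. z w) / r v" using rv by (intro divide_right_mono) auto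
      thus ?thesis by (simp add: sum_divide_distrib)
    qed
  qed (use al in auto)
qed

end

section \<open>The extremal graphs\<close>

lemma in_K112_plus:
  "{i, j} \<in> K112_plus n \<longleftrightarrow> i \<noteq> j \<and> i < n \<and> j < n \<and> (i \<le> 1 \<or> j \<le> 1 \<or> {i, j} = {2, 3})"
  unfolding K112_plus_def by (auto simp: doubleton_eq_iff)

lemma simple_K112_plus: "simple_graph n (K112_plus n)"
  unfolding simple_graph_def K112_plus_def by auto

lemma nbrs_K112_plus:
  assumes "7 \<le> n"
  shows "nbrs (K112_plus n) 0 = insert 1 (insert 2 (insert 3 {4..<n}))"
    "nbrs (K112_plus n) 1 = insert 0 (insert 2 (insert 3 {4..<n}))"
    "nbrs (K112_plus n) 2 = {0, 1, 3}" "nbrs (K112_plus n) 3 = {0, 1, 2}"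
    "4 \<le> u \<Longrightarrow> u < n \<Longrightarrow> nbrs (K112_plus n) u = {0, 1}"
  using assms unfolding nbrs_def in_K112_plus by (auto simp: doubleton_eq_iff)

text \<open>With the parts \<open>{0, 1}\<close>, \<open>{2, 3}\<close>, \<open>{4..<n}\<close> the index is a root of the cubic \<open>h\<close> below, and
  \<open>h (n + 2 - e) = 4 n - 16 - e (n - e)\<^sup>2\<close>.\<close>
lemma q_index_K112_plus_ge:
  assumes n: "7 \<le> n" and e: "0 \<le> e" "e \<le> 1" and e2: "4 * real n - 16 \<le> e * (real n - e)\<^sup>2"
  shows "real n + 2 - e \<le> q_index n (K112_plus n)"
proof -
  \<comment> \<open>The row equation \<open>k - n = 2 * a + (n - 4) * b\<close> at a dominating
    vertex, multiplied by \<open>(k - 4) * (k - 2)\<close>.\<close>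
  define h where "h = (\<lambda>x. (x - real n) * (x - 4) * (x - 2) - 4 * (x - 2) - 2 * (real n - 4) * (x - 4))"
  have h: "h (real n + 2 - t) = 4 * real n - 16 - t * (real n - t)\<^sup>2" for t
    unfolding h_def by (simp add: power2_eq_square algebra_simps)
  have "\<exists>x. real n + 2 - e \<le> x \<and> x \<le> real n + 2 \<and> h x = 0"
  proof (rule IVT')
    show "h (real n + 2 - e) \<le> 0" unfolding h using e2 by simp
    show "0 \<le> h (real n + 2)" using h[of 0] n by simp
    show "real n + 2 - e \<le> real n + 2" using e by simp
    show "continuous_on {real n + 2 - e..real n + 2} h" unfolding h_def by (intro continuous_intros)
  qed
  then obtain k where k: "real n + 2 - e \<le> k" "h k = 0" by blast
  define a where "a = 2 / (k - 4)"
  define b where "b = 2 / (k - 2)"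
  have k8: "8 \<le> k" using k(1) e n by simp
  have "k - 4 \<noteq> 0" "k - 2 \<noteq> 0" using k8 by auto
  hence ab: "a * (k - 4) = 2" "b * (k - 2) = 2" unfolding a_def b_def by (metis nonzero_eq_divide_eq)+
  have row: "k - real n = 2 * a + (real n - 4) * b"
  proof -
    have "(k - real n) * ((k - 4) * (k - 2)) = 4 * (k - 2) + 2 * (real n - 4) * (k - 4)"
      using k(2) unfolding h_def by (simp add: algebra_simps)
    also have "\<dots> = 2 * (a * (k - 4)) * (k - 2) + (real n - 4) * (b * (k - 2)) * (k - 4)" unfolding ab by simp
    also have "\<dots> = (2 * a + (real n - 4) * b) * ((k - 4) * (k - 2))" by (simp add: algebra_simps)
    finally show ?thesis using k8 by simp
  qed
  define z where "z = (\<lambda>u::nat. if u \<le> 1 then 1 else if u \<le> 3 then a else b)"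
  have z: "z 0 = 1" "z 1 = 1" "z (Suc 0) = 1" "z 2 = a" "z 3 = a" "\<And>u. 4 \<le> u \<Longrightarrow> z u = b" by (auto simp: z_def)
  have "k \<le> q_index n (K112_plus n)"
  proof (rule q_index_ge_eigenvalue[OF simple_K112_plus, of 0 n z k])
    fix u assume u: "u < n"
    have S: "(\<Sum>w\<in>{4..<n}. 1 + z w) = (real n - 4) * (1 + b)"
      using n z(6) by (simp add: of_nat_diff)
    consider "u = 0" | "u = 1" | "u = 2" | "u = 3" | "4 \<le> u" by linarith
    thus "(\<Sum>w\<in>nbrs (K112_plus n) u. z u + z w) = k * z u"
    proof cases
      case 1
      have "(\<Sum>w\<in>nbrs (K112_plus n) u. z u + z w) = 2 + 2 * (1 + a) + (real n - 4) * (1 + b)"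
        unfolding 1 nbrs_K112_plus[OF n] using S z by simp
      thus ?thesis using row z 1 by (simp add: algebra_simps)
    next
      case 2
      have "(\<Sum>w\<in>nbrs (K112_plus n) u. z u + z w) = 2 + 2 * (1 + a) + (real n - 4) * (1 + b)"
        unfolding 2 nbrs_K112_plus[OF n] using S z by simp
      thus ?thesis using row z 2 by (simp add: algebra_simps)
    next
      case 3
      show ?thesis unfolding 3 nbrs_K112_plus[OF n] using ab z by (simp add: algebra_simps)
    next
      case 4
      show ?thesis unfolding 4 nbrs_K112_plus[OF n] using ab z by (simp add: algebra_simps)
    next
      case 5
      show ?thesis unfolding nbrs_K112_plus(5)[OF n 5 u] using ab z 5 by (simp add: algebra_simps)
    qed
  qed (use n z in auto)
  thus ?thesis using k(1) by simp
qed

lemma in_K1_join_K4_K1: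
  "{i, j} \<in> K1_join_K4_K1 \<longleftrightarrow> i \<noteq> j \<and> i < 6 \<and> j < 6 \<and>
     (i = 0 \<or> j = 0 \<or> (1 \<le> i \<and> i \<le> 4 \<and> 1 \<le> j \<and> j \<le> 4))"
  unfolding K1_join_K4_K1_def by (auto simp: doubleton_eq_iff)

lemma simple_K1_join_K4_K1: "simple_graph 6 K1_join_K4_K1"
  unfolding simple_graph_def K1_join_K4_K1_def by auto

lemma nbrs_K1_join_K4_K1:
  "nbrs K1_join_K4_K1 0 = insert 5 {1..4}"
  "1 \<le> u \<Longrightarrow> u \<le> 4 \<Longrightarrow> nbrs K1_join_K4_K1 u = insert 0 ({1..4} - {u})"
  "nbrs K1_join_K4_K1 5 = {0}"
  unfolding nbrs_def in_K1_join_K4_K1 by auto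

text \<open>With the classes \<open>{0}\<close>, \<open>{1..4}\<close>, \<open>{5}\<close>, the row
  equations reduce to the cubic \<open>h\<close>, which changes sign near 8.275. The bound must
  exceed 8.25, where \<open>(mu - 5) * 4\<close> reaches 13 in
  \<open>iso_K1_join_K4_K1\<close>.\<close>

lemma q_index_K1_join_K4_K1_ge: "827 / 100 \<le> q_index 6 K1_join_K4_K1"
proof -
  define h where "h = (\<lambda>x::real. (x - 5) * (x - 7) * (x - 1) - 4 * (x - 1) - (x - 7))"
  have "\<exists>x. 827 / 100 \<le> x \<and> x \<le> 9 \<and> h x = 0"
  proof (rule IVT')
    show "continuous_on {827 / 100..9} h" unfolding h_def by (intro continuous_intros)
  qed (auto simp: h_def)
  then obtain k where k: "827 / 100 \<le> k" "h k = 0" by blast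
  define a where "a = 1 / (k - 7)"
  define b where "b = 1 / (k - 1)"
  have ab: "a * (k - 7) = 1" "b * (k - 1) = 1" using k by (auto simp: a_def b_def)
  have row: "k - 5 = 4 * a + b"
  proof -
    have "(k - 5) * ((k - 7) * (k - 1)) = 4 * (k - 1) + (k - 7)"
      using k(2) unfolding h_def by (simp add: algebra_simps)
    also have "\<dots> = 4 * (a * (k - 7)) * (k - 1) + (b * (k - 1)) * (k - 7)" unfolding ab by simp
    also have "\<dots> = (4 * a + b) * ((k - 7) * (k - 1))" by (simp add: algebra_simps)
    finally show ?thesis using k by simp
  qed
  define z where "z = (\<lambda>u::nat. if u = 0 then 1 else if u \<le> 4 then a else b)"
  have z: "z 0 = 1" "\<And>u. 1 \<le> u \<Longrightarrow> u \<le> 4 \<Longrightarrow> z u = a" "z 5 = b" by (auto simp: z_def)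
  have "k \<le> q_index 6 K1_join_K4_K1"
  proof (rule q_index_ge_eigenvalue[OF simple_K1_join_K4_K1, of 0 z k])
    fix u :: nat assume u: "u < 6"
    consider "u = 0" | "1 \<le> u" "u \<le> 4" | "u = 5" using u by linarith
    thus "(\<Sum>w\<in>nbrs K1_join_K4_K1 u. z u + z w) = k * z u"
    proof cases
      case 1
      show ?thesis unfolding 1 nbrs_K1_join_K4_K1 using row z by simp
    next
      case 2
      have "(\<Sum>w\<in>{1..4} - {u}. z u + z w) = (\<Sum>w\<in>{1..4} - {u}. 2 * a)"
        using z 2 by (intro sum.cong) auto
      also have "\<dots> = 6 * a" using 2 by simp
      finally show ?thesis unfolding nbrs_K1_join_K4_K1(2)[OF 2] using ab z 2 by (simp add: algebra_simps)
    next
      case 3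
      show ?thesis unfolding 3 nbrs_K1_join_K4_K1 using ab z by (simp add: algebra_simps)
    qed
  qed (use z in auto)
  thus ?thesis using k(1) by simp
qed

text \<open>The vertices other than \<open>v\<close>, \<open>w\<close>, \<open>p\<close>,
  \<open>q\<close> are interchangeable, so any bijection of them onto \<open>{4..<n}\<close>
  completes the map.\<close>

lemma graph_iso_K112_plus:
  assumes n: "7 \<le> n" and d: "distinct [v, w, p, q]" "{v, w, p, q} \<subseteq> {0..<n}"
    and E: "\<And>u x. u < n \<Longrightarrow> x < n \<Longrightarrow> {u, x} \<in> E \<longleftrightarrow>
      u \<noteq> x \<and> (u \<in> {v, w} \<or> x \<in> {v, w} \<or> {u, x} = {p, q})"
  shows "graph_iso n E (K112_plus n)"
proof -
  let ?R = "{0..<n} - {v, w, p, q}"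
  have "card {v, w, p, q} = 4" using d(1) by simp
  hence "card ?R = card {4..<n}" using card_Diff_subset[OF _ d(2)] by simp
  from finite_same_card_bij[OF _ _ this] obtain g where g: "bij_betw g ?R {4..<n}" by auto
  define f where "f = (\<lambda>u. if u = v then 0 else if u = w then 1 else if u = p then 2 else if u = q then 3 else g u)"
  have "bij_betw f ?R {4..<n}" using g by (subst bij_betw_cong[of _ f g]) (auto simp: f_def)
  moreover have fvals: "f v = 0" "f w = 1" "f p = 2" "f q = 3" using d(1) by (auto simp: f_def)
  have "bij_betw f {v, w, p, q} {0, 1, 2, 3}"
  proof -
    have im: "f ` {v, w, p, q} = {0, 1, 2, 3}" using fvals by simp
    moreover have "inj_on f {v, w, p, q}"
      by (rule eq_card_imp_inj_on) (simp_all only: im, use d(1) in simp_all)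
    ultimately show ?thesis by (simp only: bij_betw_def)
  qed
  moreover have "{4..<n} \<inter> {0, 1, 2, 3} = {}" by simp
  ultimately have "bij_betw f (?R \<union> {v, w, p, q}) ({4..<n} \<union> {0, 1, 2, 3})" by (rule bij_betw_combine)
  moreover have "?R \<union> {v, w, p, q} = {0..<n}" using d(2) by blast
  moreover have "{4..<n} \<union> {0, 1, 2, 3} = {0..<n}" using n by auto
  ultimately have f: "bij_betw f {0..<n} {0..<n}" by simp
  have inj: "f u = f x \<longleftrightarrow> u = x" if "u < n" "x < n" for u x
    using f that unfolding bij_betw_def by (auto dest: inj_onD)
  have fn: "f u < n" if "u < n" for u using f that unfolding bij_betw_def by auto
  have ge: "4 \<le> g u" if "u \<in> ?R" for u using g that unfolding bij_betw_def by auto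
  have f123: "(f u \<le> 1 \<longleftrightarrow> u \<in> {v, w}) \<and> (f u = 2 \<longleftrightarrow> u = p) \<and> (f u = 3 \<longleftrightarrow> u = q)" if u: "u < n" for u
  proof (cases "u \<in> ?R")
    case True
    hence "f u = g u" by (auto simp: f_def)
    thus ?thesis using ge[OF True] True by auto
  next
    case False
    hence "u = v \<or> u = w \<or> u = p \<or> u = q" using u by auto
    thus ?thesis using d(1) fvals by (elim disjE) auto
  qed
  show ?thesis unfolding graph_iso_def
  proof (intro exI conjI allI impI)
    show "bij_betw f {0..<n} {0..<n}" by (rule f)
    fix u x assume u: "u < n" and x: "x < n"
    show "{u, x} \<in> E \<longleftrightarrow> {f u, f x} \<in> K112_plus n"
      unfolding E[OF u x] in_K112_plus doubleton_eq_iff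
      by (simp only: inj[OF u x] fn[OF u] fn[OF x] f123[OF u, THEN conjunct1] f123[OF x, THEN conjunct1]
          f123[OF u, THEN conjunct2, THEN conjunct1] f123[OF x, THEN conjunct2, THEN conjunct1]
          f123[OF u, THEN conjunct2, THEN conjunct2] f123[OF x, THEN conjunct2, THEN conjunct2] simp_thms)
  qed
qed

lemma graph_iso_K1_join_K4_K1:
  assumes d: "distinct [v, a, b, x, y, s]" "{v, a, b, x, y, s} = {0..<6}"
    and E: "\<And>i j. i < 6 \<Longrightarrow> j < 6 \<Longrightarrow> {i, j} \<in> E \<longleftrightarrow>
      i \<noteq> j \<and> (i = v \<or> j = v \<or> (i \<noteq> s \<and> j \<noteq> s))"
  shows "graph_iso 6 E K1_join_K4_K1"
proof -
  define f where "f = (\<lambda>u. if u = v then 0 else if u = a then 1 else if u = b then 2 else if u = x then 3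
     else if u = y then 4 else (5::nat))"
  have "bij_betw f {v, a, b, x, y, s} {0, 1, 2, 3, 4, 5}"
  proof -
    have "f v = 0" "f a = 1" "f b = 2" "f x = 3" "f y = 4" "f s = 5" using d(1) by (auto simp: f_def)
    hence im: "f ` {v, a, b, x, y, s} = {0, 1, 2, 3, 4, 5}" by simp
    moreover have "inj_on f {v, a, b, x, y, s}"
      by (rule eq_card_imp_inj_on) (simp_all only: im, use d(1) in simp_all)
    ultimately show ?thesis by (simp only: bij_betw_def)
  qed
  moreover have "{0, 1, 2, 3, 4, 5} = {0..<6::nat}" by auto
  ultimately have f: "bij_betw f {0..<6} {0..<6}" using d(2) by simp
  have inj: "f i = f j \<longleftrightarrow> i = j" if "i < 6" "j < 6" for i j
    using f that unfolding bij_betw_def by (auto dest: inj_onD)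
  have fn: "f i < 6" if "i < 6" for i using f that unfolding bij_betw_def by auto
  have f0: "f i = 0 \<longleftrightarrow> i = v" and f1: "1 \<le> f i \<longleftrightarrow> i \<noteq> v" and f5: "f i \<le> 4 \<longleftrightarrow> i \<noteq> s" if i: "i < 6" for i
  proof -
    have "i \<in> {v, a, b, x, y, s}" using d(2) i by simp
    thus "f i = 0 \<longleftrightarrow> i = v" "1 \<le> f i \<longleftrightarrow> i \<noteq> v" "f i \<le> 4 \<longleftrightarrow> i \<noteq> s" using d(1) by (auto simp: f_def)
  qed
  show ?thesis unfolding graph_iso_def
  proof (intro exI conjI allI impI)
    show "bij_betw f {0..<6} {0..<6}" by (rule f)
    fix i j :: nat assume i: "i < 6" and j: "j < 6"
    show "{i, j} \<in> E \<longleftrightarrow> {f i, f j} \<in> K1_join_K4_K1"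
      unfolding E[OF i j] in_K1_join_K4_K1
      by (simp only: inj[OF i j] fn[OF i] fn[OF j] f0[OF i] f0[OF j] f1[OF i] f1[OF j] f5[OF i] f5[OF j]) blast
  qed
qed

section \<open>Recognising the extremal graphs\<close>

context large_subsolution
begin

lemma iso_K112_plus: "graph_iso n E (K112_plus n)"
proof -
  have d6: "6 \<le> card (N v)" using card_N_v n7 by simp
  obtain w p q where w: "w \<in> N v" "N v - {w} \<subseteq> N w" "p \<in> N v - {w}" "q \<in> N v - {w}" "adj p q"
    "\<And>x y'. x \<in> N v - {w} \<Longrightarrow> y' \<in> N v - {w} \<Longrightarrow> adj x y' \<Longrightarrow> {x, y'} = {p, q}"
  proof (rule dominated_structure[OF d6 no_block second_order])
    fix w p q
    assume "w \<in> N v" "N v - {w} \<subseteq> N w" "p \<in> N v - {w}" "q \<in> N v - {w}" "adj p q"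
      "\<And>x y'. x \<in> N v - {w} \<Longrightarrow> y' \<in> N v - {w} \<Longrightarrow> adj x y' \<Longrightarrow> {x, y'} = {p, q}"
    thus thesis by (rule that)
  qed
  have Nv: "N v = {..<n} - {v}"
    using far_empty N_subset[of v] by (auto simp: far_def)
  have vall: "adj v u" if "u < n" "u \<noteq> v" for u
  proof -
    have "u \<in> N v" unfolding Nv using that by simp
    thus ?thesis by simp
  qed
  have wall: "adj w u" if "u < n" "u \<noteq> w" for u
  proof (cases "u = v")
    case True
    thus ?thesis using w(1) by (simp add: adj_commute)
  next
    case False
    hence "u \<in> N v - {w}" using that vall by simp
    hence "u \<in> N w" using w(2) by blast
    thus ?thesis by simp
  qed
  show ?thesis
  proof (rule graph_iso_K112_plus[OF n7])
    show "distinct [v, w, p, q]" using w(1,3-5) by auto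
    show "{v, w, p, q} \<subseteq> {0..<n}" using w(1,3,4) v_less N_less by auto
    fix u x assume u: "u < n" and x: "x < n"
    show "{u, x} \<in> E \<longleftrightarrow> u \<noteq> x \<and> (u \<in> {v, w} \<or> x \<in> {v, w} \<or> {u, x} = {p, q})"
      unfolding adj_def[symmetric]
    proof
      assume a: "adj u x"
      hence "u \<noteq> x" by auto
      moreover have "{u, x} = {p, q}" if "u \<notin> {v, w}" "x \<notin> {v, w}"
        by (rule w(6)) (use a that u x vall in auto)
      ultimately show "u \<noteq> x \<and> (u \<in> {v, w} \<or> x \<in> {v, w} \<or> {u, x} = {p, q})" by blast
    next
      assume a: "u \<noteq> x \<and> (u \<in> {v, w} \<or> x \<in> {v, w} \<or> {u, x} = {p, q})"
      thus "adj u x"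
        using vall[of u] vall[of x] wall[of u] wall[of x] u x w(5) by (auto simp: adj_commute doubleton_eq_iff)
    qed
  qed
qed

end

context subsolution
begin

text \<open>The first-order count suffices with \<open>al = 0\<close>. Degrees up to 3 allow too few
  edges, degree 4 would require 14 where \<open>block_degree_sum\<close> allows 13, and degree 5
  requires \<open>degsum\<close> 12, which forces a \<open>K_4\<close> and an isolated vertex in
  \<open>N v\<close>.\<close>

lemma iso_K1_join_K4_K1:
  assumes n6: "n = 6" and mu: "mu = 827 / 100" and al0: "al = 0"
  shows "graph_iso 6 E K1_join_K4_K1"
proof -
  let ?d = "card (N v)" and ?T = "\<Sum>t\<in>far v. card (N t \<inter> N v)"
  have cd: "card (far v) + ?d = 5" using card_far[OF v_less] n6 by simp
  have count: "(727 / 100 - real ?d) * ?d \<le> real (degsum (N v) + ?T)"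
    using first_order unfolding mu al0 by (simp add: algebra_simps)
  have deg: "card (N s \<inter> N v) \<le> ?d - 1" if "s \<in> N v" for s
  proof -
    have "N s \<inter> N v \<subseteq> N v - {s}" by auto
    from card_mono[OF _ this] show ?thesis using that by simp
  qed
  have D: "degsum (N v) \<le> ?d * (?d - 1)"
    unfolding degsum_def using sum_bounded_above[of "N v" "\<lambda>s. card (N s \<inter> N v)" "?d - 1"] deg by simp
  have le: "card (N t \<inter> N v) \<le> ?d" for t by (rule card_mono) auto
  have T: "?T \<le> card (far v) * ?d" using sum_bounded_above[of "far v" "\<lambda>t. card (N t \<inter> N v)" ?d] le by simp
  have "?d \<in> {1, 2, 3, 4, 5}" using cd deg_pos by auto
  moreover have False if "?d \<le> 3"
  proof -
    have "degsum (N v) + ?T \<le> ?d * (?d - 1) + card (far v) * ?d" using D T by (rule add_mono)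
    also have "\<dots> = 4 * ?d"
    proof -
      have "?d - 1 + card (far v) = 4" using cd deg_pos by simp
      thus ?thesis by (metis add_mult_distrib mult.commute)
    qed
    finally have "degsum (N v) + ?T \<le> 4 * ?d" .
    hence "real (degsum (N v) + ?T) \<le> real (4 * ?d)" by (simp only: of_nat_le_iff)
    hence "(727 / 100 - real ?d) * ?d \<le> 4 * real ?d" using count by simp
    hence "727 / 100 - real ?d \<le> 4" using deg_pos by (simp add: mult_le_cancel_right)
    thus False using that by simp
  qed
  ultimately consider (four) "?d = 4" | (five) "?d = 5" by force
  thus ?thesis
  proof cases
    case four
    have "real 13 < real (degsum (N v) + ?T)" using count four by simp
    hence DT: "13 < degsum (N v) + ?T" by (simp only: of_nat_less_iff)
    have "card (far v) = 1" using cd four by simp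
    then obtain t where t: "far v = {t}" by (rule card_1_singletonE)
    have "\<not> degsum (N v) \<le> 2 * ?d" using DT T t four by simp
    then obtain a b x y' where B: "block v a b x y'" using degsum_le_twice_card[of "N v" v] by blast
    have NvA: "N v = {a, b, x, y'}"
      using B four by (intro card_seteq[symmetric]) (auto simp: block_def)
    have "degsum (N v) = (\<Sum>s\<in>{a, b, x, y'}. card (N s \<inter> N v))" unfolding degsum_def using NvA by (rule sum.cong) simp
    moreover have "?T = card (N t \<inter> {a, b, x, y'})" using t NvA by simp
    ultimately have "degsum (N v) + ?T \<le> 13" using block_degree_sum[OF B, of t] t by (simp only: singletonI)
    thus ?thesis using DT by simp
  next
    case five
    have far: "far v = {}" using cd five by simp
    have "real 11 < real (degsum (N v) + ?T)" using count five by simp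
    hence DT: "11 < degsum (N v)" using far by simp
    have "\<not> degsum (N v) \<le> 2 * ?d" using DT five by simp
    then obtain a b x y' where B: "block v a b x y'" using degsum_le_twice_card[of "N v" v] by blast
    let ?A = "{a, b, x, y'}"
    have A: "?A \<subseteq> N v" "card ?A = 4" using B by (auto simp: block_def)
    have "card (N v - ?A) = 1" using card_Diff_subset[OF _ A(1)] A(2) five by simp
    then obtain s where s: "N v - ?A = {s}" by (rule card_1_singletonE)
    have "s \<in> N v - ?A" unfolding s by simp
    hence sA: "s \<in> N v" "s \<notin> ?A" by blast+
    have "N v = (N v - ?A) \<union> ?A" using A(1) by blast
    hence NvA: "N v = insert s ?A" unfolding s by blast
    have sn: "\<not> adj s u" if "u \<in> N v" for u
    proof (cases "u \<in> ?A")
      case True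
      thus ?thesis using block_closed[OF B _ True, of s] sA by (auto simp: adj_commute)
    next
      case False
      hence "u = s" using that NvA by blast
      thus ?thesis by simp
    qed
    hence sN: "N s \<inter> N v = {}" by auto
    have "degsum (N v) = (\<Sum>u\<in>insert s ?A. card (N u \<inter> N v))"
      unfolding degsum_def using NvA by (rule sum.cong) simp
    also have "\<dots> = (\<Sum>u\<in>?A. card (N u \<inter> N v))"
      using sum.insert[OF _ sA(2), of "\<lambda>u. card (N u \<inter> N v)"] sN by (simp del: sum.insert)
    also have "\<dots> = card (N a \<inter> N v) + card (N b \<inter> N v) + card (N x \<inter> N v) + card (N y' \<inter> N v)"
      using B by (simp add: block_def)
    finally have sum: "degsum (N v) = card (N a \<inter> N v) + card (N b \<inter> N v) + card (N x \<inter> N v) + card (N y' \<inter> N v)" .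
    have deg3: "card (N u \<inter> N v) \<le> 3" if "u \<in> ?A" for u using blocks_degree block_subset_blocks[OF B] that by blast
    \<comment> \<open>A nonadjacent pair would leave at most \<open>2 + 3 * 3 = 11\<close>.\<close>
    have xy: "adj x y'"
    proof (rule ccontr)
      assume "\<not> adj x y'"
      moreover have "x \<in> N v" using A(1) by blast
      hence "\<not> adj x s" using sn[of x] by (simp add: adj_commute)
      ultimately have "s \<notin> N x" "x \<notin> N x" "y' \<notin> N x" by simp_all
      hence "N x \<inter> N v \<subseteq> {a, b}" unfolding NvA by blast
      from card_mono[OF _ this] have "card (N x \<inter> N v) \<le> 2" by (auto simp: card_insert_if split: if_splits)
      thus False using sum DT deg3[of a] deg3[of b] deg3[of y'] by simp
    qed
    have "N v = {..<n} - {v}" using far N_subset[of v] by (auto simp: far_def)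
    hence Nv: "N v = {..<6} - {v}" unfolding n6 .
    have vall: "adj v u" if "u < 6" "u \<noteq> v" for u
  proof -
    have "u \<in> N v" unfolding Nv using that by simp
    thus ?thesis by simp
  qed
    show ?thesis
    proof (rule graph_iso_K1_join_K4_K1)
      show "distinct [v, a, b, x, y', s]" using B sA by (auto simp: block_def)
      have "insert v (N v) = {..<6}" using Nv v_less n6 by auto
      moreover have "{v, a, b, x, y', s} = insert v (N v)" unfolding NvA by blast
      ultimately show all: "{v, a, b, x, y', s} = {0..<6}" by (simp only: lessThan_atLeast0)
      fix i j :: nat assume i: "i < 6" and j: "j < 6"
      hence ij: "i \<in> {v, a, b, x, y', s}" "j \<in> {v, a, b, x, y', s}" using all by auto
      show "{i, j} \<in> E \<longleftrightarrow> i \<noteq> j \<and> (i = v \<or> j = v \<or> (i \<noteq> s \<and> j \<noteq> s))"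
        unfolding adj_def[symmetric]
      proof
        assume e: "adj i j"
        have "i \<noteq> j" using e by auto
        moreover have "i \<noteq> s \<and> j \<noteq> s" if "i \<noteq> v" "j \<noteq> v"
          using sn[of i] sn[of j] e vall[of i] vall[of j] that i j by (auto simp: adj_commute)
        ultimately show "i \<noteq> j \<and> (i = v \<or> j = v \<or> (i \<noteq> s \<and> j \<noteq> s))" by blast
      next
        assume h: "i \<noteq> j \<and> (i = v \<or> j = v \<or> (i \<noteq> s \<and> j \<noteq> s))"
        show "adj i j"
        proof (cases "i = v \<or> j = v")
          case True
          thus ?thesis using vall[of i] vall[of j] h i j by (auto simp: adj_commute)
        next
          case False
          hence "i \<in> ?A" "j \<in> ?A" "i \<noteq> j" using h ij by auto
          thus ?thesis using B xy unfolding block_def by (auto simp: adj_commute)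
        qed
      qed
    qed
  qed
qed

end

text \<open>The choice is the minimum of \<open>4 / (n + 4)\<close> and \<open>27 / 100\<close>.
  There is little room: for \<open>n = 7\<close> the last inequality already needs
  \<open>e > 0.26\<close>.\<close>

lemma index_gap:
  fixes n :: nat
  assumes n: "7 \<le> n"
  obtains e :: real where "0 \<le> e" "e \<le> 27 / 100" "e * (real n + 4) \<le> 4" "4 * real n - 16 \<le> e * (real n - e)\<^sup>2"
proof (cases "4 / (real n + 4) \<le> 27 / 100")
  case True
  let ?e = "4 / (real n + 4)"
  have "real n + 4 \<noteq> 0" by linarith
  hence en: "?e * (real n + 4) = 4" by (metis nonzero_eq_divide_eq)
  have "?e * real n \<le> 4" using en by (simp add: field_simps)
  \<comment> \<open>For \<open>t = ?e\<close> the product \<open>t * real n\<close> is at most 4, so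
    the bracket \<open>16 - 2 * (t * real n)\<close> is positive.\<close>
  moreover have "(real n - t)\<^sup>2 = (real n + 4) * (real n - 4) + (16 - 2 * (t * real n)) + t\<^sup>2" for t
    by (simp add: power2_eq_square algebra_simps)
  ultimately have "(real n + 4) * (real n - 4) \<le> (real n - ?e)\<^sup>2"
    using zero_le_power2[of ?e] by (simp only:)
  hence "?e * ((real n + 4) * (real n - 4)) \<le> ?e * (real n - ?e)\<^sup>2" by (intro mult_left_mono) auto
  moreover have "?e * ((real n + 4) * (real n - 4)) = 4 * real n - 16" using en by (simp add: mult.assoc[symmetric])
  ultimately show thesis using that[of ?e] True en by simp
next
  case False
  \<comment> \<open>The difference of the two sides in the next line is a parabola in
    \<open>n\<close> with its vertex near 7.7; subtracting this square leaves positive terms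
    only.\<close>
  have "0 \<le> 27 / 100 * (real n - 77 / 10)\<^sup>2" by simp
  hence "4 * real n - 16 \<le> 27 / 100 * (real n - 27 / 100)\<^sup>2"
    using n by (simp add: power2_eq_square algebra_simps)
  moreover have "27 / 100 * (real n + 4) \<le> 4" using False by (simp add: field_simps)
  ultimately show thesis using that[of "27 / 100"] by simp
qed

thm_deps symmetric_mat_has_eigenvalue simple_graph_nbrs degree_eq_card_nbrs signless_laplacian_row
  finite_eigenvalues_signless_laplacian q_index_ge_eigenvalue q_index_subsolution
  hub_cycle_has_three_chords card_ge_2E card_ge_3E tcc_free.in_N tcc_free.adj_commute
  tcc_free.adj_irrefl tcc_free.adj_less tcc_free.finite_N tcc_free.N_subset tcc_free.no_path5
  tcc_free.no_path6_skip4 tcc_free.no_path6_skip5 tcc_free.block_closed tcc_free.block_attached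
  tcc_free.block_attached_hub tcc_free.block_swap tcc_free.block_flip
  tcc_free.block_attached_unique tcc_free.block_attached_card_le_2
  tcc_free.block_attached_card_le_1 tcc_free.degsum_remove tcc_free.min_degree_2_core
  tcc_free.degsum_le_twice_card tcc_free.dense_has_short_cycle tcc_free.no_P3_P2_attached
  tcc_free.no_P4_attached tcc_free.no_claw_attached tcc_free.fin_S tcc_free.S_iff tcc_free.Z_iff
  tcc_free.ex_outside4 tcc_free.complete_attachment_sparse tcc_free.square_attachment_sparse
  tcc_free.triangle_attachment_sparse_aux tcc_free.triangle_attachment_sparse
  tcc_free.nonneighbour_sparse_no_block tcc_free.blocks_subset tcc_free.block_subset_blocks
  tcc_free.blocks_closed tcc_free.blocks_degree tcc_free.blocks_attached tcc_free.degsum_blocks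
  tcc_free.degsum_off_blocks tcc_free.block_eq_blocks_or_card_ge_8 tcc_free.degsum_le_blocks
  tcc_free.finite_far tcc_free.far_iff tcc_free.card_far tcc_free.block_far_sparse
  tcc_free.low_degree_far_sparse tcc_free.closed_part_sum tcc_free.dominated_structure
  tcc_free.card_nbrs_split tcc_free.N_subset_insert tcc_free.double_count tcc_free.sum_card_nbrs
  tcc_free.card_blocks_ge_4 tcc_free.block_degree_sum subsolution.N_less subsolution.y_v_pos
  subsolution.sum_y_le subsolution.first_order subsolution.closed_bound subsolution.blocks_bound
  large_subsolution.al_mult large_subsolution.e_le large_subsolution.count_real
  large_subsolution.count large_subsolution.count_low large_subsolution.degree_ge_5
  large_subsolution.far_empty_if_no_block large_subsolution.block_unattached
  large_subsolution.block_attached_impossible large_subsolution.far_empty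
  large_subsolution.card_N_v large_subsolution.card_nbrs_S large_subsolution.no_block
  large_subsolution.second_order tcc_free.normalised_subsolution in_K112_plus simple_K112_plus
  nbrs_K112_plus q_index_K112_plus_ge in_K1_join_K4_K1 simple_K1_join_K4_K1 nbrs_K1_join_K4_K1
  q_index_K1_join_K4_K1_ge graph_iso_K112_plus graph_iso_K1_join_K4_K1
  large_subsolution.iso_K112_plus subsolution.iso_K1_join_K4_K1 index_gap

theorem theorem1p1:
  fixes n :: nat and E :: "nat set set"
  assumes "simple_graph n E" and "no_isolated n E" and "n \<ge> 6"
  shows "(n = 6 \<and> q_index n E \<ge> q_index 6 K1_join_K4_K1 \<and> \<not> graph_iso n E K1_join_K4_K1
            \<longrightarrow> has_trebly_chorded_cycle_at_vertex E)
       \<and> (n \<ge> 7 \<and> q_index n E \<ge> q_index n (K112_plus n) \<and> \<not> graph_iso n E (K112_plus n)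
            \<longrightarrow> has_trebly_chorded_cycle_at_vertex E)"
proof (intro conjI impI; elim conjE; rule ccontr)
  assume n: "n = 6" and q: "q_index 6 K1_join_K4_K1 \<le> q_index n E"
    and ni: "\<not> graph_iso n E K1_join_K4_K1" and nt: "\<not> has_trebly_chorded_cycle_at_vertex E"
  interpret tcc_free n E using assms(1) nt by unfold_locales
  have mu: "827 / 100 \<le> q_index n E" using q q_index_K1_join_K4_K1_ge by simp
  obtain v y where "subsolution n E (827 / 100) 0 v y"
    by (rule normalised_subsolution[OF assms(2) _ _ _ mu, of 0]) (use n in auto)
  then interpret subsolution n E "827 / 100" 0 v y .
  show False using iso_K1_join_K4_K1 n ni by simp
next
  assume n: "7 \<le> n" and q: "q_index n (K112_plus n) \<le> q_index n E"
    and ni: "\<not> graph_iso n E (K112_plus n)" and nt: "\<not> has_trebly_chorded_cycle_at_vertex E"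
  interpret tcc_free n E using assms(1) nt by unfold_locales
  obtain e :: real where e: "0 \<le> e" "e \<le> 27 / 100" "e * (real n + 4) \<le> 4" "4 * real n - 16 \<le> e * (real n - e)\<^sup>2"
    using index_gap[OF n] .
  have mu: "real n + 2 - e \<le> q_index n E" using q q_index_K112_plus_ge[OF n e(1) _ e(4)] e(2) by simp
  obtain v y where s: "subsolution n E (real n + 2 - e) (1 / (real n + 4)) v y"
    by (rule normalised_subsolution[OF assms(2) _ _ _ mu, of "1 / (real n + 4)"]) (use n in auto)
  interpret large_subsolution n E "real n + 2 - e" "1 / (real n + 4)" v y e
    using s n e by (intro large_subsolution.intro large_subsolution_axioms.intro) auto
  show False using iso_K112_plus ni by simp
qed

end
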